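(* Let $k\ge3$ and let $V\subset\mathbb{C}^k$ be an algebraic variety of codimension $2$. Then there exist a point $p\in\mathbb{C}^k$ and a sequence $\{F_n\}_{n\ge0}$ of holomorphic automorphisms of $\mathbb{C}^k$, each having $p$ as an attracting fixed point, such that the basin of attraction \[ \Omega_{\{F_n\}}=\{z\in\mathbb{C}^k: F_n\circ\cdots\circ F_0(z)\to p \text{ as } n\to\infty\} \] is a piecewise smooth Short $\mathbb{C}^k$ with $\Omega_{\{F_n\}}\cap V=\emptyset$.
   Context: A Short $\mathbb{C}^k$ is a domain $\Omega\subset\mathbb{C}^k$ such that: (1) $\Omega=\bigcup_{j\ge1}\Omega_j$ with $\Omega_j\subset\Omega_{j+1}$ and each $\Omega_j$ biholomorphic to the unit ball of $\mathbb{C}^k$; (2) the infinitesimal Kobayashi pseudometric of $\Omega$ vanishes identically; (3) $\Omega$ carries a non-constant plurisubharmonic function that is bounded above. A domain $D\subset\mathbb{C}^k$ is piecewise smooth (pseudoconvex) if $D=\bigcap_{i=1}^n D_i$ where each $D_i=\{\rho_i<0\}$ is a pseudoconvex domain with $C^\infty$ boundary, $\rho_i$ a $C^\infty$ defining function with $\nabla\rho_i\neq0$ on $\partial D_i$, and $d\rho_{i_1}\wedge\cdots\wedge d\rho_{i_l}\ne0$ on $\{z\in\partial D:\rho_{i_1}(z)=\cdots=\rho_{i_l}(z)=0\}$ for all $1\le i_1<\cdots<i_l\le n$. *)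

theory Defs
  imports "HOL-Analysis.Analysis"
begin

definition holo_map :: "(complex ^ 'n) set \<Rightarrow> (complex ^ 'n \<Rightarrow> complex ^ 'm) \<Rightarrow> bool" where
  "holo_map S f \<longleftrightarrow> open S \<and>
     (\<forall>z\<in>S. \<exists>L. (f has_derivative L) (at z) \<and> (\<forall>c v. L (c *s v) = c *s L v))"

definition biholomorphic :: "(complex ^ 'n) set \<Rightarrow> (complex ^ 'n) set \<Rightarrow> bool" where
  "biholomorphic S T \<longleftrightarrow> (\<exists>f g. holo_map S f \<and> holo_map T g \<and> f ` S = T \<and>
      (\<forall>z\<in>S. g (f z) = z) \<and> (\<forall>w\<in>T. f (g w) = w))"

definition holo_automorphism :: "(complex ^ 'n \<Rightarrow> complex ^ 'n) \<Rightarrow> bool" where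
  "holo_automorphism F \<longleftrightarrow> holo_map UNIV F \<and> bij F \<and> holo_map UNIV (inv F)"

definition attracting_fixed_point :: "(complex ^ 'n \<Rightarrow> complex ^ 'n) \<Rightarrow> complex ^ 'n \<Rightarrow> bool" where
  "attracting_fixed_point F p \<longleftrightarrow> F p = p \<and>
     (\<forall>lam v. v \<noteq> 0 \<and> frechet_derivative F (at p) v = lam *s v \<longrightarrow> cmod lam < 1)"

fun comp_seq :: "(nat \<Rightarrow> ('a \<Rightarrow> 'a)) \<Rightarrow> nat \<Rightarrow> 'a \<Rightarrow> 'a" where
  "comp_seq F 0 = F 0"
| "comp_seq F (Suc n) = F (Suc n) \<circ> comp_seq F n"

definition basin :: "(nat \<Rightarrow> (complex ^ 'n \<Rightarrow> complex ^ 'n)) \<Rightarrow> complex ^ 'n \<Rightarrow> (complex ^ 'n) set" where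
  "basin F p = {z. (\<lambda>n. comp_seq F n z) \<longlonglongrightarrow> p}"

inductive_set poly_fun :: "(complex ^ 'n \<Rightarrow> complex) set" where
  const: "(\<lambda>z. c) \<in> poly_fun"
| coord: "(\<lambda>z. z $ i) \<in> poly_fun"
| add: "f \<in> poly_fun \<Longrightarrow> g \<in> poly_fun \<Longrightarrow> (\<lambda>z. f z + g z) \<in> poly_fun"
| mult: "f \<in> poly_fun \<Longrightarrow> g \<in> poly_fun \<Longrightarrow> (\<lambda>z. f z * g z) \<in> poly_fun"

definition algebraic_set :: "(complex ^ 'n) set \<Rightarrow> bool" where
  "algebraic_set V \<longleftrightarrow> (\<exists>P. P \<subseteq> poly_fun \<and> V = {z. \<forall>f\<in>P. f z = 0})"

definition regular_point_dim :: "(complex ^ 'n) set \<Rightarrow> complex ^ 'n \<Rightarrow> nat \<Rightarrow> bool" where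
  "regular_point_dim V z d \<longleftrightarrow> z \<in> V \<and>
     (\<exists>U W \<phi> \<psi> I. z \<in> U \<and> holo_map U \<phi> \<and> holo_map W \<psi> \<and> \<phi> ` U = W \<and>
        (\<forall>x\<in>U. \<psi> (\<phi> x) = x) \<and> (\<forall>w\<in>W. \<phi> (\<psi> w) = w) \<and> card (I :: 'n set) = d \<and>
        \<phi> ` (V \<inter> U) = {w\<in>W. \<forall>i. i \<notin> I \<longrightarrow> w $ i = 0})"

definition has_dimension :: "(complex ^ 'n) set \<Rightarrow> nat \<Rightarrow> bool" where
  "has_dimension V d \<longleftrightarrow> (\<exists>z. regular_point_dim V z d) \<and>
     (\<forall>z d'. regular_point_dim V z d' \<longrightarrow> d' \<le> d)"

definition algebraic_variety_codim :: "(complex ^ 'n) set \<Rightarrow> nat \<Rightarrow> bool" where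
  "algebraic_variety_codim V c \<longleftrightarrow> algebraic_set V \<and> c \<le> CARD('n) \<and> has_dimension V (CARD('n) - c)"

definition holo_disc :: "(complex \<Rightarrow> complex ^ 'n) \<Rightarrow> bool" where
  "holo_disc f \<longleftrightarrow> (\<forall>t\<in>ball 0 1. \<exists>w. (f has_derivative (\<lambda>h. h *s w)) (at t))"

definition kobayashi :: "(complex ^ 'n) set \<Rightarrow> complex ^ 'n \<Rightarrow> complex ^ 'n \<Rightarrow> real" where
  "kobayashi \<Omega> z v = Inf {\<alpha>::real. \<alpha> > 0 \<and> (\<exists>f w. holo_disc f \<and> f ` ball 0 1 \<subseteq> \<Omega> \<and> f 0 = z \<and>
       (f has_derivative (\<lambda>h. h *s w)) (at 0) \<and> complex_of_real \<alpha> *s w = v)}"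

definition usc_on :: "(complex ^ 'n) set \<Rightarrow> (complex ^ 'n \<Rightarrow> real) \<Rightarrow> bool" where
  "usc_on S u \<longleftrightarrow> (\<forall>z\<in>S. \<forall>c. u z < c \<longrightarrow> (\<forall>\<^sub>F y in at z within S. u y < c))"

definition psh :: "(complex ^ 'n) set \<Rightarrow> (complex ^ 'n \<Rightarrow> real) \<Rightarrow> bool" where
  "psh S u \<longleftrightarrow> usc_on S u \<and>
     (\<forall>a b. (\<forall>\<zeta>. cmod \<zeta> \<le> 1 \<longrightarrow> a + \<zeta> *s b \<in> S) \<longrightarrow>
        set_integrable lborel {0..2*pi} (\<lambda>\<theta>. u (a + cis \<theta> *s b)) \<and>
        u a \<le> (1 / (2*pi)) * (LINT \<theta>:{0..2*pi}|lborel. u (a + cis \<theta> *s b)))"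

definition short_Ck :: "(complex ^ 'n) set \<Rightarrow> bool" where
  "short_Ck \<Omega> \<longleftrightarrow> open \<Omega> \<and> connected \<Omega> \<and> \<Omega> \<noteq> {} \<and>
     (\<exists>\<Omega>s :: nat \<Rightarrow> (complex ^ 'n) set. \<Omega> = (\<Union>j. \<Omega>s j) \<and> (\<forall>j. \<Omega>s j \<subseteq> \<Omega>s (Suc j)) \<and>
        (\<forall>j. biholomorphic (\<Omega>s j) (ball 0 1))) \<and>
     (\<forall>z\<in>\<Omega>. \<forall>v. kobayashi \<Omega> z v = 0) \<and>
     (\<exists>u. psh \<Omega> u \<and> (\<exists>M. \<forall>z\<in>\<Omega>. u z \<le> M) \<and> (\<exists>x\<in>\<Omega>. \<exists>y\<in>\<Omega>. u x \<noteq> u y))"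

fun iter_dderiv :: "(complex ^ 'n \<Rightarrow> real) \<Rightarrow> (complex ^ 'n) list \<Rightarrow> complex ^ 'n \<Rightarrow> real" where
  "iter_dderiv \<rho> [] = \<rho>"
| "iter_dderiv \<rho> (v # vs) = (\<lambda>q. frechet_derivative (iter_dderiv \<rho> vs) (at q) v)"

definition smooth_fun :: "(complex ^ 'n \<Rightarrow> real) \<Rightarrow> bool" where
  "smooth_fun \<rho> \<longleftrightarrow> (\<forall>vs q. iter_dderiv \<rho> vs differentiable (at q))"

text \<open>Levi pseudoconvexity of {rho < 0}: at boundary points, the Levi form
  (1/4)(D^2 rho(w,w) + D^2 rho(iw,iw)) is nonnegative on the complex tangent space
  {w. d rho(w) = 0 and d rho(iw) = 0}.\<close>
definition levi_pseudoconvex :: "(complex ^ 'n \<Rightarrow> real) \<Rightarrow> bool" where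
  "levi_pseudoconvex \<rho> \<longleftrightarrow> (\<forall>p\<in>frontier {z. \<rho> z < 0}. \<forall>w.
     frechet_derivative \<rho> (at p) w = 0 \<and> frechet_derivative \<rho> (at p) (\<i> *s w) = 0 \<longrightarrow>
     iter_dderiv \<rho> [w, w] p + iter_dderiv \<rho> [\<i> *s w, \<i> *s w] p \<ge> 0)"

definition piecewise_smooth_domain :: "(complex ^ 'n) set \<Rightarrow> bool" where
  "piecewise_smooth_domain D \<longleftrightarrow> (\<exists>(n::nat) (\<rho> :: nat \<Rightarrow> complex ^ 'n \<Rightarrow> real). n \<ge> 1 \<and>
     D = (\<Inter>i<n. {z. \<rho> i z < 0}) \<and>
     (\<forall>i<n. smooth_fun (\<rho> i) \<and> connected {z. \<rho> i z < 0} \<and> {z. \<rho> i z < 0} \<noteq> {} \<and>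
        (\<forall>z\<in>frontier {z. \<rho> i z < 0}. (\<exists>w. frechet_derivative (\<rho> i) (at z) w \<noteq> 0)) \<and>
        levi_pseudoconvex (\<rho> i)) \<and>
     (\<forall>S\<subseteq>{..<n}. S \<noteq> {} \<longrightarrow> (\<forall>z\<in>frontier D. (\<forall>i\<in>S. \<rho> i z = 0) \<longrightarrow>
        (\<forall>c :: nat \<Rightarrow> real. (\<forall>w. (\<Sum>i\<in>S. c i * frechet_derivative (\<rho> i) (at z) w) = 0)
            \<longrightarrow> (\<forall>i\<in>S. c i = 0)))))"

end

theory Submission
  imports Defs "HOL-Complex_Analysis.Cauchy_Integral_Formula"
begin

text \<open>
  In coordinates \<open>(x\<^sub>1, \<dots>, x\<^sub>m, y)\<close>, \<open>m = k - 1\<close>, consider the polynomial automorphisms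
  \<open>(x, y) \<mapsto> (x\<^sub>1\<^sup>2 + \<eta>\<^sub>n y, x\<^sub>2\<^sup>2 + \<eta>\<^sub>n x\<^sub>1, \<dots>, x\<^sub>m\<^sup>2 + \<eta>\<^sub>n x\<^bsub>m-1\<^esub>, \<eta>\<^sub>n x\<^sub>m)\<close>
  with couplings \<open>\<eta>\<^sub>n\<close> decreasing very fast.  The \<open>2\<^sup>n\<close>-th root of the modulus of the
  \<open>i\<close>-th coordinate of the \<open>n\<close>-th iterate converges to a continuous plurisubharmonic \<open>U\<^sub>i\<close>, and the basin
  of the origin is the set where all \<open>U\<^sub>i < 1\<close>.  Where \<open>U\<^sub>i > 0\<close>, \<open>ln U\<^sub>i\<close> is locally the real part of a
  holomorphic function that is close to a scaled logarithm of the \<open>i\<close>-th coordinate of a late iterate; this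
  yields smooth, Levi flat, transversal boundary pieces.  The basin is an increasing union of preimages of a
  ball on which the iterates and their derivatives tend to zero, hence the Kobayashi metric vanishes.

  The region where some \<open>|x\<^sub>i| \<ge> 3\<close> dominates all coordinates escapes to infinity.  A variety of codimension two
  is moved into this region by an affine map: it suffices to find a complex line missing the variety
  in a direction that is not asymptotic to it.  If every line in a given non-asymptotic direction met the
  variety, then locally the variety would be a graph over a hyperplane, that is, it would have a regular
  point of codimension one.
\<close>

section \<open>Holomorphic functions of several variables\<close>

text \<open>The coordinate \<open>y\<close> is left unsquared because a map with all
  \<open>k\<close> coordinates squared would not be injective; hence there are only
  \<open>k - 1\<close> potentials, and \<open>y\<close> follows a squared coordinate one step later.
  The couplings meet two demands. They beat the doubly exponential growth of orbits, so that each
  step moves a \<open>2 ^ n\<close>-th root by at most \<open>\<delta> n\<close>; and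
  \<open>\<delta> n\<close> is small against \<open>1 / 2 ^ n\<close>, the scale on which the
  \<open>2 ^ n\<close>-th roots of 1/2 and 2 differ from 1. Hence on \<open>U i = 1\<close> the
  \<open>i\<close>-th coordinate of every late iterate has modulus between 1/2 and 2. Transversality
  rests on this: in the coordinates of the \<open>N\<close>-th iterate the correction to the
  logarithm is holomorphic and of order \<open>\<delta> N\<close> on a ball of fixed radius, so
  Cauchy's estimate controls its derivative however distorted the iterate is. At zeros of the
  potentials \<open>ln (U i)\<close> breaks down, so a flat function cuts it off away from the
  boundary. Holomorphy is bare complex differentiability here. The inverse function theorem requires
  continuous derivatives, which are first obtained by slicing with complex lines.\<close>

lemma norm_vector_scalar_mult: "norm (c *s v) = cmod c * norm (v :: complex ^ 'n)"
  by (simp add: norm_vec_def norm_mult L2_set_right_distrib)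

lemma bounded_linear_scalar_line: "bounded_linear (\<lambda>t. t *s (b :: complex ^ 'n))"
  by (rule bounded_linear_intro[where K = "norm b"])
     (simp_all add: vec_eq_iff algebra_simps norm_vector_scalar_mult)

lemma has_derivative_vecI:
  fixes f :: "'a :: real_normed_vector \<Rightarrow> complex ^ 'n"
  assumes "\<And>i. ((\<lambda>z. f z $ i) has_derivative (\<lambda>h. L h $ i)) (at x)"
  shows "(f has_derivative L) (at x)"
proof -
  have "((\<lambda>z. f z \<bullet> b) has_derivative (\<lambda>h. L h \<bullet> b)) (at x)" if "b \<in> Basis" for b
  proof -
    obtain i u where b: "b = axis i u" using \<open>b \<in> Basis\<close> by (auto simp: Basis_vec_def)
    show ?thesis unfolding b inner_axis
      by (rule has_derivative_inner_left[OF assms])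
  qed
  then show ?thesis using has_derivative_componentwise_within[of f L x UNIV] by simp
qed

lemma has_derivative_vec_nth:
  assumes "(f has_derivative L) F"
  shows "((\<lambda>z. f z $ i) has_derivative (\<lambda>h. L h $ i)) F"
  using bounded_linear.has_derivative[OF bounded_linear_vec_nth assms] .

abbreviation fderiv :: "('a :: real_normed_vector \<Rightarrow> 'b :: real_normed_vector) \<Rightarrow> 'a \<Rightarrow> 'a \<Rightarrow> 'b" where
  "fderiv f z \<equiv> frechet_derivative f (at z)"

text \<open>Scalar counterpart of \<open>holo_map\<close>. Continuity of the derivative is not part
  of it; it follows from \<open>holo_fun_directional_derivative\<close>.\<close>

definition holo_fun :: "(complex ^ 'n) set \<Rightarrow> (complex ^ 'n \<Rightarrow> complex) \<Rightarrow> bool" where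
  "holo_fun S f \<longleftrightarrow> open S \<and>
     (\<forall>z\<in>S. \<exists>L. (f has_derivative L) (at z) \<and> (\<forall>c v. L (c *s v) = c * L v))"

lemma holo_funI:
  assumes "open S"
    and "\<And>z. z \<in> S \<Longrightarrow> \<exists>L. (f has_derivative L) (at z) \<and> (\<forall>c v. L (c *s v) = c * L v)"
  shows "holo_fun S f"
  using assms by (auto simp: holo_fun_def)

lemma holo_fun_open: "holo_fun S f \<Longrightarrow> open S"
  by (simp add: holo_fun_def)

lemma holo_fun_has_derivative:
  assumes "holo_fun S f" "z \<in> S"
  shows "(f has_derivative fderiv f z) (at z)"
  using assms unfolding holo_fun_def
  by (metis differentiable_def frechet_derivative_works)

lemma holo_fun_scale:
  assumes "holo_fun S f" "z \<in> S"
  shows "fderiv f z (c *s v) = c * fderiv f z v"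
  using assms unfolding holo_fun_def by (metis frechet_derivative_at)

lemma holo_map_iff: "holo_map S f \<longleftrightarrow> open S \<and> (\<forall>i. holo_fun S (\<lambda>z. f z $ i))"
proof (intro iffI conjI allI)
  fix i assume f: "holo_map S f"
  show "holo_fun S (\<lambda>z. f z $ i)"
  proof (rule holo_funI)
    fix z assume "z \<in> S"
    then obtain L where "(f has_derivative L) (at z)" "\<forall>c v. L (c *s v) = c *s L v"
      using f by (auto simp: holo_map_def)
    then show "\<exists>L. ((\<lambda>z. f z $ i) has_derivative L) (at z) \<and> (\<forall>c v. L (c *s v) = c * L v)"
      by (intro exI[of _ "\<lambda>h. L h $ i"]) (auto intro: has_derivative_vec_nth)
  qed (use f in \<open>simp add: holo_map_def\<close>)
next
  assume f: "open S \<and> (\<forall>i. holo_fun S (\<lambda>z. f z $ i))"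
  have "\<exists>L. (f has_derivative L) (at z) \<and> (\<forall>c v. L (c *s v) = c *s L v)" if "z \<in> S" for z
  proof (intro exI conjI allI)
    show "(f has_derivative (\<lambda>h. \<chi> i. fderiv (\<lambda>z. f z $ i) z h)) (at z)"
      by (rule has_derivative_vecI) (use f \<open>z \<in> S\<close> in \<open>auto intro: holo_fun_has_derivative\<close>)
    fix c v
    have "fderiv (\<lambda>z. f z $ i) z (c *s v)
        = c * fderiv (\<lambda>z. f z $ i) z v" for i
      using f \<open>z \<in> S\<close> by (intro holo_fun_scale[of S]) auto
    then show "(\<chi> i. fderiv (\<lambda>z. f z $ i) z (c *s v))
        = c *s (\<chi> i. fderiv (\<lambda>z. f z $ i) z v)"
      by (simp add: vec_eq_iff)
  qed
  then show "holo_map S f" using f by (auto simp: holo_map_def)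
qed (auto simp: holo_map_def)

lemma holo_map_has_derivative:
  assumes "holo_map S f" "z \<in> S"
  shows "(f has_derivative fderiv f z) (at z)"
  using assms unfolding holo_map_def
  by (metis differentiable_def frechet_derivative_works)

lemma holo_map_scale:
  assumes "holo_map S f" "z \<in> S"
  shows "fderiv f z (c *s v) = c *s fderiv f z v"
  using assms unfolding holo_map_def by (metis frechet_derivative_at)

lemma holo_map_continuous: "holo_map S f \<Longrightarrow> continuous_on S f"
  by (meson continuous_at_imp_continuous_on has_derivative_continuous holo_map_has_derivative)

lemma holo_fun_continuous: "holo_fun S f \<Longrightarrow> continuous_on S f"
  by (meson continuous_at_imp_continuous_on has_derivative_continuous holo_fun_has_derivative)

lemma holo_fun_comp_map:
  assumes f: "holo_map S f" and g: "holo_fun T g" and "f ` S \<subseteq> T"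
  shows "holo_fun S (\<lambda>z. g (f z))"
proof (rule holo_funI)
  fix z assume "z \<in> S"
  then have "f z \<in> T" using assms(3) by auto
  show "\<exists>L. ((\<lambda>z. g (f z)) has_derivative L) (at z) \<and> (\<forall>c v. L (c *s v) = c * L v)"
  proof (intro exI conjI allI)
    show "((\<lambda>z. g (f z)) has_derivative
        (\<lambda>h. fderiv g (f z) (fderiv f z h))) (at z)"
      using has_derivative_compose[OF holo_map_has_derivative[OF f \<open>z \<in> S\<close>]
          holo_fun_has_derivative[OF g \<open>f z \<in> T\<close>]] .
  qed (simp add: holo_map_scale[OF f \<open>z \<in> S\<close>] holo_fun_scale[OF g \<open>f z \<in> T\<close>])
qed (use f in \<open>simp add: holo_map_def\<close>)

lemma holo_map_comp:
  assumes "holo_map S f" "holo_map T g" "f ` S \<subseteq> T"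
  shows "holo_map S (\<lambda>z. g (f z))"
  using assms holo_fun_comp_map[OF assms(1) _ assms(3), of "\<lambda>w. g w $ i" for i] by (simp add: holo_map_iff)

lemma holo_fun_subset: "holo_fun S f \<Longrightarrow> open T \<Longrightarrow> T \<subseteq> S \<Longrightarrow> holo_fun T f"
  by (auto simp: holo_fun_def)

lemma holo_fun_const: "open S \<Longrightarrow> holo_fun S (\<lambda>z. c)"
  by (rule holo_funI) (auto intro!: exI[of _ "\<lambda>_. 0"])

lemma holo_fun_coord: "open S \<Longrightarrow> holo_fun S (\<lambda>z. z $ i)"
  by (rule holo_funI)
     (auto intro!: exI[of _ "\<lambda>h. h $ i"] has_derivative_vec_nth[OF has_derivative_ident])

lemma holo_fun_add:
  assumes f: "holo_fun S f" and g: "holo_fun S g"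
  shows "holo_fun S (\<lambda>z. f z + g z)"
proof (rule holo_funI)
  fix z assume z: "z \<in> S"
  show "\<exists>L. ((\<lambda>z. f z + g z) has_derivative L) (at z) \<and> (\<forall>c v. L (c *s v) = c * L v)"
    by (intro exI conjI allI)
       (rule has_derivative_add[OF holo_fun_has_derivative[OF f z] holo_fun_has_derivative[OF g z]],
        simp add: holo_fun_scale[OF f z] holo_fun_scale[OF g z] algebra_simps)
qed (use f in \<open>simp add: holo_fun_def\<close>)

lemma holo_fun_mult:
  assumes f: "holo_fun S f" and g: "holo_fun S g"
  shows "holo_fun S (\<lambda>z. f z * g z)"
proof (rule holo_funI)
  fix z assume z: "z \<in> S"
  show "\<exists>L. ((\<lambda>z. f z * g z) has_derivative L) (at z) \<and> (\<forall>c v. L (c *s v) = c * L v)"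
    by (intro exI conjI allI)
       (rule has_derivative_mult[OF holo_fun_has_derivative[OF f z] holo_fun_has_derivative[OF g z]],
        simp add: holo_fun_scale[OF f z] holo_fun_scale[OF g z] algebra_simps)
qed (use f in \<open>simp add: holo_fun_def\<close>)

lemma holo_fun_comp:
  assumes f: "holo_fun S f" and g: "g holomorphic_on T" "open T" and "f ` S \<subseteq> T"
  shows "holo_fun S (\<lambda>z. g (f z))"
proof (rule holo_funI)
  fix z assume z: "z \<in> S"
  then have "(g has_derivative (\<lambda>h. deriv g (f z) * h)) (at (f z))"
    using g \<open>f ` S \<subseteq> T\<close> holomorphic_derivI[of g T "f z"]
    by (auto simp: has_field_derivative_def)
  note d = has_derivative_compose[OF holo_fun_has_derivative[OF f z] this]
  show "\<exists>L. ((\<lambda>z. g (f z)) has_derivative L) (at z) \<and> (\<forall>c v. L (c *s v) = c * L v)"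
    by (intro exI conjI allI, rule d) (simp add: holo_fun_scale[OF f z])
qed (use f in \<open>simp add: holo_fun_def\<close>)

lemma holo_fun_sum:
  assumes "open S" "\<And>j. j \<in> A \<Longrightarrow> holo_fun S (f j)"
  shows "holo_fun S (\<lambda>z. \<Sum>j\<in>A. f j z)"
  using assms(2)
  by (induction A rule: infinite_finite_induct) (auto intro: holo_fun_add holo_fun_const \<open>open S\<close>)

lemma holo_fun_diff:
  assumes f: "holo_fun S f" and g: "holo_fun S g"
  shows "holo_fun S (\<lambda>z. f z - g z)"
  using holo_fun_add[OF f holo_fun_mult[OF holo_fun_const[OF holo_fun_open[OF g], of "-1"] g]] by simp

lemma holo_fun_inverse:
  assumes f: "holo_fun S f" and "\<And>z. z \<in> S \<Longrightarrow> f z \<noteq> 0"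
  shows "holo_fun S (\<lambda>z. inverse (f z))"
proof (rule holo_fun_comp[OF f])
  show "inverse holomorphic_on (- {0} :: complex set)"
    by (auto intro!: holomorphic_intros)
qed (use assms in auto)

lemma holo_fun_divide:
  assumes "holo_fun S f" "holo_fun S g" and "\<And>z. z \<in> S \<Longrightarrow> g z \<noteq> 0"
  shows "holo_fun S (\<lambda>z. f z / g z)"
  using holo_fun_mult[OF assms(1) holo_fun_inverse[OF assms(2,3)]] by (simp add: divide_inverse)

lemma holo_fun_local:
  assumes "\<And>z. z \<in> S \<Longrightarrow> \<exists>T. z \<in> T \<and> holo_fun T f" "open S"
  shows "holo_fun S f"
  using assms unfolding holo_fun_def by blast

lemma poly_fun_holo: "f \<in> poly_fun \<Longrightarrow> holo_fun UNIV f"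
  by (induction rule: poly_fun.induct)
     (auto intro: holo_fun_const holo_fun_coord holo_fun_add holo_fun_mult)

lemma holo_fun_line:
  assumes f: "holo_fun S f" and "a + t *s b \<in> S"
  shows "((\<lambda>t. f (a + t *s b)) has_field_derivative fderiv f (a + t *s b) b) (at t)"
proof -
  have "((\<lambda>t. a + t *s b) has_derivative (\<lambda>h. h *s b)) (at t)"
    using has_derivative_add[OF has_derivative_const[of a]
        bounded_linear.has_derivative[OF bounded_linear_scalar_line has_derivative_ident]] by simp
  from has_derivative_compose[OF this holo_fun_has_derivative[OF assms]]
  show ?thesis
    by (simp add: has_field_derivative_def holo_fun_scale[OF assms] mult.commute[of _ "frechet_derivative _ _ _"])
qed

lemma holo_map_line:
  assumes f: "holo_map S f" and "a + t *s b \<in> S"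
  shows "((\<lambda>t. f (a + t *s b)) has_derivative (\<lambda>h. h *s fderiv f (a + t *s b) b)) (at t)"
proof -
  have "((\<lambda>t. a + t *s b) has_derivative (\<lambda>h. h *s b)) (at t)"
    using has_derivative_add[OF has_derivative_const[of a]
        bounded_linear.has_derivative[OF bounded_linear_scalar_line has_derivative_ident]] by simp
  from has_derivative_compose[OF this holo_map_has_derivative[OF assms]]
  show ?thesis
    by (simp add: holo_map_scale[OF assms])
qed

section \<open>Cauchy estimates by restriction to complex lines\<close>

lemma holomorphic_on_has_derivativeI:
  assumes "\<And>t. t \<in> A \<Longrightarrow> (g has_field_derivative g' t) (at t)"
  shows "g holomorphic_on A"
  using assms DERIV_subset by (fastforce simp: holomorphic_on_def field_differentiable_def)

text \<open>One-variable Cauchy estimate on the slice through \<open>z\<close> in direction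
  \<open>v\<close>. Half of the largest admissible radius keeps the closed disc inside the open ball
  and costs the factor 2.\<close>

lemma holo_fun_Cauchy_bound:
  assumes f: "holo_fun S f" and S: "ball z r \<subseteq> S" and "r > 0"
    and B: "\<And>w. w \<in> ball z r \<Longrightarrow> cmod (f w) \<le> B"
  shows "cmod (fderiv f z v) \<le> 2 * B / r * norm v"
proof (cases "v = 0")
  case True
  have "linear (fderiv f z)"
    using S \<open>r > 0\<close> by (intro has_derivative_linear[OF holo_fun_has_derivative[OF f]]) auto
  then show ?thesis using True by (simp add: linear_0)
next
  case False
  define s where "s = r / (2 * norm v)"
  have "s > 0" using False \<open>r > 0\<close> by (simp add: s_def)
  have in_ball: "z + t *s v \<in> ball z r" if "cmod t \<le> s" for t
  proof -
    have "cmod t * norm v \<le> s * norm v" using that by (simp add: mult_right_mono)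
    also have "\<dots> < r" using False \<open>r > 0\<close> by (simp add: s_def)
    finally show ?thesis by (simp add: dist_norm norm_vector_scalar_mult)
  qed
  let ?g = "\<lambda>t. f (z + t *s v)"
  have der: "(?g has_field_derivative fderiv f (z + t *s v) v) (at t)"
    if "cmod t \<le> s" for t
    using holo_fun_line[OF f] in_ball[OF that] S by blast
  have "cmod ((deriv ^^ 1) ?g 0) \<le> fact 1 * B / s ^ 1"
  proof (rule Cauchy_inequality)
    show "?g holomorphic_on ball 0 s"
      by (rule holomorphic_on_has_derivativeI[OF der]) simp
    show "continuous_on (cball 0 s) ?g"
      using der by (auto intro!: continuous_at_imp_continuous_on DERIV_isCont simp: dist_norm)
    show "cmod (?g x) \<le> B" if "cmod (0 - x) = s" for x
      using B in_ball that by simp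
  qed (fact \<open>s > 0\<close>)
  moreover have "deriv ?g 0 = fderiv f z v"
    using DERIV_imp_deriv[OF der[of 0]] \<open>s > 0\<close> by simp
  ultimately show ?thesis by (simp add: s_def field_simps)
qed

text \<open>Weierstrass' theorem: the Cauchy bound for differences \<open>f m - f n\<close> makes
  the derivatives uniformly Cauchy, and complex linearity passes to the limit.\<close>

lemma holo_fun_uniform_limit:
  fixes f :: "nat \<Rightarrow> complex ^ 'n \<Rightarrow> complex"
  assumes f: "\<And>n. holo_fun S (f n)" and lim: "uniform_limit S f g sequentially"
  shows "holo_fun S g"
proof (rule holo_funI)
  show "open S" using holo_fun_open[OF f] .
  fix z assume "z \<in> S"
  then obtain r0 where r0: "r0 > 0" "ball z r0 \<subseteq> S" using \<open>open S\<close> openE by blast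
  \<comment> \<open>A ball of radius \<open>r\<close> about any point of \<open>ball z r\<close>
    stays in \<open>S\<close>, so one Cauchy bound serves the whole ball.\<close>
  define r where "r = r0 / 2"
  have r: "r > 0" and sub: "\<And>x. x \<in> ball z r \<Longrightarrow> ball x r \<subseteq> S"
  proof -
    show "r > 0" using r0 by (simp add: r_def)
    fix x assume x: "x \<in> ball z r"
    have "ball x r \<subseteq> ball z r0"
    proof
      fix y assume "y \<in> ball x r"
      then show "y \<in> ball z r0" using x dist_triangle[of z y x] by (simp add: r_def)
    qed
    then show "ball x r \<subseteq> S" using r0 by auto
  qed
  let ?B = "ball z r"
  have BS: "?B \<subseteq> S" using sub[of z] r by auto
  let ?d = "\<lambda>n x h. fderiv (f n) x h"
  have cau: "\<exists>N. \<forall>m\<ge>N. \<forall>n\<ge>N. \<forall>x\<in>?B. \<forall>h. cmod (?d m x h - ?d n x h) \<le> e * norm h"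
    if "e > 0" for e
  proof -
    have "e * r / 4 > 0" using \<open>e > 0\<close> r by simp
    from uniform_limitD[OF lim this] obtain N where
      N: "\<And>n x. n \<ge> N \<Longrightarrow> x \<in> S \<Longrightarrow> dist (f n x) (g x) < e * r / 4"
      by (auto simp: eventually_sequentially)
    have "cmod (?d m x h - ?d n x h) \<le> e * norm h" if "m \<ge> N" "n \<ge> N" "x \<in> ?B" for m n x h
    proof -
      have D: "holo_fun S (\<lambda>w. f m w - f n w)" by (intro holo_fun_diff f)
      have "x \<in> S" using that BS by auto
      have "((\<lambda>w. f m w - f n w) has_derivative (\<lambda>h. ?d m x h - ?d n x h)) (at x)"
        by (intro has_derivative_diff holo_fun_has_derivative[OF f] \<open>x \<in> S\<close>)
      then have eq: "fderiv (\<lambda>w. f m w - f n w) x = (\<lambda>h. ?d m x h - ?d n x h)"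
        by (rule frechet_derivative_at[symmetric])
      have "cmod (fderiv (\<lambda>w. f m w - f n w) x h) \<le> 2 * (e * r / 2) / r * norm h"
      proof (rule holo_fun_Cauchy_bound[OF D sub[OF \<open>x \<in> ?B\<close>] r])
        fix w assume "w \<in> ball x r"
        then have "w \<in> S" using sub \<open>x \<in> ?B\<close> by blast
        then show "cmod (f m w - f n w) \<le> e * r / 2"
          using N[OF \<open>m \<ge> N\<close> \<open>w \<in> S\<close>] N[OF \<open>n \<ge> N\<close> \<open>w \<in> S\<close>]
            dist_triangle2[of "f m w" "f n w" "g w"] by (simp add: dist_norm)
      qed
      then show ?thesis using r by (simp add: eq)
    qed
    then show ?thesis by blast
  qed
  have conv: "convergent (\<lambda>n. ?d n x h)" if "x \<in> ?B" for x h
  proof -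
    have "Cauchy (\<lambda>n. ?d n x h)"
    proof (rule metric_CauchyI)
      fix e :: real assume "e > 0"
      then have "e / (norm h + 1) > 0"
        by (meson add_nonneg_pos divide_pos_pos norm_ge_zero zero_less_one)
      from cau[OF this] obtain N where N: "\<forall>m\<ge>N. \<forall>n\<ge>N. \<forall>x\<in>?B. \<forall>h'.
          cmod (?d m x h' - ?d n x h') \<le> e / (norm h + 1) * norm h'" by blast
      have "e / (norm h + 1) * norm h < e"
      proof -
        have "norm h + 1 > 0" by (simp add: add_nonneg_pos)
        then show ?thesis using \<open>e > 0\<close> by (simp add: field_simps)
      qed
      then show "\<exists>M. \<forall>m\<ge>M. \<forall>n\<ge>M. dist (?d m x h) (?d n x h) < e"
        using N that unfolding dist_norm by (meson le_less_trans)
    qed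
    then show ?thesis by (simp add: Cauchy_convergent)
  qed
  define g' where "g' x h = lim (\<lambda>n. ?d n x h)" for x h
  have g': "(\<lambda>n. ?d n x h) \<longlonglongrightarrow> g' x h" if "x \<in> ?B" for x h
    using conv[OF that] by (simp add: g'_def convergent_LIMSEQ_iff)
  have "\<exists>G. \<forall>x\<in>?B. (\<lambda>n. f n x) \<longlonglongrightarrow> G x \<and> (G has_derivative g' x) (at x within ?B)"
  proof (rule has_derivative_sequence[where f' = "\<lambda>n x h. ?d n x h" and ?x0.0 = z and l = "g z"])
    show "(f n has_derivative (\<lambda>h. ?d n x h)) (at x within ?B)" if "x \<in> ?B" for n x
      using holo_fun_has_derivative[OF f] BS that has_derivative_at_withinI by blast
    show "\<forall>\<^sub>F n in sequentially. \<forall>x\<in>?B. \<forall>h. cmod (?d n x h - g' x h) \<le> e * norm h" if e: "e > 0" for e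
    proof -
      from cau[OF e] obtain N where N: "\<forall>m\<ge>N. \<forall>n\<ge>N. \<forall>x\<in>?B. \<forall>h.
          cmod (?d m x h - ?d n x h) \<le> e * norm h" by blast
      have "cmod (?d n x h - g' x h) \<le> e * norm h" if "n \<ge> N" "x \<in> ?B" for n x h
      proof (rule LIMSEQ_le_const2)
        show "(\<lambda>m. cmod (?d n x h - ?d m x h)) \<longlonglongrightarrow> cmod (?d n x h - g' x h)"
          by (intro tendsto_intros g' that)
        show "\<exists>M. \<forall>m\<ge>M. cmod (?d n x h - ?d m x h) \<le> e * norm h" using N that by blast
      qed
      then show ?thesis unfolding eventually_sequentially by blast
    qed
    show "(\<lambda>n. f n z) \<longlonglongrightarrow> g z" using tendsto_uniform_limitI[OF lim \<open>z \<in> S\<close>] .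
  qed (use r in auto)
  then obtain G where G: "\<And>x. x \<in> ?B \<Longrightarrow> (\<lambda>n. f n x) \<longlonglongrightarrow> G x"
    "\<And>x. x \<in> ?B \<Longrightarrow> (G has_derivative g' x) (at x within ?B)" by blast
  have "G x = g x" if "x \<in> ?B" for x
    using G(1)[OF that] tendsto_uniform_limitI[OF lim, of x] that BS LIMSEQ_unique by blast
  moreover have "(G has_derivative g' z) (at z)"
    using G(2)[of z] r at_within_open[of z ?B] by simp
  ultimately have "(g has_derivative g' z) (at z)"
    using has_derivative_transform_within_open[of G "g' z" z UNIV ?B g] r by auto
  moreover have "g' z (c *s v) = c * g' z v" for c v
  proof (rule LIMSEQ_unique)
    show "(\<lambda>n. ?d n z (c *s v)) \<longlonglongrightarrow> g' z (c *s v)" using g' r by simp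
    have "(\<lambda>n. c * ?d n z v) \<longlonglongrightarrow> c * g' z v" using g' r by (intro tendsto_intros) simp
    then show "(\<lambda>n. ?d n z (c *s v)) \<longlonglongrightarrow> c * g' z v"
      by (simp add: holo_fun_scale[OF f \<open>z \<in> S\<close>])
  qed
  ultimately show "\<exists>L. (g has_derivative L) (at z) \<and> (\<forall>c v. L (c *s v) = c * L v)" by blast
qed

text \<open>Taylor's formula with the second derivative bounded by Cauchy on discs of radius
  \<open>s / 2\<close>. The rate depends only on a bound of \<open>g\<close>, which makes difference
  quotients converge uniformly in the base point.\<close>

lemma holomorphic_quadratic_remainder:
  assumes g: "g holomorphic_on ball 0 s" and B: "\<And>t. cmod t < s \<Longrightarrow> cmod (g t) \<le> B"
    and t: "cmod t \<le> s / 4" and "s > 0"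
  shows "cmod (g t - g 0 - deriv g 0 * t) \<le> 8 * B / s\<^sup>2 * (cmod t)\<^sup>2"
proof -
  let ?S = "cball (0::complex) (s / 4)"
  have "cmod ((deriv ^^ 0) g t - (\<Sum>i\<le>1. (deriv ^^ i) g 0 * (t - 0) ^ i / fact i))
      \<le> (8 * B / s\<^sup>2) * cmod (t - 0) ^ Suc 1 / fact 1"
  proof (rule complex_Taylor[where S = ?S])
    fix i :: nat and x assume x: "x \<in> ?S"
    then have "x \<in> ball 0 s" using \<open>s > 0\<close> by simp
    then show "((deriv ^^ i) g has_field_derivative (deriv ^^ Suc i) g x) (at x within ?S)"
      using holomorphic_derivI[OF holomorphic_higher_deriv[OF g open_ball] open_ball] by simp
  next
    fix x assume x: "x \<in> ?S"
    have sub: "cball x (s / 2) \<subseteq> ball 0 s"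
    proof
      fix y assume "y \<in> cball x (s / 2)"
      then show "y \<in> ball 0 s" using x dist_triangle[of 0 y x] \<open>s > 0\<close> by simp
    qed
    have "cmod ((deriv ^^ 2) g x) \<le> fact 2 * B / (s / 2) ^ 2"
    proof (rule Cauchy_inequality)
      show "g holomorphic_on ball x (s / 2)"
        using sub ball_subset_cball by (intro holomorphic_on_subset[OF g]) blast
      show "continuous_on (cball x (s / 2)) g"
        using sub by (intro holomorphic_on_imp_continuous_on holomorphic_on_subset[OF g])
      show "cmod (g y) \<le> B" if "cmod (x - y) = s / 2" for y
      proof -
        have "y \<in> cball x (s / 2)" using that by (simp add: dist_norm)
        then have "y \<in> ball 0 s" using sub by blast
        then show ?thesis using B by simp
      qed
    qed (use \<open>s > 0\<close> in simp)
    also have "fact 2 * B / (s / 2) ^ 2 = 8 * B / s\<^sup>2" by (simp add: fact_2 power_divide)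
    finally show "cmod ((deriv ^^ Suc 1) g x) \<le> 8 * B / s\<^sup>2" by (simp add: numeral_2_eq_2)
  qed (use t \<open>s > 0\<close> in auto)
  then show ?thesis by (simp add: algebra_simps power2_eq_square)
qed

text \<open>Difference quotients are holomorphic and converge locally uniformly to the derivative,
  so the theorem on uniform limits applies.\<close>

lemma holo_fun_directional_derivative:
  assumes f: "holo_fun S f"
  shows "holo_fun S (\<lambda>z. fderiv f z v)"
proof (rule holo_fun_local[OF _ holo_fun_open[OF f]])
  fix z assume "z \<in> S"
  then obtain r0 where r0: "r0 > 0" "cball z r0 \<subseteq> S"
    using holo_fun_open[OF f] open_contains_cball by blast
  have "bounded (f ` cball z r0)"
    using continuous_on_subset[OF holo_fun_continuous[OF f] r0(2)]
    by (intro compact_imp_bounded compact_continuous_image) auto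
  then obtain B where B: "\<And>w. w \<in> cball z r0 \<Longrightarrow> cmod (f w) \<le> B"
    by (auto simp: bounded_iff simp del: mem_cball)
  define r where "r = r0 / 2"
  define s where "s = r / (norm v + 1)"
  have nv: "norm v + 1 > 0" by (simp add: add_nonneg_pos)
  have "r > 0" "s > 0" using r0 nv by (simp_all add: r_def s_def)
  have in_ball: "w + t *s v \<in> cball z r0" if "w \<in> ball z r" "cmod t \<le> s" for w t
  proof -
    have "cmod t * norm v \<le> s * (norm v + 1)"
      by (intro mult_mono) (use that \<open>s > 0\<close> in auto)
    also have "\<dots> = r" using nv by (simp add: s_def)
    finally have "dist w (w + t *s v) \<le> r"
      by (simp add: dist_norm norm_vector_scalar_mult)
    then show ?thesis using that dist_triangle[of z "w + t *s v" w] by (simp add: r_def)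
  qed
  \<comment> \<open>Increments that tend to 0 and stay in the disc \<open>cmod t \<le> s / 4\<close>
    of the remainder estimate.\<close>
  define T where "T n = complex_of_real (s / (4 * real (Suc n)))" for n
  have T: "cmod (T n) \<le> s / 4" "T n \<noteq> 0" "cmod (T n) = s / 4 * inverse (real (Suc n))" for n
    using \<open>s > 0\<close> by (simp_all add: T_def norm_divide norm_mult field_simps del: of_nat_Suc)
  have "holo_fun (ball z r) (\<lambda>w. fderiv f w v)"
  proof (rule holo_fun_uniform_limit)
    fix n
    have "holo_fun (ball z r) f"
      using r0 by (intro holo_fun_subset[OF f]) (auto simp: r_def subset_iff)
    moreover have "holo_fun (ball z r) (\<lambda>w. f (w + T n *s v))"
    proof (rule holo_fun_comp_map[OF _ f])
      show "holo_map (ball z r) (\<lambda>w. w + T n *s v)"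
        unfolding holo_map_iff by (auto intro!: holo_fun_add holo_fun_coord holo_fun_const)
      show "(\<lambda>w. w + T n *s v) ` ball z r \<subseteq> S"
      proof clarify
        fix w assume "w \<in> ball z r"
        then show "w + T n *s v \<in> S" using in_ball[of w "T n"] T(1)[of n] \<open>s > 0\<close> r0(2) by auto
      qed
    qed
    ultimately show "holo_fun (ball z r) (\<lambda>w. (f (w + T n *s v) - f w) / T n)"
      using T by (intro holo_fun_divide holo_fun_diff holo_fun_const) auto
  next
    have le: "cmod ((f (w + T n *s v) - f w) / T n - fderiv f w v)
        \<le> 8 * B / s\<^sup>2 * (s / 4) * inverse (real (Suc n))" if w: "w \<in> ball z r" for w n
    proof -
      let ?g = "\<lambda>t. f (w + t *s v)"
      have der: "(?g has_field_derivative fderiv f (w + t *s v) v) (at t)"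
        if "cmod t \<le> s" for t
        using holo_fun_line[OF f] in_ball[OF w that] r0 by blast
      have "cmod (?g (T n) - ?g 0 - deriv ?g 0 * T n) \<le> 8 * B / s\<^sup>2 * (cmod (T n))\<^sup>2"
      proof (rule holomorphic_quadratic_remainder)
        show "?g holomorphic_on ball 0 s"
          by (rule holomorphic_on_has_derivativeI[OF der]) simp
      qed (use T \<open>s > 0\<close> in_ball[OF w] B in auto)
      moreover have "deriv ?g 0 = fderiv f w v"
        using DERIV_imp_deriv[OF der[of 0]] \<open>s > 0\<close> by simp
      ultimately have *: "cmod (f (w + T n *s v) - f w - fderiv f w v * T n)
          \<le> 8 * B / s\<^sup>2 * (cmod (T n))\<^sup>2" by simp
      have "(f (w + T n *s v) - f w) / T n - fderiv f w v
          = (f (w + T n *s v) - f w - fderiv f w v * T n) / T n"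
        using T by (simp add: field_simps)
      then have "cmod ((f (w + T n *s v) - f w) / T n - fderiv f w v)
          \<le> 8 * B / s\<^sup>2 * (cmod (T n))\<^sup>2 / cmod (T n)"
        using divide_right_mono[OF *, of "cmod (T n)"] by (simp add: norm_divide)
      also have "\<dots> = 8 * B / s\<^sup>2 * cmod (T n)" using T(2)[of n] by (simp add: power2_eq_square)
      finally show ?thesis unfolding T(3) by (simp add: mult.assoc)
    qed
    have lim: "(\<lambda>n. 8 * B / s\<^sup>2 * (s / 4) * inverse (real (Suc n))) \<longlonglongrightarrow> 0"
      by (rule tendsto_mult_right_zero[OF LIMSEQ_inverse_real_of_nat])
    show "uniform_limit (ball z r) (\<lambda>n w. (f (w + T n *s v) - f w) / T n)
        (\<lambda>w. fderiv f w v) sequentially"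
    proof (rule uniform_limitI)
      fix e :: real assume "e > 0"
      from order_tendstoD(2)[OF lim this]
      show "\<forall>\<^sub>F n in sequentially. \<forall>w\<in>ball z r.
          dist ((f (w + T n *s v) - f w) / T n) (fderiv f w v) < e"
        unfolding dist_norm
      proof eventually_elim
        case (elim n)
        then show ?case using le le_less_trans by blast
      qed
    qed
  qed
  then show "\<exists>T. z \<in> T \<and> holo_fun T (\<lambda>z. fderiv f z v)"
    using \<open>r > 0\<close> by (intro exI[of _ "ball z r"]) auto
qed

section \<open>Varieties without points of codimension one\<close>

lemma poly_fun_diff: "f \<in> poly_fun \<Longrightarrow> g \<in> poly_fun \<Longrightarrow> (\<lambda>z. f z - g z) \<in> poly_fun"
  using poly_fun.add[of f "\<lambda>z. (-1) * g z"] poly_fun.mult[OF poly_fun.const[of "-1"], of g] by simp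

lemma poly_fun_directional_derivative:
  fixes v :: "complex ^ 'n"
  assumes "f \<in> poly_fun"
  shows "(\<lambda>z. fderiv f z v) \<in> poly_fun"
  using assms
proof (induction rule: poly_fun.induct)
  case (const c)
  then show ?case by (simp add: poly_fun.const)
next
  case (coord i)
  have "fderiv (\<lambda>z :: complex ^ 'n. z $ i) z = (\<lambda>h. h $ i)" for z
    by (rule frechet_derivative_at[symmetric, OF has_derivative_vec_nth[OF has_derivative_ident]])
  then show ?case by (simp add: poly_fun.const)
next
  case (add f g)
  have "fderiv (\<lambda>z. f z + g z) z
      = (\<lambda>h. fderiv f z h + fderiv g z h)" for z
    by (rule frechet_derivative_at[symmetric], intro has_derivative_add holo_fun_has_derivative)
       (use add poly_fun_holo in auto)
  then show ?case using add by (simp add: poly_fun.add)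
next
  case (mult f g)
  have "fderiv (\<lambda>z. f z * g z) z
      = (\<lambda>h. f z * fderiv g z h + fderiv f z h * g z)" for z
    by (rule frechet_derivative_at[symmetric], intro has_derivative_mult holo_fun_has_derivative)
       (use mult poly_fun_holo in auto)
  then show ?case using mult by (simp add: poly_fun.add poly_fun.mult)
qed

lemma poly_fun_continuous: "f \<in> poly_fun \<Longrightarrow> continuous_on A f"
  using holo_fun_continuous[OF poly_fun_holo] continuous_on_subset by blast

section \<open>Polynomials on parallel complex lines\<close>

lemma poly_fun_line:
  assumes "f \<in> poly_fun"
  shows "\<exists>p. \<forall>t. f (a + t *s b) = poly p t"
  using assms
proof (induction rule: poly_fun.induct)
  case (const c)
  show ?case by (rule exI[of _ "[:c:]"]) simp
next
  case (coord i)
  show ?case by (rule exI[of _ "[:a $ i, b $ i:]"]) simp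
next
  case (add f g)
  then obtain p q where "\<forall>t. f (a + t *s b) = poly p t" "\<forall>t. g (a + t *s b) = poly q t" by blast
  then show ?case by (intro exI[of _ "p + q"]) simp
next
  case (mult f g)
  then obtain p q where "\<forall>t. f (a + t *s b) = poly p t" "\<forall>t. g (a + t *s b) = poly q t" by blast
  then show ?case by (intro exI[of _ "p * q"]) simp
qed

text \<open>The coefficients of the polynomial t \<mapsto> f(t z) are the homogeneous parts of f at z.\<close>
lemma poly_fun_radial:
  fixes f :: "complex ^ 'n \<Rightarrow> complex"
  assumes "f \<in> poly_fun"
  shows "\<exists>d P. (\<forall>z t. f (t *s z) = poly (P z) t) \<and> (\<forall>z. degree (P z) \<le> d) \<and>
      (\<forall>j. continuous_on UNIV (\<lambda>z. coeff (P z) j))"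
  using assms
proof (induction rule: poly_fun.induct)
  case (const c)
  show ?case by (rule exI[of _ 0], rule exI[of _ "\<lambda>z. [:c:]"]) auto
next
  case (coord i)
  show ?case
  proof (rule exI[of _ 1], rule exI[of _ "\<lambda>z. [:0, z $ i:]"], intro conjI allI)
    show "continuous_on UNIV (\<lambda>z :: complex ^ 'n. coeff [:0, z $ i:] j)" for j
      by (cases j; cases "j - 1") (auto intro!: continuous_intros)
  qed auto
next
  case (add f g)
  then obtain d P e Q where "\<forall>z t. f (t *s z) = poly (P z) t" "\<forall>z. degree (P z) \<le> d"
    "\<forall>j. continuous_on UNIV (\<lambda>z. coeff (P z) j)" "\<forall>z t. g (t *s z) = poly (Q z) t"
    "\<forall>z. degree (Q z) \<le> e" "\<forall>j. continuous_on UNIV (\<lambda>z. coeff (Q z) j)" by blast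
  then show ?case
    by (intro exI[of _ "max d e"] exI[of _ "\<lambda>z. P z + Q z"])
       (auto intro!: continuous_intros degree_add_le intro: le_trans[OF _ max.cobounded1]
          le_trans[OF _ max.cobounded2])
next
  case (mult f g)
  then obtain d P e Q where "\<forall>z t. f (t *s z) = poly (P z) t" "\<forall>z. degree (P z) \<le> d"
    "\<forall>j. continuous_on UNIV (\<lambda>z. coeff (P z) j)" "\<forall>z t. g (t *s z) = poly (Q z) t"
    "\<forall>z. degree (Q z) \<le> e" "\<forall>j. continuous_on UNIV (\<lambda>z. coeff (Q z) j)" by blast
  then show ?case
    by (intro exI[of _ "d + e"] exI[of _ "\<lambda>z. P z * Q z"])
       (auto intro!: continuous_intros order_trans[OF degree_mult_le] add_mono simp: coeff_mult)
qed

text \<open>Only the exponent \<open>degree p\<close> gives a finite nonzero limit. This reads off a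
  degree from asymptotics alone.\<close>

lemma degree_eq_of_tendsto:
  fixes p :: "complex poly"
  assumes lim: "((\<lambda>t. poly p t / t ^ d) \<longlongrightarrow> L) at_infinity" and "L \<noteq> 0"
  shows "p \<noteq> 0 \<and> degree p = d"
proof -
  have ev: "\<forall>\<^sub>F t::complex in at_infinity. t \<noteq> 0"
    by (rule eventually_at_infinityI[of 1]) auto
  have nontriv: "(at_infinity :: complex filter) \<noteq> bot" by (simp add: trivial_limit_at_infinity)
  have nz: "p \<noteq> 0"
  proof
    assume "p = 0"
    then have "((\<lambda>t::complex. 0) \<longlongrightarrow> L) at_infinity" using lim by simp
    with tendsto_unique[OF nontriv tendsto_const this] \<open>L \<noteq> 0\<close> show False by simp
  qed
  have inv: "((\<lambda>t. inverse (t ^ m)) \<longlongrightarrow> (0::complex)) at_infinity" if "m > 0" for m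
    using filterlim_compose[OF tendsto_inverse_0 filterlim_power_at_infinity[of m]] that by simp
  note lead = poly_divide_tendsto_aux[of p]
  have "\<not> degree p < d"
  proof
    assume less: "degree p < d"
    have "((\<lambda>t. (poly p t / t ^ degree p) * inverse (t ^ (d - degree p))) \<longlongrightarrow> lead_coeff p * 0) at_infinity"
      by (intro tendsto_mult lead inv) (use less in simp)
    moreover have "\<forall>\<^sub>F t in at_infinity. (poly p t / t ^ degree p) * inverse (t ^ (d - degree p)) = poly p t / t ^ d"
      using ev by eventually_elim (use less in \<open>simp add: field_simps flip: power_add\<close>)
    ultimately have "((\<lambda>t. poly p t / t ^ d) \<longlongrightarrow> 0) at_infinity"
      by (simp add: tendsto_cong)
    from tendsto_unique[OF nontriv this lim] \<open>L \<noteq> 0\<close> show False by simp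
  qed
  moreover have "\<not> d < degree p"
  proof
    assume less: "d < degree p"
    have "((\<lambda>t. (poly p t / t ^ d) * inverse (t ^ (degree p - d))) \<longlongrightarrow> L * 0) at_infinity"
      by (intro tendsto_mult lim inv) (use less in simp)
    moreover have "\<forall>\<^sub>F t in at_infinity. (poly p t / t ^ d) * inverse (t ^ (degree p - d)) = poly p t / t ^ degree p"
      using ev by eventually_elim (use less in \<open>simp add: field_simps flip: power_add\<close>)
    ultimately have "((\<lambda>t. poly p t / t ^ degree p) \<longlongrightarrow> 0) at_infinity"
      by (simp add: tendsto_cong)
    from tendsto_unique[OF nontriv this lead] nz show False by simp
  qed
  ultimately show ?thesis using nz by simp
qed

text \<open>A common degree on all lines parallel to \<open>v\<close> allows at most
  \<open>d\<close> zeros of \<open>f\<close> on each and no such line inside the zero set;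
  \<open>d\<close> later serves as the quantity to minimise.\<close>

definition line_degree :: "complex ^ 'n \<Rightarrow> nat \<Rightarrow> (complex ^ 'n \<Rightarrow> complex) \<Rightarrow> bool" where
  "line_degree v d f \<longleftrightarrow> (\<forall>b. \<exists>p. p \<noteq> 0 \<and> degree p = d \<and> (\<forall>t. poly p t = f (b + t *s v)))"

lemma line_degree_derivative:
  assumes f: "f \<in> poly_fun" and "line_degree v (Suc d) f"
  shows "line_degree v d (\<lambda>z. fderiv f z v)"
  unfolding line_degree_def
proof
  fix b
  obtain p where p: "degree p = Suc d" "\<forall>t. poly p t = f (b + t *s v)"
    using assms by (auto simp: line_degree_def)
  have "poly (pderiv p) t = fderiv f (b + t *s v) v" for t
  proof (rule DERIV_unique)
    show "(poly p has_field_derivative poly (pderiv p) t) (at t)" by (rule poly_DERIV)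
    have "poly p = (\<lambda>t. f (b + t *s v))" using p by auto
    then show "(poly p has_field_derivative fderiv f (b + t *s v) v) (at t)"
      using holo_fun_line[OF poly_fun_holo[OF f]] by simp
  qed
  moreover have "degree (pderiv p) = d" using p by (simp add: degree_pderiv)
  moreover have "pderiv p \<noteq> 0" using p by (simp add: pderiv_eq_0_iff)
  ultimately show "\<exists>p. p \<noteq> 0 \<and> degree p = d \<and> (\<forall>t. poly p t = fderiv f (b + t *s v) v)"
    by blast
qed

text \<open>\<open>v\<close> is a point where the top homogeneous part of \<open>f\<close> does not
  vanish. By continuity that part dominates the lower ones on a cone around the line of
  \<open>v\<close>, which keeps the zero set out of the cone far from the origin. The case
  \<open>v = 0\<close> occurs only for constant \<open>f\<close>.\<close>

lemma poly_fun_generic_direction: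
  assumes f: "f \<in> poly_fun" and "f a \<noteq> 0"
  obtains v d e R where "v = 0 \<Longrightarrow> d = 0" "line_degree v d f" "e > 0" "R > 0"
    "\<And>t x. cmod t \<ge> R \<Longrightarrow> norm x \<le> e * cmod t \<Longrightarrow> f (t *s v + x) \<noteq> 0"
proof -
  obtain D P where P: "\<And>z t. f (t *s z) = poly (P z) t" "\<And>z. degree (P z) \<le> D"
    "\<And>j. continuous_on UNIV (\<lambda>z. coeff (P z) j)" using poly_fun_radial[OF f] by blast
  have "poly (P a) 1 \<noteq> 0" using P(1)[of 1 a] \<open>f a \<noteq> 0\<close> by simp
  then have ex: "\<exists>z. coeff (P z) (degree (P a)) \<noteq> 0" by (intro exI[of _ a]) auto
  \<comment> \<open>The degree of the highest homogeneous part that is not identically zero.\<close>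
  define d where "d = (GREATEST j. \<exists>z. coeff (P z) j \<noteq> 0)"
  have bound: "j \<le> D" if "\<exists>z. coeff (P z) j \<noteq> 0" for j
    using that P(2) le_degree le_trans by blast
  have "\<exists>z. coeff (P z) d \<noteq> 0" unfolding d_def
    using GreatestI_nat[of "\<lambda>j. \<exists>z. coeff (P z) j \<noteq> 0", OF ex] bound by blast
  then obtain v where v: "coeff (P v) d \<noteq> 0" by blast
  have deg: "degree (P z) \<le> d" for z
  proof (rule degree_le, intro allI impI)
    fix j assume "d < j"
    show "coeff (P z) j = 0"
    proof (rule ccontr)
      assume "coeff (P z) j \<noteq> 0"
      then have "j \<le> d" unfolding d_def
        by (intro Greatest_le_nat[of "\<lambda>j. \<exists>z. coeff (P z) j \<noteq> 0" _ D]) (use bound in blast)+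
      then show False using \<open>d < j\<close> by simp
    qed
  qed
  \<comment> \<open>Factoring out \<open>t\<close> turns a vector \<open>x\<close> of size
    \<open>e * cmod t\<close> into a small perturbation of \<open>v\<close>.\<close>
  have expand: "f (t *s v + x) = (\<Sum>j\<le>d. coeff (P (v + inverse t *s x)) j * t ^ j)" if "t \<noteq> 0" for t x
  proof -
    have "t *s v + x = t *s (v + inverse t *s x)" using that by (simp add: vec_eq_iff algebra_simps)
    then show ?thesis using P(1)[of t "v + inverse t *s x"]
        arg_cong[OF poly_as_sum_of_monoms'[OF deg[of "v + inverse t *s x"]], of "\<lambda>p. poly p t"]
      by (simp add: poly_sum poly_monom)
  qed
  \<comment> \<open>Near \<open>v\<close>, \<open>M\<close> controls the lower coefficients and
    \<open>c\<close> bounds the top one from below.\<close>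
  define M where "M = (\<Sum>j\<le>d. cmod (coeff (P v) j) + 1)"
  define c where "c = cmod (coeff (P v) d) / 2"
  have "c > 0" using v by (simp add: c_def)
  have cont: "isCont (\<lambda>z. coeff (P z) j) v" for j
    using P(3) by (simp add: continuous_on_eq_continuous_at)
  have "\<forall>\<^sub>F w in nhds v. (\<forall>j\<in>{..d}. cmod (coeff (P w) j) < cmod (coeff (P v) j) + 1) \<and>
      cmod (coeff (P w) d) > c"
  proof (intro eventually_conj eventually_ball_finite ballI)
    have t: "((\<lambda>w. cmod (coeff (P w) j)) \<longlongrightarrow> cmod (coeff (P v) j)) (nhds v)" for j
      using cont[of j] by (intro tendsto_norm) (simp add: isCont_def tendsto_nhds_iff)
    show "\<forall>\<^sub>F w in nhds v. cmod (coeff (P w) j) < cmod (coeff (P v) j) + 1" for j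
      by (rule order_tendstoD(2)[OF t]) simp
    show "\<forall>\<^sub>F w in nhds v. c < cmod (coeff (P w) d)"
      by (rule order_tendstoD(1)[OF t]) (use v in \<open>simp add: c_def\<close>)
  qed simp
  then obtain e0 where e0: "e0 > 0" and near: "\<And>w. dist w v < e0 \<Longrightarrow>
      (\<forall>j\<in>{..d}. cmod (coeff (P w) j) < cmod (coeff (P v) j) + 1) \<and> cmod (coeff (P w) d) > c"
    unfolding eventually_nhds_metric by blast
  define R where "R = max 1 (2 * M / c)"
  have "M \<ge> 0" by (simp add: M_def sum_nonneg)
  have tail: "cmod (\<Sum>j<d. coeff (P w) j * t ^ j) \<le> M * cmod t ^ d / cmod t"
    if "dist w v < e0" "cmod t \<ge> 1" for w t
  proof -
    have "cmod (\<Sum>j<d. coeff (P w) j * t ^ j) \<le> (\<Sum>j<d. cmod (coeff (P w) j * t ^ j))" by (rule norm_sum)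
    also have "\<dots> \<le> (\<Sum>j<d. (cmod (coeff (P v) j) + 1) * (cmod t ^ d / cmod t))"
    proof (rule sum_mono)
      fix j assume j: "j \<in> {..<d}"
      have "cmod t ^ j * cmod t \<le> cmod t ^ d"
        using power_increasing[of "Suc j" d "cmod t"] j that by (simp add: mult.commute)
      moreover have "cmod t > 0" using that by linarith
      ultimately have "cmod t ^ j \<le> cmod t ^ d / cmod t" by (simp add: pos_le_divide_eq)
      then show "cmod (coeff (P w) j * t ^ j) \<le> (cmod (coeff (P v) j) + 1) * (cmod t ^ d / cmod t)"
        using near[OF that(1)] j unfolding norm_mult norm_power
        by (intro mult_mono) (auto intro: less_imp_le)
    qed
    also have "\<dots> = (\<Sum>j<d. cmod (coeff (P v) j) + 1) * (cmod t ^ d / cmod t)"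
      by (rule sum_distrib_right[symmetric])
    also have "\<dots> \<le> M * (cmod t ^ d / cmod t)"
      unfolding M_def by (intro mult_right_mono sum_mono2) auto
    finally show ?thesis by simp
  qed
  have split: "(\<Sum>j\<le>d. coeff p j * t ^ j) = (\<Sum>j<d. coeff p j * t ^ j) + coeff p d * t ^ d" for p and t :: complex
    by (simp add: lessThan_Suc_atMost[symmetric])
  show thesis
  proof
    show "d = 0" if "v = 0"
    proof -
      have "poly (P 0) = (\<lambda>t. f 0)" using P(1)[of _ 0] by auto
      then have "P 0 = [:f 0:]" by (intro poly_ext) simp
      then show "d = 0" using v that by (cases d) auto
    qed
    show "e0 / 2 > 0" using e0 by simp
    show "R > 0" by (simp add: R_def)
    show "f (t *s v + x) \<noteq> 0" if t: "cmod t \<ge> R" and x: "norm x \<le> e0 / 2 * cmod t" for t x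
    proof
      assume zero: "f (t *s v + x) = 0"
      have t1: "cmod t \<ge> 1" "cmod t \<ge> 2 * M / c" "t \<noteq> 0" using t by (auto simp: R_def)
      let ?w = "v + inverse t *s x"
      have "dist ?w v = norm x / cmod t"
        by (simp add: dist_norm norm_vector_scalar_mult norm_inverse divide_inverse mult.commute)
      also have "\<dots> \<le> e0 / 2" using x t1 by (simp add: pos_divide_le_eq)
      finally have w: "dist ?w v < e0" using e0 by simp
      have "coeff (P ?w) d * t ^ d = - (\<Sum>j<d. coeff (P ?w) j * t ^ j)"
        using zero expand[OF t1(3), of x] unfolding split by (metis add_eq_0_iff)
      then have "cmod (coeff (P ?w) d) * cmod t ^ d \<le> M * cmod t ^ d / cmod t"
        using tail[OF w t1(1)] by (metis norm_minus_cancel norm_mult norm_power)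
      then have "cmod (coeff (P ?w) d) \<le> M / cmod t" using t1 by (simp add: field_simps)
      moreover have "M / cmod t \<le> c / 2" using t1 \<open>c > 0\<close> by (simp add: field_simps)
      ultimately show False using near[OF w] \<open>c > 0\<close> by linarith
    qed
    show "line_degree v d f"
      unfolding line_degree_def
    proof
      fix b
      obtain p where p: "\<forall>t. f (b + t *s v) = poly p t" using poly_fun_line[OF f] by blast
      have w0: "((\<lambda>t. v + inverse t *s b) \<longlongrightarrow> v) at_infinity"
      proof -
        have "((\<lambda>t. inverse t *s b) \<longlongrightarrow> 0 *s b) at_infinity"
          by (rule bounded_linear.tendsto[OF bounded_linear_scalar_line tendsto_inverse_0])
        from tendsto_add[OF tendsto_const[of v] this] show ?thesis by simp
      qed
      have ev: "\<forall>\<^sub>F t in at_infinity. dist (v + inverse t *s b) v < e0"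
        using tendstoD[OF w0 e0] .
      have ev1: "\<forall>\<^sub>F t :: complex in at_infinity. cmod t \<ge> 1"
        using eventually_at_infinity by blast
      have c1: "((\<lambda>t. coeff (P (v + inverse t *s b)) d) \<longlongrightarrow> coeff (P v) d) at_infinity"
        by (rule isCont_tendsto_compose[OF cont w0])
      have c2: "((\<lambda>t. (\<Sum>j<d. coeff (P (v + inverse t *s b)) j * t ^ j) / t ^ d) \<longlongrightarrow> 0) at_infinity"
      proof (rule Lim_null_comparison)
        show "\<forall>\<^sub>F t in at_infinity. cmod ((\<Sum>j<d. coeff (P (v + inverse t *s b)) j * t ^ j) / t ^ d) \<le> M * cmod (inverse t)"
          using ev ev1
        proof eventually_elim
          case (elim t)
          then have "t \<noteq> 0" by auto
          with tail[OF elim] show ?case by (simp add: norm_divide norm_power norm_inverse field_simps)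
        qed
        show "((\<lambda>t. M * cmod (inverse t)) \<longlongrightarrow> 0) at_infinity"
          using tendsto_mult_right_zero[OF tendsto_norm_zero[OF tendsto_inverse_0]] .
      qed
      have "((\<lambda>t. poly p t / t ^ d) \<longlongrightarrow> coeff (P v) d) at_infinity"
      proof (rule Lim_transform_eventually)
        show "((\<lambda>t. (\<Sum>j<d. coeff (P (v + inverse t *s b)) j * t ^ j) / t ^ d + coeff (P (v + inverse t *s b)) d)
            \<longlongrightarrow> coeff (P v) d) at_infinity"
          using tendsto_add[OF c2 c1] by simp
        show "\<forall>\<^sub>F t in at_infinity. (\<Sum>j<d. coeff (P (v + inverse t *s b)) j * t ^ j) / t ^ d +
            coeff (P (v + inverse t *s b)) d = poly p t / t ^ d"
          using ev1
        proof eventually_elim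
          case (elim t)
          then have "t \<noteq> 0" by auto
          then have "poly p t = (\<Sum>j\<le>d. coeff (P (v + inverse t *s b)) j * t ^ j)"
            using expand[of t b] p by (simp add: add.commute)
          then show ?case using \<open>t \<noteq> 0\<close> split by (simp add: add_divide_distrib)
        qed
      qed
      from degree_eq_of_tendsto[OF this v] p
      show "\<exists>p. p \<noteq> 0 \<and> degree p = d \<and> (\<forall>t. poly p t = f (b + t *s v))" by auto
    qed
  qed
qed

text \<open>The real inverse function theorem applies because directional derivatives are
  holomorphic, hence continuous; the inverse of a complex linear map is complex linear, so the local
  inverse is holomorphic.\<close>

lemma holo_inverse_function:
  fixes \<phi> :: "complex ^ 'n \<Rightarrow> complex ^ 'n"
  assumes \<phi>: "holo_map S \<phi>" and "z \<in> S" and inj: "\<And>h. fderiv \<phi> z h = 0 \<Longrightarrow> h = 0"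
  obtains U W g where "z \<in> U" "U \<subseteq> S" "holo_map U \<phi>" "holo_map W g" "\<phi> ` U = W"
    "\<And>x. x \<in> U \<Longrightarrow> g (\<phi> x) = x" "\<And>w. w \<in> W \<Longrightarrow> \<phi> (g w) = w"
proof -
  let ?d = "\<lambda>x. fderiv \<phi> x"
  have "open S" using \<phi> by (simp add: holo_map_def)
  have der: "(\<phi> has_derivative ?d x) (at x)" if "x \<in> S" for x
    using holo_map_has_derivative[OF \<phi> that] .
  have app: "blinfun_apply (Blinfun (?d x)) = ?d x" if "x \<in> S" for x
    using has_derivative_bounded_linear[OF der[OF that]] by (rule bounded_linear_Blinfun_apply)
  have lin: "linear (?d z)" using der[OF \<open>z \<in> S\<close>] has_derivative_linear by blast
  have "inj (?d z)" using inj lin by (simp add: linear_injective_0)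
  then obtain h where h: "linear h" "h \<circ> ?d z = id" using lin linear_injective_left_inverse by blast
  have apph: "blinfun_apply (Blinfun h) = h"
    using h(1) by (intro bounded_linear_Blinfun_apply) (simp add: linear_conv_bounded_linear)
  have "continuous_on S (\<lambda>x. ?d x b)" for b
  proof -
    have eq: "?d x b = (\<chi> i. fderiv (\<lambda>z. \<phi> z $ i) x b)" if "x \<in> S" for x
    proof -
      have "(\<lambda>h. ?d x h $ i) = fderiv (\<lambda>z. \<phi> z $ i) x" for i
        by (rule frechet_derivative_at[OF has_derivative_vec_nth[OF der[OF that]]])
      from fun_cong[OF this] show ?thesis by (simp add: vec_eq_iff)
    qed
    have "continuous_on S (\<lambda>x. \<chi> i. fderiv (\<lambda>z. \<phi> z $ i) x b)"
      using \<phi> by (intro continuous_intros holo_fun_continuous holo_fun_directional_derivative)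
        (auto simp: holo_map_iff)
    then show ?thesis using eq by (simp cong: continuous_on_cong)
  qed
  then have cont: "continuous_on S (\<lambda>x. Blinfun (?d x))"
    by (intro continuous_on_blinfun_componentwise) (simp add: app cong: continuous_on_cong)
  have comp: "Blinfun h o\<^sub>L Blinfun (?d z) = id_blinfun"
    using h(2) by (intro blinfun_eqI) (simp add: apph app[OF \<open>z \<in> S\<close>] pointfree_idE)
  obtain U W g g' where U: "open U" "U \<subseteq> S" "z \<in> U" "open W" "homeomorphism U W \<phi> g"
    and g': "\<And>y. y \<in> W \<Longrightarrow> (g has_derivative g' y) (at y)"
      "\<And>y. y \<in> W \<Longrightarrow> g' y = inv (blinfun_apply (Blinfun (?d (g y))))"
      "\<And>y. y \<in> W \<Longrightarrow> bij (blinfun_apply (Blinfun (?d (g y))))"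
    using inverse_function_theorem[OF \<open>open S\<close> _ cont \<open>z \<in> S\<close> comp, of \<phi>] der app by metis
  show thesis
  proof
    show "holo_map U \<phi>" using \<phi> U by (auto simp: holo_map_def)
    show "holo_map W g"
      unfolding holo_map_def
    proof (intro conjI ballI exI allI)
      fix y c v assume y: "y \<in> W"
      have gy: "g y \<in> S" using U y by (auto simp: homeomorphism_def)
      show "(g has_derivative g' y) (at y)" by (rule g'[OF y])
      have bij: "bij (?d (g y))" and g'y: "g' y = inv (?d (g y))"
        using g'(2,3)[OF y] app[OF gy] by auto
      have "?d (g y) (c *s g' y v) = c *s ?d (g y) (g' y v)" using holo_map_scale[OF \<phi> gy] .
      also have "?d (g y) (g' y v) = v" using bij by (simp add: g'y bij_is_surj surj_f_inv_f)
      finally show "g' y (c *s v) = c *s g' y v"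
        using bij unfolding g'y by (metis bij_inv_eq_iff)
    qed (rule U)
  qed (use U in \<open>auto simp: homeomorphism_def\<close>)
qed

text \<open>Candidate chart flattening \<open>{f = 0}\<close>. For \<open>v $ i0 = 1\<close> the
  slots other than \<open>i0\<close> give the projection along \<open>v\<close>, that is, a label of
  the line parallel to \<open>v\<close>.\<close>

definition straighten :: "'n \<Rightarrow> complex ^ 'n \<Rightarrow> (complex ^ 'n \<Rightarrow> complex) \<Rightarrow> complex ^ 'n \<Rightarrow> complex ^ 'n" where
  "straighten i0 v f z = (\<chi> i. if i = i0 then f z else z $ i - z $ i0 * v $ i)"

lemma straighten_holo:
  assumes "f \<in> poly_fun"
  shows "holo_map UNIV (straighten i0 v f)"
  unfolding holo_map_iff
proof (intro conjI allI)
  fix i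
  have "(\<lambda>z. straighten i0 v f z $ i) \<in> poly_fun"
    using assms by (cases "i = i0")
      (auto simp: straighten_def intro!: poly_fun_diff poly_fun.coord poly_fun.mult poly_fun.const)
  then show "holo_fun UNIV (\<lambda>z. straighten i0 v f z $ i)" by (rule poly_fun_holo)
qed simp

text \<open>The projected slots force a kernel vector to be a multiple of \<open>v\<close>, and slot
  \<open>i0\<close> then sees the nonzero derivative along \<open>v\<close>.\<close>

lemma straighten_derivative_injective:
  assumes f: "f \<in> poly_fun" and v: "v $ i0 = 1" and nz: "fderiv f z v \<noteq> 0"
    and zero: "fderiv (straighten i0 v f) z h = 0"
  shows "h = 0"
proof -
  let ?s = "straighten i0 v f"
  have der: "((\<lambda>z. ?s z $ i) has_derivative (\<lambda>h. fderiv ?s z h $ i)) (at z)" for i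
    using holo_map_has_derivative[OF straighten_holo[OF f]] by (intro has_derivative_vec_nth) simp
  have h: "h $ i = h $ i0 * v $ i" for i
  proof (cases "i = i0")
    case False
    have "((\<lambda>z. z $ i - z $ i0 * v $ i) has_derivative (\<lambda>h. h $ i - h $ i0 * v $ i)) (at z)"
      by (intro has_derivative_diff has_derivative_mult_left has_derivative_vec_nth has_derivative_ident)
    then have "(\<lambda>h. h $ i - h $ i0 * v $ i) = (\<lambda>h. fderiv ?s z h $ i)"
      using der[of i] False by (intro has_derivative_unique[of "\<lambda>z. z $ i - z $ i0 * v $ i" _ z])
        (auto simp: straighten_def)
    from fun_cong[OF this, of h] zero show ?thesis by simp
  qed (simp add: v)
  have hv: "h = h $ i0 *s v" unfolding vec_eq_iff by (metis h vector_smult_component)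
  have "fderiv f z = (\<lambda>h. fderiv ?s z h $ i0)"
    using der[of i0] holo_fun_has_derivative[OF poly_fun_holo[OF f], of z]
    by (intro has_derivative_unique[of f _ z]) (auto simp: straighten_def)
  from fun_cong[OF this, of h] zero have "fderiv f z h = 0" by simp
  then have "h $ i0 * fderiv f z v = 0"
    using holo_fun_scale[OF poly_fun_holo[OF f] UNIV_I] hv by metis
  then have "h $ i0 = 0" using nz by simp
  then show "h = 0" by (metis hv vector_smult_lzero)
qed

text \<open>The chart maps \<open>{f = 0}\<close> to the hyperplane \<open>w $ i0 = 0\<close>; a
  variety filling a piece of this hypersurface thus acquires a regular point of codimension
  one.\<close>

lemma regular_point_of_graph:
  fixes V :: "(complex ^ 'n) set"
  assumes "z \<in> V" "z \<in> U" "holo_map U (straighten i0 v f)" "holo_map W g" "straighten i0 v f ` U = W"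
    "\<And>x. x \<in> U \<Longrightarrow> g (straighten i0 v f x) = x" "\<And>w. w \<in> W \<Longrightarrow> straighten i0 v f (g w) = w"
    and V: "V \<inter> U = {x \<in> U. f x = 0}"
  shows "regular_point_dim V z (CARD('n) - 1)"
  unfolding regular_point_dim_def
proof (rule conjI, fact assms(1), rule exI[of _ U], rule exI[of _ W], rule exI[of _ "straighten i0 v f"],
    rule exI[of _ g], rule exI[of _ "- {i0}"], intro conjI)
  show "card (- {i0}) = CARD('n) - 1" by (simp add: Compl_eq_Diff_UNIV card_Diff_singleton)
  show "straighten i0 v f ` (V \<inter> U) = {w \<in> W. \<forall>i. i \<notin> - {i0} \<longrightarrow> w $ i = 0}"
    unfolding V using assms(5) by (auto simp: straighten_def)
qed (use assms in auto)

text \<open>Suppose every line meets \<open>V\<close>. Among the polynomials vanishing on the part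
  of \<open>V\<close> over some open set of lines, take \<open>f\<close> of least degree
  \<open>d\<close> along \<open>v\<close>. By minimality, over every open set some point of
  \<open>V\<close> is a simple zero of \<open>f\<close> on its line. Near it \<open>V\<close> cannot
  fill \<open>{f = 0}\<close>, so a further zero lies off \<open>V\<close> and persists on nearby
  lines. Repetition yields \<open>d + 1\<close> zeros on one line.\<close>

lemma line_missing_variety:
  fixes V :: "(complex ^ 'n) set"
  assumes "closed V" and v: "v $ i0 = 1" and f0: "f0 \<in> poly_fun" "line_degree v d0 f0" "\<And>z. z \<in> V \<Longrightarrow> f0 z = 0"
    and noreg: "\<And>z. \<not> regular_point_dim V z (CARD('n) - 1)"
  shows "\<exists>b. \<forall>t. b + t *s v \<notin> V"
proof (rule ccontr)
  assume "\<nexists>b. \<forall>t. b + t *s v \<notin> V"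
  then have all: "\<exists>t. b + t *s v \<in> V" for b by blast
  define Q where "Q d \<longleftrightarrow> (\<exists>A f. open A \<and> A \<noteq> {} \<and> f \<in> poly_fun \<and> line_degree v d f \<and>
      (\<forall>b\<in>A. \<forall>t. b + t *s v \<in> V \<longrightarrow> f (b + t *s v) = 0))" for d
  have "Q d0" unfolding Q_def using f0 by (intro exI[of _ UNIV] exI[of _ f0]) auto
  define d where "d = (LEAST d. Q d)"
  have "Q d" unfolding d_def using \<open>Q d0\<close> by (rule LeastI)
  then obtain A f where A: "open A" "A \<noteq> {}" and f: "f \<in> poly_fun" "line_degree v d f"
    and van: "\<And>b t. b \<in> A \<Longrightarrow> b + t *s v \<in> V \<Longrightarrow> f (b + t *s v) = 0"
    unfolding Q_def by blast
  have "d \<noteq> 0"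
  proof
    assume "d = 0"
    obtain b where "b \<in> A" using A by blast
    obtain p where p: "p \<noteq> 0" "degree p = 0" "\<forall>t. poly p t = f (b + t *s v)"
      using f \<open>d = 0\<close> by (auto simp: line_degree_def)
    obtain t where "b + t *s v \<in> V" using all by blast
    then have "poly p t = 0" using van \<open>b \<in> A\<close> p by simp
    moreover obtain a where "p = [:a:]" using p(2) by (rule degree_eq_zeroE)
    ultimately show False using p(1) by simp
  qed
  then obtain e where e: "d = Suc e" by (cases d) auto
  let ?f' = "\<lambda>z. fderiv f z v"
  have "e < d" using e by simp
  then have "\<not> Q e" unfolding d_def by (rule not_less_Least)
  \<comment> \<open>Otherwise the derivative along \<open>v\<close>, of degree \<open>e < d\<close>,
    would contradict the choice of \<open>d\<close>.\<close>
  have simple: "\<exists>b\<in>A1. \<exists>t. b + t *s v \<in> V \<and> ?f' (b + t *s v) \<noteq> 0"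
    if "open A1" "A1 \<noteq> {}" for A1
  proof (rule ccontr)
    assume "\<not> ?thesis"
    then have "Q e" unfolding Q_def
      using that poly_fun_directional_derivative[OF f(1)] line_degree_derivative[OF f(1)] f(2) e
      by (intro exI[of _ A1] exI[of _ ?f']) auto
    with \<open>\<not> Q e\<close> show False ..
  qed
  \<comment> \<open>\<open>C\<close> is a closed set off \<open>V\<close> that holds the zeros found
    so far. Each new zero is found outside \<open>C\<close>, hence differs from the old
    ones.\<close>
  have step: "\<exists>A1 C. open A1 \<and> A1 \<noteq> {} \<and> A1 \<subseteq> A \<and> closed C \<and> C \<inter> V = {} \<and>
      (\<forall>b\<in>A1. \<exists>T. finite T \<and> card T = s \<and> (\<forall>t\<in>T. b + t *s v \<in> C \<and> f (b + t *s v) = 0))" for s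
  proof (induction s)
    case 0
    show ?case by (rule exI[of _ A], rule exI[of _ "{}"]) (use A in \<open>auto intro!: exI[of _ "{}"]\<close>)
  next
    case (Suc s)
    then obtain A1 C where A1: "open A1" "A1 \<noteq> {}" "A1 \<subseteq> A" and C: "closed C" "C \<inter> V = {}"
      and T: "\<And>b. b \<in> A1 \<Longrightarrow> \<exists>T. finite T \<and> card T = s \<and> (\<forall>t\<in>T. b + t *s v \<in> C \<and> f (b + t *s v) = 0)"
      by blast
    obtain b1 t1 where b1: "b1 \<in> A1" "b1 + t1 *s v \<in> V" "?f' (b1 + t1 *s v) \<noteq> 0"
      using simple[OF A1(1,2)] by blast
    define z1 where "z1 = b1 + t1 *s v"
    \<comment> \<open>A point \<open>z\<close> near \<open>z1\<close> lies on the line with base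
      point \<open>z - t1 *s v\<close>, which has to stay in \<open>A1\<close>.\<close>
    define U0 where "U0 = {z. z - t1 *s v \<in> A1} \<inter> - C"
    have "open {z. z - t1 *s v \<in> A1}"
      using open_vimage[OF A1(1), of "\<lambda>z. z - t1 *s v"] by (simp add: vimage_def continuous_intros)
    then have "open U0" using C by (simp add: U0_def open_Int open_Compl)
    have "z1 \<in> U0" using b1 C by (auto simp: U0_def z1_def)
    let ?\<phi> = "straighten i0 v f"
    have holo: "holo_map U0 ?\<phi>"
      using straighten_holo[OF f(1)] \<open>open U0\<close> by (auto simp: holo_map_def)
    obtain U W g where U: "z1 \<in> U" "U \<subseteq> U0" "holo_map U ?\<phi>" "holo_map W g" "?\<phi> ` U = W"
      "\<And>x. x \<in> U \<Longrightarrow> g (?\<phi> x) = x" "\<And>w. w \<in> W \<Longrightarrow> ?\<phi> (g w) = w"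
      using holo_inverse_function[OF holo \<open>z1 \<in> U0\<close>
          straighten_derivative_injective[OF f(1) v b1(3)[folded z1_def]]] by blast
    have VU: "f z = 0" if "z \<in> V" "z \<in> U" for z
      using van[of "z - t1 *s v" t1] that U(2) A1(3) by (auto simp: U0_def)
    have "\<exists>z\<in>U. f z = 0 \<and> z \<notin> V"
    proof (rule ccontr)
      assume "\<not> (\<exists>z\<in>U. f z = 0 \<and> z \<notin> V)"
      then have "V \<inter> U = {x \<in> U. f x = 0}" using VU by blast
      from regular_point_of_graph[OF _ U(1,3-7) this] b1(2) noreg show False by (simp add: z1_def)
    qed
    then obtain z3 where z3: "z3 \<in> U" "f z3 = 0" "z3 \<notin> V" by blast
    have "open (U \<inter> - V)" using U(3) \<open>closed V\<close> by (auto simp: holo_map_def)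
    then obtain r where r: "r > 0" "cball z3 r \<subseteq> U \<inter> - V"
      using z3 open_contains_cball by (metis ComplI IntI)
    \<comment> \<open>\<open>\<psi> b\<close> is the chart value of a zero of \<open>f\<close> on
      the line through \<open>b\<close>, so \<open>g (\<psi> b)\<close> is such a zero.\<close>
    define \<psi> where "\<psi> = straighten i0 v (\<lambda>_. 0)"
    have \<psi>_cont: "continuous_on UNIV \<psi>"
      unfolding \<psi>_def by (rule holo_map_continuous[OF straighten_holo[OF poly_fun.const]])
    have "open W" using U by (simp add: holo_map_def)
    have "open (W \<inter> g -` ball z3 r)"
      using continuous_open_preimage[OF holo_map_continuous[OF U(4)] \<open>open W\<close>] by simp
    then have "open (\<psi> -` (W \<inter> g -` ball z3 r))"
      using \<psi>_cont by (rule open_vimage)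
    then have "open (A1 \<inter> \<psi> -` (W \<inter> g -` ball z3 r))" (is "open ?A2") using A1 by blast
    have "z3 - t1 *s v \<in> ?A2"
    proof -
      have "\<psi> (z3 - t1 *s v) = ?\<phi> z3"
        using z3 v by (simp add: \<psi>_def straighten_def vec_eq_iff algebra_simps)
      moreover have "?\<phi> z3 \<in> W" using U(5) z3 by blast
      ultimately show ?thesis using U z3 r by (auto simp: U0_def)
    qed
    have T': "\<exists>T'. finite T' \<and> card T' = Suc s \<and>
        (\<forall>t\<in>T'. b + t *s v \<in> C \<union> cball z3 r \<and> f (b + t *s v) = 0)" if b: "b \<in> ?A2" for b
    proof -
      obtain T where T: "finite T" "card T = s" "\<And>t. t \<in> T \<Longrightarrow> b + t *s v \<in> C \<and> f (b + t *s v) = 0"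
        using T[of b] b by blast
      define z where "z = g (\<psi> b)"
      have z: "z \<in> ball z3 r" "?\<phi> z = \<psi> b" using b U(7) by (auto simp: z_def)
      have zi: "b $ i + (z $ i0 - b $ i0) * v $ i = z $ i" for i
        using arg_cong[OF z(2), of "\<lambda>x. x $ i"] v
        by (auto simp: straighten_def \<psi>_def algebra_simps split: if_splits)
      then have zb: "b + (z $ i0 - b $ i0) *s v = z" unfolding vec_eq_iff by (metis vector_add_component vector_smult_component)
      have "f z = 0" using arg_cong[OF z(2), of "\<lambda>x. x $ i0"] by (simp add: straighten_def \<psi>_def)
      have "z \<in> U" using z r by (auto simp: subset_iff)
      then have "z \<notin> C" using U by (auto simp: U0_def)
      then have "z $ i0 - b $ i0 \<notin> T" using T(3) zb by metis
      then show ?thesis using T zb z \<open>f z = 0\<close>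
        by (intro exI[of _ "insert (z $ i0 - b $ i0) T"]) auto
    qed
    show ?case
    proof (rule exI[of _ ?A2], rule exI[of _ "C \<union> cball z3 r"], intro conjI ballI)
      show "closed (C \<union> cball z3 r)" using C by auto
      show "(C \<union> cball z3 r) \<inter> V = {}" using C r by auto
    qed (use \<open>open ?A2\<close> \<open>z3 - t1 *s v \<in> ?A2\<close> A1 T' in \<open>auto simp del: vimage_Int\<close>)
  qed
  from step[of "Suc d"] obtain b T where T: "finite T" "card T = Suc d" "\<forall>t\<in>T. f (b + t *s v) = 0" by blast
  obtain p where p: "p \<noteq> 0" "degree p = d" "\<forall>t. poly p t = f (b + t *s v)"
    using f by (auto simp: line_degree_def)
  have "T \<subseteq> {t. poly p t = 0}" using T p by auto
  then have "card T \<le> degree p"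
    using card_mono[OF poly_roots_finite[OF p(1)]] card_poly_roots_bound[OF p(1)] by (meson le_trans)
  then show False using T p by simp
qed

text \<open>\<open>i0\<close> is the index of the unsquared coordinate. At modulus
  \<open>M \<ge> 3\<close> squaring, minus a coupling term of size at most \<open>M\<close>, still
  doubles.\<close>

definition escaping :: "'n \<Rightarrow> complex ^ 'n \<Rightarrow> bool" where
  "escaping i0 w \<longleftrightarrow> (\<exists>i. i \<noteq> i0 \<and> 3 \<le> cmod (w $ i) \<and> (\<forall>j. cmod (w $ j) \<le> cmod (w $ i)))"

lemma obtain_max_component:
  fixes w :: "complex ^ 'n"
  obtains i where "\<And>j. cmod (w $ j) \<le> cmod (w $ i)"
proof -
  have "Max (range (\<lambda>j. cmod (w $ j))) \<in> range (\<lambda>j. cmod (w $ j))" by (intro Max_in) auto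
  then obtain i where "Max (range (\<lambda>j. cmod (w $ j))) = cmod (w $ i)" by (rule rangeE)
  then show thesis using that[of i] Max_ge[of "range (\<lambda>j. cmod (w $ j))"] by auto
qed

text \<open>The missed line becomes the \<open>i0\<close>-axis. The variety keeps a positive
  distance from it, and by the cone estimate its height along the line is at most linear in that
  distance; two scaling factors then place it in the escaping region.\<close>

lemma affine_coordinates_avoiding_variety:
  fixes V :: "(complex ^ 'n) set"
  assumes V: "algebraic_variety_codim V 2" and k: "CARD('n) \<ge> 3"
  obtains i0 \<Psi> where "holo_automorphism \<Psi>" "\<And>i. (\<lambda>z. \<Psi> z $ i) \<in> poly_fun" "\<And>z. z \<in> V \<Longrightarrow> escaping i0 (\<Psi> z)"
proof -
  obtain P where P: "P \<subseteq> poly_fun" "V = {z. \<forall>f\<in>P. f z = 0}"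
    using V by (auto simp: algebraic_variety_codim_def algebraic_set_def)
  have dim: "d \<le> CARD('n) - 2" if "regular_point_dim V z d" for z d
    using V that by (auto simp: algebraic_variety_codim_def has_dimension_def)
  obtain z0 where "z0 \<in> V"
    using V by (auto simp: algebraic_variety_codim_def has_dimension_def regular_point_dim_def)
  have "closed V"
  proof -
    have "V = (\<Inter>f\<in>P. f -` {0})" using P by auto
    moreover have "closed (f -` {0})" if "f \<in> P" for f
      using that P poly_fun_continuous[of f UNIV] by (intro continuous_closed_vimage) (auto simp: continuous_on_eq_continuous_at)
    ultimately show ?thesis by auto
  qed
  have "\<exists>f\<in>P. \<exists>a. f a \<noteq> 0"
  proof (rule ccontr)
    assume "\<not> (\<exists>f\<in>P. \<exists>a. f a \<noteq> 0)"
    then have "V = UNIV" using P by auto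
    have id: "holo_map UNIV (\<lambda>z :: complex ^ 'n. z)"
      unfolding holo_map_iff by (auto intro: holo_fun_coord)
    have "regular_point_dim V z0 CARD('n)"
      unfolding regular_point_dim_def
      by (rule conjI, fact, rule exI[of _ UNIV], rule exI[of _ UNIV], rule exI[of _ "\<lambda>z. z"],
          rule exI[of _ "\<lambda>z. z"], rule exI[of _ UNIV]) (use id \<open>V = UNIV\<close> in auto)
    from dim[OF this] k show False by simp
  qed
  then obtain f a where f: "f \<in> poly_fun" "f a \<noteq> 0" and fV: "\<And>z. z \<in> V \<Longrightarrow> f z = 0" using P by blast
  obtain v0 d \<epsilon>0 R0 where v0: "v0 = 0 \<Longrightarrow> d = 0" "line_degree v0 d f" "\<epsilon>0 > 0" "R0 > 0"
    "\<And>t x. cmod t \<ge> R0 \<Longrightarrow> norm x \<le> \<epsilon>0 * cmod t \<Longrightarrow> f (t *s v0 + x) \<noteq> 0"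
    using poly_fun_generic_direction[OF f] by blast
  have "v0 \<noteq> 0"
  proof
    assume "v0 = 0"
    then obtain p where p: "p \<noteq> 0" "degree p = 0" "\<forall>t. poly p t = f (z0 + t *s v0)"
      using v0(1,2) by (auto simp: line_degree_def)
    have "poly p 0 = 0" using p(3) fV[OF \<open>z0 \<in> V\<close>] by simp
    moreover obtain a where "p = [:a:]" using p(2) by (rule degree_eq_zeroE)
    ultimately show False using p(1) by simp
  qed
  then obtain i0 where i0: "v0 $ i0 \<noteq> 0" by (auto simp: vec_eq_iff)
  define \<mu> where "\<mu> = v0 $ i0"
  define v where "v = inverse \<mu> *s v0"
  have "\<mu> \<noteq> 0" using i0 by (simp add: \<mu>_def)
  have v: "v $ i0 = 1" using i0 by (simp add: v_def \<mu>_def)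
  have v0v: "v0 = \<mu> *s v" using \<open>\<mu> \<noteq> 0\<close> by (simp add: v_def vec_eq_iff)
  define \<epsilon> where "\<epsilon> = \<epsilon>0 / cmod \<mu>"
  define R where "R = R0 * cmod \<mu>"
  have "\<epsilon> > 0" "R > 0" using \<open>\<mu> \<noteq> 0\<close> v0 by (simp_all add: \<epsilon>_def R_def)
  have cone: "f (t *s v + x) \<noteq> 0" if "cmod t \<ge> R" "norm x \<le> \<epsilon> * cmod t" for t x
  proof -
    have "f ((t / \<mu>) *s v0 + x) \<noteq> 0"
      using that \<open>\<mu> \<noteq> 0\<close> by (intro v0(5)) (simp_all add: norm_divide R_def \<epsilon>_def field_simps)
    moreover have "(t / \<mu>) *s v0 = t *s v" using \<open>\<mu> \<noteq> 0\<close> by (simp add: v0v)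
    ultimately show ?thesis by simp
  qed
  have ld: "line_degree v d f"
    unfolding line_degree_def
  proof
    fix b
    obtain p where p: "p \<noteq> 0" "degree p = d" "\<forall>t. poly p t = f (b + t *s v0)"
      using v0(2) by (auto simp: line_degree_def)
    have "poly (pcompose p [:0, inverse \<mu>:]) t = f (b + t *s v)" for t
      using p(3) \<open>\<mu> \<noteq> 0\<close> by (simp add: poly_pcompose v0v mult.assoc)
    moreover have "degree (pcompose p [:0, inverse \<mu>:]) = d" using p \<open>\<mu> \<noteq> 0\<close> by (simp add: degree_pcompose)
    moreover have "pcompose p [:0, inverse \<mu>:] \<noteq> 0"
      using p(1) \<open>\<mu> \<noteq> 0\<close> pcompose_eq_0[of p "[:0, inverse \<mu>:]"] by auto
    ultimately show "\<exists>p. p \<noteq> 0 \<and> degree p = d \<and> (\<forall>t. poly p t = f (b + t *s v))" by blast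
  qed
  have "\<not> regular_point_dim V z (CARD('n) - 1)" for z
    using dim[of z "CARD('n) - 1"] k by auto
  from line_missing_variety[OF \<open>closed V\<close> v f(1) ld fV this]
  obtain b where b: "\<And>t. b + t *s v \<notin> V" by blast
  \<comment> \<open>\<open>c\<close> is where the missed line meets the hyperplane
    \<open>z $ i0 = 0\<close>; \<open>x z\<close> is the displacement of \<open>z\<close> from the
    line, measured parallel to that hyperplane.\<close>
  define c where "c = b - b $ i0 *s v"
  define x where "x z = z - z $ i0 *s v - c" for z
  have x_i0: "x z $ i0 = 0" for z using v by (simp add: x_def c_def)
  have x_nz: "x z \<noteq> 0" if "z \<in> V" for z
  proof
    assume "x z = 0"
    then have "z = b + (z $ i0 - b $ i0) *s v" by (simp add: x_def c_def vec_eq_iff algebra_simps)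
    then show False using b that by metis
  qed
  have z_eq: "z = z $ i0 *s v + (x z + c)" for z by (simp add: x_def)
  \<comment> \<open>A higher point would lie in the cone on which \<open>f\<close> has no
    zeros.\<close>
  have height: "cmod (z $ i0) \<le> R + norm c / \<epsilon> + norm (x z) / \<epsilon>" if "z \<in> V" for z
  proof (rule ccontr)
    assume "\<not> ?thesis"
    then have gt: "cmod (z $ i0) > R + (norm c + norm (x z)) / \<epsilon>" by (simp add: add_divide_distrib)
    have "(norm c + norm (x z)) / \<epsilon> \<ge> 0" using \<open>\<epsilon> > 0\<close> by simp
    then have "cmod (z $ i0) \<ge> R" using gt by linarith
    moreover have "norm (x z + c) \<le> \<epsilon> * cmod (z $ i0)"
    proof -
      have "(norm c + norm (x z)) / \<epsilon> \<le> cmod (z $ i0)" using gt \<open>R > 0\<close> by linarith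
      then have "norm c + norm (x z) \<le> \<epsilon> * cmod (z $ i0)" using \<open>\<epsilon> > 0\<close> by (simp add: pos_divide_le_eq mult.commute)
      then show ?thesis using norm_triangle_ineq[of "x z" c] by linarith
    qed
    ultimately have "f (z $ i0 *s v + (x z + c)) \<noteq> 0" by (rule cone)
    then show False using fV[OF that] z_eq[of z] by simp
  qed
  have x_cont: "continuous_on A x" for A
    unfolding x_def by (intro continuous_intros bounded_linear.continuous_on[OF bounded_linear_scalar_line])
  \<comment> \<open>The height bound makes the part of \<open>V\<close> with
    \<open>norm (x z) \<le> 1\<close> compact, so the nonvanishing \<open>x\<close> is bounded away
    from 0 there.\<close>
  have "\<exists>r>0. r \<le> 1 \<and> (\<forall>z\<in>V. norm (x z) \<ge> r)"
  proof -
    define K where "K = V \<inter> {z. norm (x z) \<le> 1}"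
    have "closed {z. norm (x z) \<le> 1}"
      by (intro closed_Collect_le continuous_intros x_cont)
    moreover have "bounded K"
    proof (rule boundedI)
      fix z assume z: "z \<in> K"
      have "norm z \<le> cmod (z $ i0) * norm v + (norm (x z) + norm c)"
        using z_eq[of z] norm_triangle_ineq[of "z $ i0 *s v" "x z + c"] norm_triangle_ineq[of "x z" c]
        by (simp add: norm_vector_scalar_mult)
      also have "\<dots> \<le> (R + norm c / \<epsilon> + 1 / \<epsilon>) * norm v + (1 + norm c)"
      proof (intro add_mono mult_right_mono)
        have "cmod (z $ i0) \<le> R + norm c / \<epsilon> + norm (x z) / \<epsilon>" using height z by (simp add: K_def)
        also have "\<dots> \<le> R + norm c / \<epsilon> + 1 / \<epsilon>"
          using z \<open>\<epsilon> > 0\<close> by (simp add: K_def divide_right_mono)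
        finally show "cmod (z $ i0) \<le> R + norm c / \<epsilon> + 1 / \<epsilon>" .
      qed (use z in \<open>auto simp: K_def\<close>)
      finally show "norm z \<le> (R + norm c / \<epsilon> + 1 / \<epsilon>) * norm v + (1 + norm c)" .
    qed
    ultimately have "compact K" using \<open>closed V\<close> by (auto simp: K_def compact_eq_bounded_closed)
    show ?thesis
    proof (cases "K = {}")
      case True
      then show ?thesis by (intro exI[of _ 1]) (auto simp: K_def)
    next
      case False
      have "continuous_on K (\<lambda>z. norm (x z))" by (intro continuous_intros x_cont)
      from continuous_attains_inf[OF \<open>compact K\<close> False this]
      obtain z1 where z1: "z1 \<in> K" "\<And>z. z \<in> K \<Longrightarrow> norm (x z1) \<le> norm (x z)" by blast
      show ?thesis
      proof (intro exI[of _ "norm (x z1)"] conjI ballI)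
        show "0 < norm (x z1)" "norm (x z1) \<le> 1" using z1(1) x_nz by (auto simp: K_def)
        fix z assume "z \<in> V"
        show "norm (x z1) \<le> norm (x z)"
        proof (cases "norm (x z) \<le> 1")
          case False
          then show ?thesis using \<open>norm (x z1) \<le> 1\<close> by simp
        qed (use z1 \<open>z \<in> V\<close> in \<open>auto simp: K_def\<close>)
      qed
    qed
  qed
  then obtain r where r: "r > 0" "\<And>z. z \<in> V \<Longrightarrow> norm (x z) \<ge> r" by blast
  define k where "k = real CARD('n)"
  \<comment> \<open>\<open>H\<close> bounds the height of \<open>V\<close> relative to
    \<open>norm (x z)\<close>. The largest coordinate of \<open>x z\<close> is at least
    \<open>r / k\<close>, so \<open>\<kappa>1\<close> lifts it to 3; \<open>\<kappa>2\<close> then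
    keeps the coordinate \<open>i0\<close> below it.\<close>
  define H where "H = (R + norm c / \<epsilon>) / r + 1 / \<epsilon>"
  define \<kappa>1 where "\<kappa>1 = 3 * k / r"
  define \<kappa>2 where "\<kappa>2 = \<kappa>1 / (k * H)"
  have "k > 0" by (simp add: k_def)
  have "H > 0" using \<open>R > 0\<close> \<open>\<epsilon> > 0\<close> r by (simp add: H_def add_nonneg_pos add_pos_pos)
  have "\<kappa>1 > 0" using \<open>k > 0\<close> r by (simp add: \<kappa>1_def)
  have "\<kappa>2 > 0" using \<open>\<kappa>1 > 0\<close> \<open>k > 0\<close> \<open>H > 0\<close> by (simp add: \<kappa>2_def)
  have slope: "cmod (z $ i0) \<le> H * norm (x z)" if "z \<in> V" for z
  proof -
    have "R + norm c / \<epsilon> \<le> (R + norm c / \<epsilon>) / r * norm (x z)"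
    proof -
      have "(R + norm c / \<epsilon>) * 1 \<le> (R + norm c / \<epsilon>) * (norm (x z) / r)"
        using r(2)[OF that] r(1) \<open>R > 0\<close> \<open>\<epsilon> > 0\<close> by (intro mult_left_mono) auto
      then show ?thesis by simp
    qed
    then show ?thesis using height[OF that] by (simp add: H_def algebra_simps)
  qed
  define \<Psi> :: "complex ^ 'n \<Rightarrow> complex ^ 'n" where
    "\<Psi> z = (\<chi> i. if i = i0 then of_real \<kappa>2 * z $ i0 else of_real \<kappa>1 * x z $ i)" for z
  define \<Phi> :: "complex ^ 'n \<Rightarrow> complex ^ 'n" where
    "\<Phi> w = (\<chi> i. if i = i0 then inverse (of_real \<kappa>2) * w $ i0
       else inverse (of_real \<kappa>1) * w $ i + inverse (of_real \<kappa>2) * w $ i0 * v $ i + c $ i)" for w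
  have \<Psi>_poly: "(\<lambda>z. \<Psi> z $ i) \<in> poly_fun" for i
    by (cases "i = i0")
       (auto simp: \<Psi>_def x_def intro!: poly_fun_diff poly_fun.coord poly_fun.mult poly_fun.const)
  have \<Phi>_poly: "(\<lambda>z. \<Phi> z $ i) \<in> poly_fun" for i
    by (cases "i = i0")
       (auto simp: \<Phi>_def intro!: poly_fun.add poly_fun.coord poly_fun.mult poly_fun.const)
  have \<Phi>\<Psi>: "\<Phi> (\<Psi> z) = z" for z
    using \<open>\<kappa>1 > 0\<close> \<open>\<kappa>2 > 0\<close> by (simp add: \<Psi>_def \<Phi>_def vec_eq_iff x_def field_simps)
  have \<Psi>\<Phi>: "\<Psi> (\<Phi> z) = z" for z
    using \<open>\<kappa>1 > 0\<close> \<open>\<kappa>2 > 0\<close> by (simp add: \<Psi>_def \<Phi>_def vec_eq_iff x_def field_simps)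
  have bij: "bij \<Psi>" using \<Phi>\<Psi> \<Psi>\<Phi> by (intro o_bij[of \<Phi>]) (auto simp: fun_eq_iff)
  have inv: "inv \<Psi> = \<Phi>" using \<Phi>\<Psi> \<Psi>\<Phi> by (rule inv_equality)
  show thesis
  proof
    show "holo_automorphism \<Psi>"
      unfolding holo_automorphism_def inv holo_map_iff
      using bij \<Psi>_poly \<Phi>_poly poly_fun_holo by auto
    show "(\<lambda>z. \<Psi> z $ i) \<in> poly_fun" for i by (rule \<Psi>_poly)
    fix z assume z: "z \<in> V"
    obtain i where i: "\<And>j. cmod (x z $ j) \<le> cmod (x z $ i)"
      using obtain_max_component[of "x z"] by blast
    have "norm (x z) \<le> (\<Sum>j\<in>UNIV. cmod (x z $ j))" by (simp add: norm_vec_def L2_set_le_sum)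
    also have "\<dots> \<le> k * cmod (x z $ i)"
      using sum_bounded_above[of UNIV "\<lambda>j. cmod (x z $ j)" "cmod (x z $ i)"] i by (simp add: k_def)
    finally have nx: "norm (x z) \<le> k * cmod (x z $ i)" .
    have "i \<noteq> i0"
    proof
      assume "i = i0"
      then have "norm (x z) \<le> 0" using nx x_i0 by simp
      then show False using x_nz[OF z] by simp
    qed
    have \<Psi>i: "cmod (\<Psi> z $ i) = \<kappa>1 * cmod (x z $ i)"
      using \<open>i \<noteq> i0\<close> \<open>\<kappa>1 > 0\<close> by (simp add: \<Psi>_def norm_mult)
    have "3 \<le> cmod (\<Psi> z $ i)"
    proof -
      have "r \<le> k * cmod (x z $ i)" using r(2)[OF z] nx by linarith
      then show ?thesis unfolding \<Psi>i \<kappa>1_def using r(1) by (simp add: field_simps)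
    qed
    moreover have "cmod (\<Psi> z $ j) \<le> cmod (\<Psi> z $ i)" for j
    proof (cases "j = i0")
      case True
      have "cmod (\<Psi> z $ j) = \<kappa>2 * cmod (z $ i0)" using True \<open>\<kappa>2 > 0\<close> by (simp add: \<Psi>_def norm_mult)
      also have "\<dots> \<le> \<kappa>2 * (H * (k * cmod (x z $ i)))"
        using order_trans[OF slope[OF z] mult_left_mono[OF nx, of H]] \<open>\<kappa>2 > 0\<close> \<open>H > 0\<close>
        by (intro mult_left_mono) auto
      also have "\<dots> = \<kappa>1 * cmod (x z $ i)" using \<open>H > 0\<close> \<open>k > 0\<close> by (simp add: \<kappa>2_def)
      finally show ?thesis using \<Psi>i by simp
    next
      case False
      then show ?thesis using i[of j] \<open>\<kappa>1 > 0\<close> \<Psi>i by (simp add: \<Psi>_def norm_mult mult_left_mono)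
    qed
    ultimately show "escaping i0 (\<Psi> z)" using \<open>i \<noteq> i0\<close> by (auto simp: escaping_def)
  qed
qed

section \<open>The dynamical system\<close>

lemma poly_fun_power: "f \<in> poly_fun \<Longrightarrow> (\<lambda>z. f z ^ n) \<in> poly_fun"
  by (induction n) (auto intro: poly_fun.const poly_fun.mult)

lemma cmod_nth_le: "cmod ((w :: complex ^ 'n) $ i) \<le> norm w"
  unfolding norm_vec_def by (rule member_le_L2_set) auto

lemma norm_axis_complex: "norm (axis i c :: complex ^ 'n) = cmod c"
  unfolding norm_eq_sqrt_inner by (simp add: inner_axis_axis)

lemma root_add_le:
  fixes a b :: real
  assumes "a \<ge> 0" "b \<ge> 0" "m > 0"
  shows "root m (a + b) \<le> root m a + root m b"
proof (rule real_root_le_iff[THEN iffD1, of 1])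
  have "a + b = root m a ^ m + root m b ^ m" using assms by simp
  also have "\<dots> \<le> (root m a + root m b) ^ m"
  proof -
    have "x ^ m + y ^ m \<le> (x + y) ^ m" if "x \<ge> 0" "y \<ge> 0" for x y :: real
      using \<open>m > 0\<close>
    proof (induction m rule: nat_induct_non_zero)
      case (Suc n)
      have "x ^ Suc n + y ^ Suc n \<le> (x + y) * (x ^ n + y ^ n)"
        using that by (simp add: algebra_simps)
      also have "\<dots> \<le> (x + y) * (x + y) ^ n" using Suc that by (intro mult_left_mono) auto
      finally show ?case by simp
    qed simp
    from this[of "root m a" "root m b"] show ?thesis using assms by simp
  qed
  finally have "root m (a + b) \<le> root m ((root m a + root m b) ^ m)" using assms by simp
  also have "\<dots> = root m a + root m b" using assms by (intro real_root_power_cancel) auto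
  finally show "root 1 (root m (a + b)) \<le> root 1 (root m a + root m b)" by simp
qed simp

text \<open>A perturbation of size \<open>d ^ m\<close> moves the root by at most \<open>d\<close>,
  whatever the values: the potentials therefore converge across zeros of the coordinates
  too.\<close>

lemma root_diff_le:
  fixes a b :: real
  assumes "a \<ge> 0" "b \<ge> 0" "m > 0"
  shows "\<bar>root m a - root m b\<bar> \<le> root m \<bar>a - b\<bar>"
proof -
  have *: "root m x - root m y \<le> root m \<bar>x - y\<bar>" if "x \<ge> 0" "y \<ge> 0" for x y
  proof -
    have "root m x \<le> root m (y + \<bar>x - y\<bar>)" using assms by (subst real_root_le_iff) auto
    also have "\<dots> \<le> root m y + root m \<bar>x - y\<bar>" using that assms by (intro root_add_le) auto
    finally show ?thesis by simp
  qed
  show ?thesis using *[of a b] *[of b a] assms by (simp add: abs_minus_commute abs_le_iff)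
qed

text \<open>\<open>\<eta> n\<close> is the coupling of the \<open>n\<close>-th map.  On the region where the \<open>n\<close>-th iterate is bounded by \<open>Q n\<close>
  (which eventually contains every point) it changes the \<open>2\<^sup>n\<close>-th roots of the coordinates by at most \<open>\<delta> n\<close>.\<close>
definition \<delta> :: "nat \<Rightarrow> real" where "\<delta> n = (1/4) ^ n / 100"
definition Q :: "nat \<Rightarrow> real" where "Q n = real (n + 1) ^ (2 ^ n)"
definition \<eta> :: "nat \<Rightarrow> real" where "\<eta> n = ((\<delta> n)\<^sup>2 / real (n + 1)) ^ (2 ^ n)"

lemma \<delta>_pos: "\<delta> n > 0" by (simp add: \<delta>_def)
lemma \<delta>_le: "\<delta> n \<le> 1 / 100" by (simp add: \<delta>_def power_le_one)
lemma \<delta>_Suc: "\<delta> (Suc n) = \<delta> n / 4" by (simp add: \<delta>_def)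
lemma \<delta>_lim: "\<delta> \<longlonglongrightarrow> 0"
  unfolding \<delta>_def by (intro tendsto_eq_intros LIMSEQ_realpow_zero) auto
lemma eventually_\<delta>_less: "\<epsilon> > 0 \<Longrightarrow> \<forall>\<^sub>F n in sequentially. \<delta> n < \<epsilon>"
  by (rule order_tendstoD(2)[OF \<delta>_lim])

lemma Q_Suc: "(Q n)\<^sup>2 \<le> Q (Suc n)"
proof -
  have "(Q n)\<^sup>2 = real (n + 1) ^ (2 ^ Suc n)" by (simp add: Q_def power_mult[symmetric] mult.commute)
  also have "\<dots> \<le> Q (Suc n)" unfolding Q_def by (intro power_mono) auto
  finally show ?thesis .
qed

lemma \<eta>_pos: "\<eta> n > 0" using \<delta>_pos[of n] by (simp add: \<eta>_def)

text \<open>This identity dictates \<open>\<eta>\<close>: on an orbit bounded by \<open>Q n\<close>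
  the root of order \<open>2 ^ Suc n\<close> of the coupling term is at most
  \<open>\<delta> n\<close>.\<close>

lemma \<eta>_Q: "\<eta> n * Q n = \<delta> n ^ (2 ^ Suc n)"
proof -
  have "\<eta> n * Q n = ((\<delta> n)\<^sup>2 / real (n + 1) * real (n + 1)) ^ (2 ^ n)"
    unfolding \<eta>_def Q_def by (rule power_mult_distrib[symmetric])
  also have "(\<delta> n)\<^sup>2 / real (n + 1) * real (n + 1) = (\<delta> n)\<^sup>2" by simp
  finally show ?thesis by (simp add: power_mult[symmetric])
qed

lemma \<eta>_le: "\<eta> n \<le> 1 / 100"
proof -
  have a: "(\<delta> n)\<^sup>2 / real (n + 1) \<le> (1 / 100)\<^sup>2 / 1"
    using \<delta>_pos[of n] \<delta>_le[of n] by (intro frac_le power_mono) auto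
  have "\<eta> n \<le> (\<delta> n)\<^sup>2 / real (n + 1)"
    unfolding \<eta>_def using a by (intro power_decreasing[of 1 "2 ^ n", simplified]) (auto simp: power2_eq_square)
  also have "\<dots> \<le> 1 / 100" by (rule order_trans[OF a]) (simp add: power2_eq_square)
  finally show ?thesis .
qed

text \<open>\<open>e 0\<close> is the unsquared coordinate. \<open>\<Psi>\<close> enters as the
  zeroth iterate, so all sets live in the original coordinates of the variety.\<close>

locale short_dynamics =
  fixes e :: "nat \<Rightarrow> 'n :: finite" and \<Psi> :: "complex ^ 'n \<Rightarrow> complex ^ 'n"
  assumes e: "bij_betw e {..<CARD('n)} UNIV" and card2: "CARD('n) \<ge> 2"
    and \<Psi>: "holo_automorphism \<Psi>" and \<Psi>_poly: "\<And>i. (\<lambda>z. \<Psi> z $ i) \<in> poly_fun"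
begin

section \<open>The automorphisms\<close>

definition k :: nat where "k = CARD('n)"
definition idx :: "'n \<Rightarrow> nat" where "idx = inv_into {..<k} e"
text \<open>The shift is cyclic, so the derivative of the map at 0 is the coupling times a
  permutation of the coordinates.\<close>

definition \<sigma> :: "'n \<Rightarrow> 'n" where "\<sigma> i = e (if idx i = 0 then k - 1 else idx i - 1)"

lemma k2: "k \<ge> 2" using card2 by (simp add: k_def)

lemma idx_e: "j < k \<Longrightarrow> idx (e j) = j"
  using e by (simp add: idx_def k_def bij_betw_def inv_into_f_f)

lemma e_surj: "i \<in> e ` {..<k}"
  using e by (simp add: k_def bij_betw_def)

lemma e_idx: "e (idx i) = i"
  using f_inv_into_f[OF e_surj] by (simp add: idx_def)

lemma idx_less: "idx i < k"
  using inv_into_into[OF e_surj, of i] by (simp add: idx_def)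

lemma \<sigma>_e: "j < k \<Longrightarrow> \<sigma> (e j) = e (if j = 0 then k - 1 else j - 1)"
  by (simp add: \<sigma>_def idx_e)

lemma \<sigma>_neq: "\<sigma> i \<noteq> i"
proof
  assume "\<sigma> i = i"
  then have "idx (\<sigma> i) = idx i" by simp
  then show False using idx_less[of i] k2 by (auto simp: \<sigma>_def idx_e split: if_splits)
qed

lemma \<sigma>_bij: "bij \<sigma>"
proof -
  have "inj \<sigma>"
  proof (rule injI)
    fix i j assume "\<sigma> i = \<sigma> j"
    then have "idx (\<sigma> i) = idx (\<sigma> j)" by simp
    then have "idx i = idx j"
      using idx_less[of i] idx_less[of j] k2 by (auto simp: \<sigma>_def idx_e split: if_splits)
    then show "i = j" using e_idx by metis
  qed
  then show ?thesis by (simp add: bij_def finite_UNIV_inj_surj)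
qed

definition F :: "real \<Rightarrow> complex ^ 'n \<Rightarrow> complex ^ 'n" where
  "F h w = (\<chi> i. (if i = e 0 then 0 else (w $ i)\<^sup>2) + of_real h * w $ \<sigma> i)"

text \<open>\<open>unwind h j w\<close> is the coordinate with index \<open>k - 1 - j\<close> of the preimage of \<open>w\<close> under \<open>F h\<close>.\<close>
fun unwind :: "real \<Rightarrow> nat \<Rightarrow> complex ^ 'n \<Rightarrow> complex" where
  "unwind h 0 w = inverse (of_real h) * w $ e 0"
| "unwind h (Suc j) w = inverse (of_real h) * (w $ e (k - 1 - j) - (unwind h j w)\<^sup>2)"

definition Finv :: "real \<Rightarrow> complex ^ 'n \<Rightarrow> complex ^ 'n" where
  "Finv h w = (\<chi> i. unwind h (k - 1 - idx i) w)"

lemma F_poly: "(\<lambda>w. F h w $ i) \<in> poly_fun"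
  by (cases "i = e 0")
     (auto simp: F_def intro!: poly_fun.add poly_fun.mult poly_fun.const poly_fun.coord poly_fun_power)

lemma unwind_poly: "(\<lambda>w. unwind h j w) \<in> poly_fun"
  by (induction j)
     (auto intro!: poly_fun.mult poly_fun.const poly_fun.coord poly_fun_power poly_fun_diff)

lemma unwind_F:
  assumes "h > 0" "j < k"
  shows "unwind h j (F h z) = z $ e (k - 1 - j)"
  using \<open>j < k\<close>
proof (induction j)
  case 0
  then show ?case using k2 \<open>h > 0\<close> by (simp add: F_def \<sigma>_e)
next
  case (Suc j)
  have "e (k - 1 - j) \<noteq> e 0"
  proof
    assume "e (k - 1 - j) = e 0"
    then have "idx (e (k - 1 - j)) = idx (e 0)" by simp
    then show False using Suc.prems k2 by (simp add: idx_e)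
  qed
  then show ?case using Suc \<open>h > 0\<close> by (simp add: F_def \<sigma>_e)
qed

lemma Finv_F:
  assumes "h > 0"
  shows "Finv h (F h z) = z"
  unfolding vec_eq_iff
proof
  fix i
  have "k - 1 - (k - 1 - idx i) = idx i" "k - 1 - idx i < k" using idx_less[of i] by auto
  then show "Finv h (F h z) $ i = z $ i" by (simp only: Finv_def vec_lambda_beta unwind_F[OF assms] e_idx)
qed

lemma F_Finv:
  assumes "h > 0"
  shows "F h (Finv h w) = w"
  unfolding vec_eq_iff
proof
  fix i
  define m where "m = idx i"
  have m: "m < k" "i = e m" using idx_less e_idx by (auto simp: m_def)
  show "F h (Finv h w) $ i = w $ i"
  proof (cases "m = 0")
    case True
    then show ?thesis using m k2 assms by (simp add: F_def Finv_def \<sigma>_e idx_e)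
  next
    case False
    have "e m \<noteq> e 0" using False m idx_e[of m] idx_e[of 0] k2 by auto
    moreover have "k - 1 - (m - 1) = Suc (k - 1 - m)" "k - 1 - (k - 1 - m) = m" using False m by auto
    ultimately show ?thesis using m False assms by (simp add: F_def Finv_def \<sigma>_e idx_e field_simps)
  qed
qed

lemma F_automorphism:
  assumes "h > 0"
  shows "holo_automorphism (F h)"
proof -
  have inv: "inv (F h) = Finv h" using Finv_F[OF assms] F_Finv[OF assms] by (rule inv_equality)
  have "bij (F h)"
    by (rule o_bij[of "Finv h"]) (auto simp: fun_eq_iff Finv_F[OF assms] F_Finv[OF assms])
  moreover have "holo_map UNIV (F h)"
    unfolding holo_map_iff using poly_fun_holo[OF F_poly] by simp
  moreover have "holo_map UNIV (Finv h)"
    unfolding holo_map_iff using poly_fun_holo[OF unwind_poly] by (simp add: Finv_def)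
  ultimately show ?thesis by (simp add: holo_automorphism_def inv)
qed

lemma norm_\<sigma>: "norm (\<chi> i. w $ \<sigma> i) = norm (w :: complex ^ 'n)"
  unfolding norm_vec_def L2_set_def
  using sum.reindex_bij_betw[OF \<sigma>_bij, of "\<lambda>i. (cmod (w $ i))\<^sup>2"] by simp

lemma norm_F:
  assumes "h > 0"
  shows "norm (F h w) \<le> (norm w)\<^sup>2 + h * norm w"
proof -
  have "F h w = (\<chi> i. if i = e 0 then 0 else (w $ i)\<^sup>2) + of_real h *s (\<chi> i. w $ \<sigma> i)"
    by (simp add: F_def vec_eq_iff)
  then have "norm (F h w) \<le> norm ((\<chi> i. if i = e 0 then 0 else (w $ i)\<^sup>2) :: complex ^ 'n) + h * norm w"
    using norm_triangle_ineq[of "(\<chi> i. if i = e 0 then 0 else (w $ i)\<^sup>2)" "of_real h *s (\<chi> i. w $ \<sigma> i)"] assms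
    by (simp add: norm_vector_scalar_mult norm_\<sigma>)
  moreover have "norm ((\<chi> i. if i = e 0 then 0 else (w $ i)\<^sup>2) :: complex ^ 'n) \<le> (norm w)\<^sup>2"
  proof -
    have "norm ((\<chi> i. if i = e 0 then 0 else (w $ i)\<^sup>2) :: complex ^ 'n)
        \<le> (\<Sum>i\<in>UNIV. cmod (if i = e 0 then 0 else (w $ i)\<^sup>2))"
      unfolding norm_vec_def by (rule order_trans[OF L2_set_le_sum]) auto
    also have "\<dots> \<le> (\<Sum>i\<in>UNIV. (cmod (w $ i))\<^sup>2)" by (intro sum_mono) (auto simp: norm_power)
    also have "\<dots> = (norm w)\<^sup>2" by (simp add: norm_vec_def L2_set_def sum_nonneg)
    finally show ?thesis .
  qed
  ultimately show ?thesis by linarith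
qed

definition dF :: "real \<Rightarrow> complex ^ 'n \<Rightarrow> complex ^ 'n \<Rightarrow> complex ^ 'n" where
  "dF h w v = (\<chi> i. (if i = e 0 then 0 else 2 * w $ i * v $ i) + of_real h * v $ \<sigma> i)"

lemma F_has_derivative: "(F h has_derivative dF h w) (at w)"
proof (rule has_derivative_vecI)
  fix i
  note nth = has_derivative_vec_nth[OF has_derivative_ident]
  show "((\<lambda>z. F h z $ i) has_derivative (\<lambda>v. dF h w v $ i)) (at w)"
  proof (cases "i = e 0")
    case True
    then show ?thesis using has_derivative_mult_right[OF nth, of "of_real h"] by (simp add: F_def dF_def)
  next
    case False
    have "((\<lambda>z. (z $ i)\<^sup>2 + of_real h * z $ \<sigma> i) has_derivative
        (\<lambda>v. of_nat 2 * v $ i * (w $ i) ^ (2 - 1) + of_real h * v $ \<sigma> i)) (at w)"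
      by (rule has_derivative_add[OF has_derivative_power[OF nth] has_derivative_mult_right[OF nth]])
    moreover have "(\<lambda>v. of_nat 2 * v $ i * (w $ i) ^ (2 - 1) + of_real h * v $ \<sigma> i) = (\<lambda>v. dF h w v $ i)"
      using False by (simp add: dF_def fun_eq_iff)
    ultimately show ?thesis using False by (simp add: F_def)
  qed
qed

lemma norm_dF:
  assumes "h > 0"
  shows "norm (dF h w v) \<le> (2 * norm w + h) * norm v"
proof -
  let ?a = "(\<chi> i. if i = e 0 then 0 else 2 * w $ i * v $ i) :: complex ^ 'n"
  have "dF h w v = ?a + of_real h *s (\<chi> i. v $ \<sigma> i)"
    by (simp add: dF_def vec_eq_iff)
  then have "norm (dF h w v) \<le> norm ?a + h * norm v"
    using norm_triangle_ineq[of ?a "of_real h *s (\<chi> i. v $ \<sigma> i)"] assms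
    by (simp add: norm_vector_scalar_mult norm_\<sigma>)
  moreover have "norm ?a \<le> norm (of_real (2 * norm w) *s v)"
  proof (rule norm_le_componentwise_cart)
    fix i
    have "cmod (w $ i) * cmod (v $ i) \<le> norm w * cmod (v $ i)"
      by (intro mult_right_mono cmod_nth_le) auto
    then show "norm (?a $ i) \<le> norm ((of_real (2 * norm w) *s v) $ i)"
      by (simp add: norm_mult)
  qed
  ultimately show ?thesis by (simp add: norm_vector_scalar_mult norm_mult algebra_simps)
qed

lemma F_0: "F h 0 = 0" by (simp add: F_def vec_eq_iff)

section \<open>Iterates, tame sets and potentials\<close>

primrec X :: "nat \<Rightarrow> complex ^ 'n \<Rightarrow> complex ^ 'n" where
  "X 0 = \<Psi>"
| "X (Suc n) = F (\<eta> n) \<circ> X n"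

lemma X_poly: "(\<lambda>z. X n z $ i) \<in> poly_fun"
proof (induction n arbitrary: i)
  case (Suc n)
  have "(\<lambda>z. X (Suc n) z $ i) = (\<lambda>z. (if i = e 0 then 0 else (X n z $ i)\<^sup>2) + of_real (\<eta> n) * X n z $ \<sigma> i)"
    by (simp add: F_def fun_eq_iff)
  also have "\<dots> \<in> poly_fun"
    using poly_fun.add[OF poly_fun_power[OF Suc] poly_fun.mult[OF poly_fun.const Suc]]
      poly_fun.mult[OF poly_fun.const Suc] by (cases "i = e 0") simp_all
  finally show ?case .
qed (simp add: \<Psi>_poly)

lemma X_automorphism: "holo_automorphism (X n)"
proof (induction n)
  case (Suc n)
  note F = F_automorphism[OF \<eta>_pos[of n]]
  have "bij (F (\<eta> n))" "bij (X n)" using Suc F by (auto simp: holo_automorphism_def)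
  then have bij: "bij (F (\<eta> n) \<circ> X n)" and inv: "inv (F (\<eta> n) \<circ> X n) = (\<lambda>w. inv (X n) (inv (F (\<eta> n)) w))"
    by (auto simp: bij_comp o_inv_distrib fun_eq_iff)
  have "holo_map UNIV (\<lambda>z. F (\<eta> n) (X n z))" "holo_map UNIV (\<lambda>w. inv (X n) (inv (F (\<eta> n)) w))"
    using Suc F holo_map_comp[of UNIV "X n" UNIV "F (\<eta> n)"]
      holo_map_comp[of UNIV "inv (F (\<eta> n))" UNIV "inv (X n)"] by (auto simp: holo_automorphism_def)
  then show ?case using bij inv by (simp add: holo_automorphism_def comp_def)
qed (simp add: \<Psi>)

lemma X_holo: "holo_map UNIV (X n)" and X_bij: "bij (X n)" and X_inv_holo: "holo_map UNIV (inv (X n))"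
  using X_automorphism by (auto simp: holo_automorphism_def)

lemma X_inv [simp]: "inv (X n) (X n z) = z" "X n (inv (X n) w) = w"
  using X_bij by (simp_all add: bij_is_inj bij_is_surj surj_f_inv_f)

definition p :: "complex ^ 'n" where "p = inv \<Psi> 0"

lemma X_p: "X n p = 0"
  by (induction n) (use X_inv(2)[of 0] F_0 in \<open>auto simp: p_def\<close>)

lemma X_continuous: "continuous_on A (X n)"
  using holo_map_continuous[OF X_holo] continuous_on_subset by blast

lemma X_inv_continuous: "continuous_on A (inv (X n))"
  using holo_map_continuous[OF X_inv_holo] continuous_on_subset by blast

text \<open>The added 1 absorbs the coupling term and turns the growth into plain squaring.\<close>

lemma X_growth_step: "norm (X (Suc n) z) + 1 \<le> (norm (X n z) + 1)\<^sup>2"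
proof -
  have "norm (X (Suc n) z) \<le> (norm (X n z))\<^sup>2 + \<eta> n * norm (X n z)" using norm_F[OF \<eta>_pos] by simp
  also have "\<dots> \<le> (norm (X n z))\<^sup>2 + 2 * norm (X n z)" using \<eta>_le[of n] by (intro add_left_mono mult_right_mono) auto
  finally show ?thesis by (simp add: power2_sum)
qed

lemma X_growth: "norm (X n z) + 1 \<le> (norm (X 0 z) + 1) ^ (2 ^ n)"
proof (induction n)
  case (Suc n)
  have "norm (X (Suc n) z) + 1 \<le> (norm (X n z) + 1)\<^sup>2" by (rule X_growth_step)
  also have "\<dots> \<le> ((norm (X 0 z) + 1) ^ (2 ^ n))\<^sup>2" using Suc by (intro power_mono) auto
  also have "\<dots> = (norm (X 0 z) + 1) ^ (2 ^ Suc n)" by (simp add: power_mult[symmetric] mult.commute)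
  finally show ?case .
qed simp

text \<open>Strictness makes these sets open; the summand 1 makes them increase with
  \<open>n\<close>, by \<open>X_growth_step\<close> and \<open>Q_Suc\<close>.\<close>

definition tame :: "nat \<Rightarrow> (complex ^ 'n) set" where "tame n = {z. norm (X n z) + 1 < Q n}"

lemma tame_Suc: "z \<in> tame n \<Longrightarrow> z \<in> tame (Suc n)"
proof -
  assume "z \<in> tame n"
  then have "(norm (X n z) + 1)\<^sup>2 < (Q n)\<^sup>2" by (intro power_strict_mono) (auto simp: tame_def)
  then show ?thesis using X_growth_step[of n z] Q_Suc[of n] by (simp add: tame_def)
qed

lemma tame_mono: "n \<le> m \<Longrightarrow> z \<in> tame n \<Longrightarrow> z \<in> tame m"
  by (induction m rule: dec_induct) (auto intro: tame_Suc)

lemma tame_large: "norm (X 0 z) < real n \<Longrightarrow> z \<in> tame n"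
  using X_growth[of n z] power_strict_mono[of "norm (X 0 z) + 1" "real n + 1" "2 ^ n"]
  by (simp add: tame_def Q_def add.commute)

lemma eventually_tame: "\<forall>\<^sub>F n in sequentially. z \<in> tame n"
proof -
  obtain n where "norm (X 0 z) < real n" using reals_Archimedean2 by blast
  then have "z \<in> tame n" by (rule tame_large)
  then show ?thesis unfolding eventually_sequentially using tame_mono by blast
qed

lemma tame_open: "open (tame n)"
  unfolding tame_def by (intro open_Collect_less continuous_intros X_continuous)

definition u :: "'n \<Rightarrow> nat \<Rightarrow> complex ^ 'n \<Rightarrow> real" where
  "u i n z = root (2 ^ n) (cmod (X n z $ i))"

definition U :: "'n \<Rightarrow> complex ^ 'n \<Rightarrow> real" where "U i z = lim (\<lambda>n. u i n z)"

lemma u_nonneg: "u i n z \<ge> 0" by (simp add: u_def)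

lemma u_power: "u i n z ^ (2 ^ n) = cmod (X n z $ i)" by (simp add: u_def)

lemma X_Suc_nth: "i \<noteq> e 0 \<Longrightarrow> X (Suc n) z $ i = (X n z $ i)\<^sup>2 + of_real (\<eta> n) * X n z $ \<sigma> i"
  by (simp add: F_def)

lemma perturbation_le:
  assumes "z \<in> tame n"
  shows "cmod (of_real (\<eta> n) * X n z $ \<sigma> i) \<le> \<delta> n ^ (2 ^ Suc n)"
proof -
  have "cmod (X n z $ \<sigma> i) \<le> norm (X n z)" by (rule cmod_nth_le)
  also have "\<dots> \<le> Q n" using assms by (simp add: tame_def)
  finally have "\<eta> n * cmod (X n z $ \<sigma> i) \<le> \<eta> n * Q n" using \<eta>_pos[of n] by simp
  then show ?thesis using \<eta>_pos[of n] by (simp add: norm_mult \<eta>_Q)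
qed

text \<open>The doubled order of the root undoes the squaring, so only the coupling term counts. The
  coordinate \<open>e 0\<close> has no square to undo, hence no potential.\<close>

lemma u_step:
  assumes "i \<noteq> e 0" "z \<in> tame n"
  shows "\<bar>u i (Suc n) z - u i n z\<bar> \<le> \<delta> n"
proof -
  let ?a = "(X n z $ i)\<^sup>2" and ?b = "of_real (\<eta> n) * X n z $ \<sigma> i"
  have "u i n z = root (2 ^ Suc n) (cmod ?a)"
    unfolding u_def norm_power power_Suc2 real_root_mult_exp by (subst real_root_power_cancel) auto
  then have "\<bar>u i (Suc n) z - u i n z\<bar> \<le> root (2 ^ Suc n) \<bar>cmod (?a + ?b) - cmod ?a\<bar>"
    using root_diff_le[of "cmod (?a + ?b)" "cmod ?a" "2 ^ Suc n"]
    by (simp only: u_def X_Suc_nth[OF assms(1)]) simp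
  also have "\<dots> \<le> root (2 ^ Suc n) (\<delta> n ^ (2 ^ Suc n))"
  proof (subst real_root_le_iff)
    show "\<bar>cmod (?a + ?b) - cmod ?a\<bar> \<le> \<delta> n ^ (2 ^ Suc n)"
      using norm_triangle_ineq3[of "?a + ?b" ?a] perturbation_le[OF assms(2), of i] by simp
  qed simp
  also have "\<dots> = \<delta> n" using \<delta>_pos[of n] by (intro real_root_power_cancel) auto
  finally show ?thesis .
qed

text \<open>The subtracted \<open>2 * \<delta> m\<close> closes the induction: the ratio 1/4 of
  consecutive \<open>\<delta>\<close> frees more than the next step costs.\<close>

lemma u_diff:
  assumes "i \<noteq> e 0" "z \<in> tame n" "n \<le> m"
  shows "\<bar>u i m z - u i n z\<bar> \<le> 2 * \<delta> n - 2 * \<delta> m"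
  using \<open>n \<le> m\<close>
proof (induction m rule: dec_induct)
  case (step m)
  have "\<bar>u i (Suc m) z - u i m z\<bar> \<le> \<delta> m"
    using u_step[OF assms(1) tame_mono[OF _ assms(2)]] step by simp
  then show ?case using step.IH \<delta>_pos[of m] unfolding \<delta>_Suc by linarith
qed simp

lemma u_tendsto:
  assumes "i \<noteq> e 0"
  shows "(\<lambda>n. u i n z) \<longlonglongrightarrow> U i z"
proof -
  have "Cauchy (\<lambda>n. u i n z)"
  proof (rule metric_CauchyI)
    fix \<epsilon> :: real assume "\<epsilon> > 0"
    then have "\<forall>\<^sub>F n in sequentially. \<delta> n < \<epsilon> / 4" by (intro eventually_\<delta>_less) simp
    with eventually_tame[of z] have "\<forall>\<^sub>F n in sequentially. z \<in> tame n \<and> \<delta> n < \<epsilon> / 4"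
      by eventually_elim simp
    then obtain N where N: "z \<in> tame N" "\<delta> N < \<epsilon> / 4" by (auto simp: eventually_sequentially)
    have "\<bar>u i n z - u i N z\<bar> < \<epsilon> / 2" if "n \<ge> N" for n
      using u_diff[OF assms N(1) that] N(2) \<delta>_pos[of n] by linarith
    then show "\<exists>M. \<forall>m\<ge>M. \<forall>n\<ge>M. dist (u i m z) (u i n z) < \<epsilon>"
      unfolding dist_real_def by (intro exI[of _ N] allI impI) (smt (verit, best) field_sum_of_halves)
  qed
  then show ?thesis unfolding U_def by (simp add: Cauchy_convergent convergent_LIMSEQ_iff[symmetric])
qed

lemma U_diff:
  assumes "i \<noteq> e 0" "z \<in> tame n"
  shows "\<bar>U i z - u i n z\<bar> \<le> 2 * \<delta> n"
proof (rule LIMSEQ_le_const2)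
  show "(\<lambda>m. \<bar>u i m z - u i n z\<bar>) \<longlonglongrightarrow> \<bar>U i z - u i n z\<bar>"
    by (intro tendsto_intros u_tendsto assms)
  have "\<bar>u i m z - u i n z\<bar> \<le> 2 * \<delta> n" if "m \<ge> n" for m
    using u_diff[OF assms that] \<delta>_pos[of m] by simp
  then show "\<exists>N. \<forall>m\<ge>N. \<bar>u i m z - u i n z\<bar> \<le> 2 * \<delta> n" by blast
qed

lemma u_continuous: "continuous_on A (u i n)"
  unfolding u_def by (intro continuous_intros X_continuous) 

lemma U_continuous:
  assumes "i \<noteq> e 0"
  shows "continuous_on A (U i)"
proof -
  have "isCont (U i) z" for z
  proof -
    obtain N where N: "norm (X 0 z) < real N" using reals_Archimedean2 by blast
    define S where "S = tame N"
    have z: "z \<in> S" unfolding S_def by (rule tame_large[OF N])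
    have "uniform_limit S (u i) (U i) sequentially"
    proof (rule uniform_limitI)
      fix \<epsilon> :: real assume "\<epsilon> > 0"
      then have "\<forall>\<^sub>F n in sequentially. \<delta> n < \<epsilon> / 2" 
        by (intro eventually_\<delta>_less) simp
      then show "\<forall>\<^sub>F n in sequentially. \<forall>x\<in>S. dist (u i n x) (U i x) < \<epsilon>"
        using eventually_ge_at_top[of N]
      proof eventually_elim
        case (elim n)
        show ?case
        proof
          fix x assume "x \<in> S"
          then have "\<bar>U i x - u i n x\<bar> \<le> 2 * \<delta> n"
            using U_diff[OF assms tame_mono[OF elim(2)]] by (simp add: S_def)
          then show "dist (u i n x) (U i x) < \<epsilon>" using elim(1) by (simp add: dist_norm abs_minus_commute)
        qed
      qed
    qed
    then have "continuous_on S (U i)"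
      by (rule uniform_limit_theorem[rotated]) (auto intro!: always_eventually u_continuous)
    then show ?thesis using z tame_open unfolding S_def
      by (simp add: continuous_on_eq_continuous_at)
  qed
  then show ?thesis by (simp add: continuous_at_imp_continuous_on)
qed

lemma \<delta>_small: "8 * \<delta> n < 1 / 2 ^ n"
proof -
  have "(1 / 4 :: real) ^ n \<le> (1 / 2) ^ n" by (intro power_mono) auto
  moreover have "(1 / 2 :: real) ^ n > 0" by simp
  ultimately have "8 * \<delta> n < (1 / 2) ^ n" unfolding \<delta>_def by linarith
  then show ?thesis by (simp add: power_one_over)
qed

text \<open>The roots stay away from 1 by a fixed multiple of \<open>1 / m\<close>. For
  \<open>m = 2 ^ n\<close> this exceeds the accumulated error \<open>2 * \<delta> n\<close>, by
  \<open>\<delta>_small\<close>.\<close>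

lemma Bernoulli_two: "1 + 1 / (2 * real m) \<le> root m 2" "root m (1 / 2) \<le> 1 - 1 / (4 * real m)" if "m > 0"
proof -
  have e: "(1 + 1 / (2 * real m)) ^ m \<le> 2"
  proof -
    have "(1 + 1 / (2 * real m)) ^ m \<le> exp (1 / (2 * real m)) ^ m"
      by (intro power_mono exp_ge_add_one_self) auto
    also have "\<dots> = exp (1 / 2)" using that by (simp add: exp_of_nat_mult[symmetric])
    also have "\<dots> \<le> 2" using exp_bound[of "1/2"] by (simp add: power2_eq_square)
    finally show ?thesis .
  qed
  have r: "1 + 1 / (2 * real m) = root m ((1 + 1 / (2 * real m)) ^ m)"
    using that by (subst real_root_power_cancel) auto
  show "1 + 1 / (2 * real m) \<le> root m 2"
    by (subst r, subst real_root_le_iff) (use that e in auto)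
  have "1 + real m * (- (1 / (4 * real m))) \<le> (1 + (- (1 / (4 * real m)))) ^ m"
    using that by (intro Bernoulli_inequality) (simp add: field_simps)
  then have h: "1 / 2 \<le> (1 - 1 / (4 * real m)) ^ m" using that by simp
  have s: "1 - 1 / (4 * real m) = root m ((1 - 1 / (4 * real m)) ^ m)"
    using that by (subst real_root_power_cancel) (auto simp: field_simps)
  show "root m (1 / 2) \<le> 1 - 1 / (4 * real m)"
    by (subst s, subst real_root_le_iff) (use that h in auto)
qed

text \<open>All later steps together change the root by at most \<open>2 * \<delta> n\<close>, less
  than its gap below 1; a single tame time decides.\<close>

lemma U_less_one:
  assumes "i \<noteq> e 0" "z \<in> tame n" "cmod (X n z $ i) \<le> 1 / 2"
  shows "U i z < 1"
proof -
  have "u i n z \<le> root (2 ^ n) (1 / 2)" unfolding u_def using assms by simp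
  also have "\<dots> \<le> 1 - (1 / 2 ^ n) / 4" using Bernoulli_two(2)[of "2 ^ n"] by (simp add: mult.commute)
  finally have "u i n z \<le> 1 - (1 / 2 ^ n) / 4" .
  moreover have "U i z \<le> u i n z + 2 * \<delta> n" using U_diff[OF assms(1,2)] by linarith
  moreover define A where "A = 1 / (2::real) ^ n"
  moreover have "8 * \<delta> n < A" unfolding A_def by (rule \<delta>_small)
  ultimately show ?thesis unfolding A_def[symmetric] by linarith
qed

lemma U_gt_one:
  assumes "i \<noteq> e 0" "z \<in> tame n" "cmod (X n z $ i) \<ge> 2"
  shows "U i z > 1"
proof -
  have "1 + (1 / 2 ^ n) / 2 \<le> root (2 ^ n) 2" using Bernoulli_two(1)[of "2 ^ n"] by (simp add: mult.commute)
  also have "root (2 ^ n) 2 \<le> u i n z" unfolding u_def using assms by simp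
  finally have "u i n z \<ge> 1 + (1 / 2 ^ n) / 2" .
  moreover have "U i z \<ge> u i n z - 2 * \<delta> n" using U_diff[OF assms(1,2)] by linarith
  moreover define A where "A = 1 / (2::real) ^ n"
  moreover have "8 * \<delta> n < A" unfolding A_def by (rule \<delta>_small)
  ultimately show ?thesis using \<delta>_pos[of n] unfolding A_def[symmetric] by linarith
qed

lemma X_nth_tendsto_0:
  assumes "i \<noteq> e 0" "U i z < 1"
  shows "(\<lambda>n. X n z $ i) \<longlonglongrightarrow> 0"
proof -
  define c where "c = (max (U i z) 0 + 1) / 2"
  have c: "0 < c" "c < 1" "U i z < c" using assms by (auto simp: c_def)
  have ev: "\<forall>\<^sub>F n in sequentially. u i n z < c"
    using order_tendstoD(2)[OF u_tendsto[OF assms(1)] c(3)] .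
  have "\<forall>\<^sub>F n in sequentially. norm (X n z $ i) \<le> c ^ n"
    using ev
  proof eventually_elim
    case (elim n)
    have "cmod (X n z $ i) \<le> c ^ (2 ^ n)"
      unfolding u_power[symmetric] using elim u_nonneg by (intro power_mono) auto
    also have "\<dots> \<le> c ^ n" using c by (intro power_decreasing) (auto intro: less_imp_le[OF less_exp])
    finally show ?case .
  qed
  moreover have "(\<lambda>n. c ^ n) \<longlonglongrightarrow> 0" using c by (intro LIMSEQ_realpow_zero) auto
  ultimately show ?thesis by (rule Lim_null_comparison)
qed

definition \<Omega> :: "(complex ^ 'n) set" where "\<Omega> = {z. (\<lambda>n. X n z) \<longlonglongrightarrow> 0}"

lemma eventually_norm_X_less:
  assumes "z \<in> \<Omega>" "c > 0"
  shows "\<forall>\<^sub>F n in sequentially. norm (X n z) < c"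
  using order_tendstoD(2)[OF tendsto_norm_zero, of "\<lambda>n. X n z"] assms by (simp add: \<Omega>_def)

lemma \<Omega>_eq: "\<Omega> = {z. \<forall>i. i \<noteq> e 0 \<longrightarrow> U i z < 1}"
proof (intro set_eqI iffI)
  fix z assume "z \<in> \<Omega>"
  then have "\<forall>\<^sub>F n in sequentially. norm (X n z) < 1 / 2" by (rule eventually_norm_X_less) simp
  with eventually_tame[of z] have "\<forall>\<^sub>F n in sequentially. z \<in> tame n \<and> norm (X n z) < 1 / 2"
    by eventually_elim simp
  then obtain n where n: "z \<in> tame n" "norm (X n z) < 1 / 2" by (auto simp: eventually_sequentially)
  then have "cmod (X n z $ i) \<le> 1 / 2" for i using cmod_nth_le[of "X n z" i] by linarith
  then show "z \<in> {z. \<forall>i. i \<noteq> e 0 \<longrightarrow> U i z < 1}" using U_less_one n by blast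
next
  fix z assume z: "z \<in> {z. \<forall>i. i \<noteq> e 0 \<longrightarrow> U i z < 1}"
  have x: "(\<lambda>n. X n z $ i) \<longlonglongrightarrow> 0" if "i \<noteq> e 0" for i using X_nth_tendsto_0 z that by blast
  \<comment> \<open>The coordinate \<open>e 0\<close> at time \<open>n + 1\<close> is
    \<open>\<eta> n\<close> times the coordinate \<open>\<sigma> (e 0)\<close> at time
    \<open>n\<close>, and that one has a potential.\<close>
  have s: "\<sigma> (e 0) \<noteq> e 0" by (rule \<sigma>_neq)
  have "(\<lambda>n. X (Suc n) z $ e 0) \<longlonglongrightarrow> 0"
  proof (rule Lim_null_comparison)
    show "\<forall>\<^sub>F n in sequentially. norm (X (Suc n) z $ e 0) \<le> norm (X n z $ \<sigma> (e 0))"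
    proof (intro always_eventually allI)
      fix n
      have "\<eta> n * cmod (X n z $ \<sigma> (e 0)) \<le> 1 * cmod (X n z $ \<sigma> (e 0))"
        using \<eta>_le[of n] by (intro mult_right_mono) auto
      then show "norm (X (Suc n) z $ e 0) \<le> norm (X n z $ \<sigma> (e 0))"
        using \<eta>_pos[of n] by (simp add: F_def norm_mult)
    qed
    show "(\<lambda>n. norm (X n z $ \<sigma> (e 0))) \<longlonglongrightarrow> 0" using x[OF s] by (rule tendsto_norm_zero)
  qed
  then have "(\<lambda>n. X n z $ e 0) \<longlonglongrightarrow> 0" by (rule LIMSEQ_imp_Suc)
  then have "(\<lambda>n. X n z $ i) \<longlonglongrightarrow> 0 $ i" for i using x by (cases "i = e 0") auto
  then have "(\<lambda>n. X n z) \<longlonglongrightarrow> 0" by (rule vec_tendstoI)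
  then show "z \<in> \<Omega>" by (simp add: \<Omega>_def)
qed

end

section \<open>The basin is a Short \<open>C\<^sup>k\<close>\<close>

text \<open>A root \<open>a\<close> inside the disc is traded for the factor
  \<open>1 - cnj a * t\<close>, as in a Blaschke product: same modulus on the circle, no smaller at
  0, no zero inside.\<close>

lemma reflect_roots:
  fixes p :: "complex poly"
  assumes "p \<noteq> 0"
  shows "\<exists>q. (\<forall>t. cmod t = 1 \<longrightarrow> cmod (poly q t) = cmod (poly p t)) \<and>
      cmod (poly p 0) \<le> cmod (poly q 0) \<and> (\<forall>t. cmod t < 1 \<longrightarrow> poly q t \<noteq> 0)"
  using assms
proof (induction "degree p" arbitrary: p rule: less_induct)
  case (less p)
  show ?case
  proof (cases "\<exists>a. cmod a < 1 \<and> poly p a = 0")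
    case False
    then show ?thesis by (intro exI[of _ p]) auto
  next
    case True
    then obtain a where a: "cmod a < 1" "poly p a = 0" by blast
    then obtain r where r: "p = [:- a, 1:] * r" by (auto simp: poly_eq_0_iff_dvd elim: dvdE)
    have "r \<noteq> 0" using less.prems r by auto
    then have "degree p = degree [:- a, 1:] + degree r"
      unfolding r by (intro degree_mult_eq) auto
    then have "degree r < degree p" by simp
    from less.hyps[OF this \<open>r \<noteq> 0\<close>] obtain q where
      q: "\<And>t. cmod t = 1 \<Longrightarrow> cmod (poly q t) = cmod (poly r t)"
      "cmod (poly r 0) \<le> cmod (poly q 0)" "\<And>t. cmod t < 1 \<Longrightarrow> poly q t \<noteq> 0" by blast
    have circle: "cmod (1 - cnj a * t) = cmod (t - a)" if "cmod t = 1" for t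
    proof -
      have "1 = t * cnj t" using that by (simp add: complex_norm_square[symmetric])
      then have "1 - cnj a * t = t * cnj (t - a)" by (simp add: algebra_simps)
      then have "cmod (1 - cnj a * t) = cmod t * cmod (cnj (t - a))" by (simp only: norm_mult)
      then show ?thesis using that by (simp only: complex_mod_cnj)
    qed
    have nz: "1 - cnj a * t \<noteq> 0" if "cmod t < 1" for t
    proof
      assume "1 - cnj a * t = 0"
      then have "cmod a * cmod t = 1" by (metis complex_mod_cnj eq_iff_diff_eq_0 norm_mult norm_one)
      moreover have "cmod a * cmod t \<le> 1 * cmod t" using a by (intro mult_right_mono) auto
      ultimately show False using that by simp
    qed
    have eqs: "poly ([:1, - cnj a:] * q) t = (1 - cnj a * t) * poly q t" "poly p t = (t - a) * poly r t" for t
      by (simp_all add: r algebra_simps)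
    show ?thesis
    proof (intro exI[of _ "[:1, - cnj a:] * q"] conjI allI impI)
      fix t assume "cmod t = 1"
      then show "cmod (poly ([:1, - cnj a:] * q) t) = cmod (poly p t)"
        unfolding eqs using q(1) circle by (simp only: norm_mult)
    next
      have "cmod a * cmod (poly r 0) \<le> 1 * cmod (poly q 0)" using a q(2) by (intro mult_mono) auto
      then show "cmod (poly p 0) \<le> cmod (poly ([:1, - cnj a:] * q) 0)" unfolding eqs by (simp add: norm_mult)
    next
      fix t assume "cmod t < 1"
      then show "poly ([:1, - cnj a:] * q) t \<noteq> 0" unfolding eqs using q(3) nz by simp
    qed
  qed
qed

text \<open>The reflected polynomial has a holomorphic \<open>m\<close>-th root in the disc, which
  obeys the mean value property. Zeros may remain on the circle itself, hence the radii
  \<open>r < 1\<close> and the limit.\<close>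

lemma root_poly_submean:
  fixes p :: "complex poly"
  assumes "m > 0"
  shows "2 * pi * root m (cmod (poly p 0)) \<le> integral {0..2*pi} (\<lambda>t. root m (cmod (poly p (cis t))))"
proof (cases "p = 0")
  case False
  obtain q where q: "\<And>t. cmod t = 1 \<Longrightarrow> cmod (poly q t) = cmod (poly p t)"
    "cmod (poly p 0) \<le> cmod (poly q 0)" "\<And>t. cmod t < 1 \<Longrightarrow> poly q t \<noteq> 0"
    using reflect_roots[OF False] by blast
  obtain g where g: "g holomorphic_on ball 0 1" "\<And>t. t \<in> ball 0 1 \<Longrightarrow> exp (g t) = poly q t"
    using holomorphic_logarithm_exists[OF _ _ holomorphic_on_has_derivativeI[OF poly_DERIV], of "ball 0 1" q 0]
      q(3) by auto
  define h where "h t = exp (g t / of_nat m)" for t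
  have h_holo: "h holomorphic_on ball 0 1"
    unfolding h_def using \<open>m > 0\<close> by (intro holomorphic_intros g) auto
  have h: "cmod (h t) = root m (cmod (poly q t))" if "cmod t < 1" for t
  proof -
    have "h t ^ m = poly q t" using g(2)[of t] that \<open>m > 0\<close> by (simp add: h_def exp_of_nat_mult[symmetric])
    then have "cmod (poly q t) = cmod (h t) ^ m" by (metis norm_power)
    then show ?thesis using \<open>m > 0\<close> by (simp add: real_root_power_cancel)
  qed
  let ?I = "\<lambda>r. integral {0..2*pi} (\<lambda>t. root m (cmod (poly q (of_real r * cis t))))"
  have mean: "2 * pi * root m (cmod (poly q 0)) \<le> ?I r" if r: "0 < r" "r < 1" for r
  proof -
    have "((\<lambda>u. h u / (u - 0)) has_contour_integral (2 * of_real pi * \<i> * h 0)) (circlepath 0 r)"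
      using r by (intro Cauchy_integral_circlepath_simple holomorphic_on_subset[OF h_holo]) auto
    then have "((\<lambda>t. h (0 + r * cis t) / (0 + r * cis t - 0) * r * \<i> * cis t) has_integral 2 * of_real pi * \<i> * h 0) {0..2*pi}"
      unfolding circlepath_def by (subst (asm) has_contour_integral_part_circlepath_iff) auto
    moreover have "h (0 + r * cis t) / (0 + r * cis t - 0) * r * \<i> * cis t = \<i> * h (r * cis t)" for t
      using r by (simp add: field_simps)
    ultimately have i: "((\<lambda>t. \<i> * h (r * cis t)) has_integral 2 * of_real pi * \<i> * h 0) {0..2*pi}"
      by (simp only:)
    have "cmod (2 * of_real pi * \<i> * h 0) \<le> ?I r"
      unfolding integral_unique[OF i, symmetric]
    proof (rule integral_norm_bound_integral)
      show "(\<lambda>t. \<i> * h (r * cis t)) integrable_on {0..2*pi}" using i by blast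
      show "(\<lambda>t. root m (cmod (poly q (r * cis t)))) integrable_on {0..2*pi}"
        by (intro integrable_continuous_interval continuous_intros)
      show "cmod (\<i> * h (r * cis t)) \<le> root m (cmod (poly q (r * cis t)))" if "t \<in> {0..2*pi}" for t
        using h[of "r * cis t"] r by (simp add: norm_mult)
    qed
    then show ?thesis using h[of 0] by (simp add: norm_mult)
  qed
  have "continuous_on {0..1} (\<lambda>r. integral (cbox 0 (2*pi)) (\<lambda>t. root m (cmod (poly q (of_real r * cis t)))))"
    by (rule integral_continuous_on_param) (auto simp: case_prod_beta intro!: continuous_intros)
  then have cont: "continuous_on {0..1} ?I" by simp
  have "(\<lambda>n. 1 - inverse (real (Suc (Suc n)))) \<longlonglongrightarrow> 1 - 0"
    by (intro tendsto_diff tendsto_const LIMSEQ_Suc[OF LIMSEQ_inverse_real_of_nat])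
  then have lim: "(\<lambda>n. ?I (1 - inverse (real (Suc (Suc n))))) \<longlonglongrightarrow> ?I 1"
    by (intro continuous_on_tendsto_compose[OF cont]) (auto simp: field_simps)
  have "2 * pi * root m (cmod (poly q 0)) \<le> ?I 1"
  proof (rule LIMSEQ_le_const[OF lim], intro exI allI impI)
    fix n
    show "2 * pi * root m (cmod (poly q 0)) \<le> ?I (1 - inverse (real (Suc (Suc n))))"
      by (rule mean) (auto simp: field_simps)
  qed
  moreover have "?I 1 = integral {0..2*pi} (\<lambda>t. root m (cmod (poly p (cis t))))"
    using q(1) by simp
  moreover have "2 * pi * root m (cmod (poly p 0)) \<le> 2 * pi * root m (cmod (poly q 0))"
    using q(2) \<open>m > 0\<close> by simp
  ultimately show ?thesis by linarith
qed simp

section \<open>Exhaustion by balls, Kobayashi metric and plurisubharmonicity\<close>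

lemma tendsto_0_of_contraction:
  fixes a :: "nat \<Rightarrow> 'a :: real_normed_vector"
  assumes "\<And>n. n \<ge> N \<Longrightarrow> norm (a (Suc n)) \<le> 3 / 4 * norm (a n)"
  shows "a \<longlonglongrightarrow> 0"
proof -
  have le: "norm (a (m + N)) \<le> (3 / 4) ^ m * norm (a N)" for m
  proof (induction m)
    case (Suc m)
    then show ?case using assms[of "m + N"] by simp
  qed simp
  have "(\<lambda>m. (3 / 4) ^ m * norm (a N)) \<longlonglongrightarrow> 0"
    by (intro tendsto_mult_left_zero LIMSEQ_realpow_zero) auto
  with always_eventually[OF allI, OF le] have "(\<lambda>m. a (m + N)) \<longlonglongrightarrow> 0"
    by (rule Lim_null_comparison)
  then show ?thesis by (rule LIMSEQ_offset)
qed

lemma holo_automorphism_derivative: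
  assumes "holo_automorphism f"
  shows "fderiv (inv f) (f z) (fderiv f z v) = v"
    and "fderiv f z (fderiv (inv f) (f z) w) = w"
proof -
  have f: "holo_map UNIV f" "holo_map UNIV (inv f)" "bij f" using assms by (auto simp: holo_automorphism_def)
  have id: "inv f (f x) = x" "f (inv f x) = x" for x
    using f by (simp_all add: bij_is_inj bij_is_surj surj_f_inv_f)
  note d1 = holo_map_has_derivative[OF f(1) UNIV_I, of z]
  note d2 = holo_map_has_derivative[OF f(2) UNIV_I, of "f z"]
  have "((\<lambda>x. x) has_derivative (\<lambda>v. fderiv (inv f) (f z) (fderiv f z v))) (at z)"
    using has_derivative_compose[OF d1 d2] by (simp add: id)
  from has_derivative_unique[OF this has_derivative_ident]
  show "fderiv (inv f) (f z) (fderiv f z v) = v" by metis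
  have "((\<lambda>x. x) has_derivative (\<lambda>v. fderiv f z (fderiv (inv f) (f z) v))) (at (f z))"
    using has_derivative_compose[OF d2, of f "fderiv f z"] d1 by (simp add: id)
  from has_derivative_unique[OF this has_derivative_ident]
  show "fderiv f z (fderiv (inv f) (f z) w) = w" by metis
qed

context short_dynamics
begin

lemma F_contracts:
  assumes "norm w \<le> 1 / 2"
  shows "norm (F (\<eta> n) w) \<le> 3 / 4 * norm w"
proof -
  have "norm (F (\<eta> n) w) \<le> norm w * norm w + \<eta> n * norm w"
    using norm_F[OF \<eta>_pos[of n]] by (simp add: power2_eq_square)
  also have "\<dots> \<le> 1 / 2 * norm w + 1 / 4 * norm w"
    using assms \<eta>_le[of n] by (intro add_mono mult_right_mono) auto
  finally show ?thesis by simp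
qed

text \<open>On the ball of radius 1/2 every map contracts by the factor 3/4, so these preimages
  increase with \<open>n\<close>.\<close>

definition B :: "nat \<Rightarrow> (complex ^ 'n) set" where "B n = X n -` ball 0 (1 / 2)"

lemma B_step:
  assumes "z \<in> B n"
  shows "norm (X (Suc n) z) \<le> 3 / 4 * norm (X n z)" "z \<in> B (Suc n)"
proof -
  have n: "norm (X n z) < 1 / 2" using assms by (simp add: B_def)
  then show 1: "norm (X (Suc n) z) \<le> 3 / 4 * norm (X n z)" using F_contracts[of "X n z" n] by simp
  show "z \<in> B (Suc n)" using 1 n by (simp add: B_def)
qed

lemma B_mono: "n \<le> m \<Longrightarrow> z \<in> B n \<Longrightarrow> z \<in> B m"
  by (induction m rule: dec_induct) (auto intro: B_step)

lemma \<Omega>_union: "\<Omega> = (\<Union>n. B n)"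
proof (intro set_eqI iffI)
  fix z assume "z \<in> \<Omega>"
  then have "\<forall>\<^sub>F n in sequentially. norm (X n z) < 1 / 2" by (rule eventually_norm_X_less) simp
  then show "z \<in> (\<Union>n. B n)" by (auto simp: B_def eventually_sequentially)
next
  fix z assume "z \<in> (\<Union>n. B n)"
  then obtain N where "z \<in> B N" by blast
  then have "norm (X (Suc n) z) \<le> 3 / 4 * norm (X n z)" if "n \<ge> N" for n
    using B_step(1) B_mono that by blast
  from tendsto_0_of_contraction[of N "\<lambda>n. X n z", OF this] show "z \<in> \<Omega>" by (simp add: \<Omega>_def)
qed

lemma B_image: "B n = inv (X n) ` ball 0 (1 / 2)"
  unfolding B_def using bij_vimage_eq_inv_image[OF X_bij] .

lemma B_open: "open (B n)"
  unfolding B_def using X_continuous by (rule open_vimage[OF open_ball])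

lemma B_connected: "connected (B n)"
  unfolding B_image using X_inv_continuous by (intro connected_continuous_image) auto

lemma p_in_B: "p \<in> B n" by (simp add: B_def X_p)

lemma B_biholomorphic: "biholomorphic (B n) (ball 0 1)"
  unfolding biholomorphic_def
proof (intro exI conjI ballI)
  have scale: "holo_map UNIV (\<lambda>z :: complex ^ 'n. c *s z)" for c
    unfolding holo_map_iff by (auto intro!: holo_fun_mult holo_fun_const holo_fun_coord)
  show "holo_map (B n) (\<lambda>z. 2 *s X n z)"
    using holo_map_comp[OF X_holo[of n] scale[of 2]] B_open by (auto simp: holo_map_def)
  show "holo_map (ball 0 1) (\<lambda>w. inv (X n) ((1 / 2) *s w))"
    using holo_map_comp[OF scale[of "1 / 2"] X_inv_holo[of n]] by (auto simp: holo_map_def)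
  show "inv (X n) ((1 / 2) *s (2 *s X n z)) = z" for z by simp
  show "2 *s X n (inv (X n) ((1 / 2) *s w)) = w" for w by simp
  show "(\<lambda>z. 2 *s X n z) ` B n = ball 0 1"
  proof (intro equalityI subsetI)
    fix w assume "w \<in> (\<lambda>z. 2 *s X n z) ` B n"
    then show "w \<in> ball 0 1" by (auto simp: B_def norm_vector_scalar_mult)
  next
    fix w :: "complex ^ 'n" assume "w \<in> ball 0 1"
    then have "inv (X n) ((1 / 2) *s w) \<in> B n" by (simp add: B_def norm_vector_scalar_mult)
    then show "w \<in> (\<lambda>z. 2 *s X n z) ` B n" by (rule rev_image_eqI) simp
  qed
qed

text \<open>Once \<open>norm (X n z) < 1 / 4\<close>, each further derivative has norm at most
  \<open>2 * norm (X n z) + \<eta> n\<close>, hence at most 3/4.\<close>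

lemma X_derivative_tendsto_0:
  assumes "z \<in> \<Omega>"
  shows "(\<lambda>n. fderiv (X n) z v) \<longlonglongrightarrow> 0"
proof -
  let ?D = "\<lambda>n. fderiv (X n) z v"
  have chain: "?D (Suc n) = dF (\<eta> n) (X n z) (?D n)" for n
  proof -
    have "(X (Suc n) has_derivative (\<lambda>v. dF (\<eta> n) (X n z) (fderiv (X n) z v))) (at z)"
      using has_derivative_compose[OF holo_map_has_derivative[OF X_holo UNIV_I] F_has_derivative]
      by (simp add: comp_def)
    from frechet_derivative_at[OF this] show ?thesis by metis
  qed
  have "\<forall>\<^sub>F n in sequentially. norm (X n z) < 1 / 4" using assms by (rule eventually_norm_X_less) simp
  then obtain N where N: "\<And>n. n \<ge> N \<Longrightarrow> norm (X n z) < 1 / 4" by (auto simp: eventually_sequentially)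
  show ?thesis
  proof (rule tendsto_0_of_contraction)
    fix n assume "n \<ge> N"
    have "norm (?D (Suc n)) \<le> (2 * norm (X n z) + \<eta> n) * norm (?D n)"
      unfolding chain by (rule norm_dF[OF \<eta>_pos])
    also have "\<dots> \<le> 3 / 4 * norm (?D n)"
      using N[OF \<open>n \<ge> N\<close>] \<eta>_le[of n] by (intro mult_right_mono) auto
    finally show "norm (?D (Suc n)) \<le> 3 / 4 * norm (?D n)" .
  qed
qed

text \<open>For a late iterate both the image point and the image vector are small, so the affine
  disc in this direction, stretched by \<open>inverse \<alpha>\<close>, still fits into the ball of
  radius 1/2 and is pulled back by \<open>inv (X n)\<close>.\<close>

lemma kobayashi_disc:
  assumes "z \<in> \<Omega>" "\<alpha> > 0"
  shows "\<exists>f w. holo_disc f \<and> f ` ball 0 1 \<subseteq> \<Omega> \<and> f 0 = z \<and>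
       (f has_derivative (\<lambda>h. h *s w)) (at 0) \<and> complex_of_real \<alpha> *s w = v"
proof -
  have ev1: "\<forall>\<^sub>F n in sequentially. norm (X n z) < 1 / 4" using assms(1) by (rule eventually_norm_X_less) simp
  have ev2: "\<forall>\<^sub>F n in sequentially. norm (fderiv (X n) z v) < \<alpha> / 4"
    by (rule order_tendstoD(2)[OF tendsto_norm_zero[OF X_derivative_tendsto_0[OF assms(1)]]])
       (use assms(2) in simp)
  from eventually_conj[OF ev1 ev2] obtain n where n: "norm (X n z) < 1 / 4"
    "norm (fderiv (X n) z v) < \<alpha> / 4" by (auto simp: eventually_sequentially)
  define b where "b = complex_of_real (inverse \<alpha>) *s fderiv (X n) z v"
  have "norm b = inverse \<alpha> * norm (fderiv (X n) z v)"
    using assms(2) by (simp add: b_def norm_vector_scalar_mult del: of_real_inverse)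
  also have "\<dots> < inverse \<alpha> * (\<alpha> / 4)" using n(2) assms(2) by (intro mult_strict_left_mono) auto
  finally have "norm b < 1 / 4" using assms(2) by simp
  define f where "f t = inv (X n) (X n z + t *s b)" for t
  have der: "(f has_derivative (\<lambda>h. h *s fderiv (inv (X n)) (X n z + t *s b) b)) (at t)" for t
    unfolding f_def using holo_map_line[OF X_inv_holo] by simp
  show ?thesis
  proof (intro exI conjI)
    show "holo_disc f" unfolding holo_disc_def using der by blast
    show "f ` ball 0 1 \<subseteq> \<Omega>"
    proof clarify
      fix t :: complex assume "t \<in> ball 0 1"
      then have "cmod t * norm b \<le> 1 * norm b" by (intro mult_right_mono) auto
      then have "norm (X n z + t *s b) < 1 / 2"
        using n(1) \<open>norm b < 1 / 4\<close> norm_triangle_ineq[of "X n z" "t *s b"] by (simp add: norm_vector_scalar_mult)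
      then have "f t \<in> B n" by (simp add: f_def B_def)
      then show "f t \<in> \<Omega>" unfolding \<Omega>_union by blast
    qed
    show "f 0 = z" by (simp add: f_def)
    show "(f has_derivative (\<lambda>h. h *s fderiv (inv (X n)) (X n z) b)) (at 0)"
      using der[of 0] by simp
    have "fderiv (inv (X n)) (X n z) b = complex_of_real (inverse \<alpha>) *s v"
      unfolding b_def holo_map_scale[OF X_inv_holo UNIV_I] holo_automorphism_derivative(1)[OF X_automorphism] ..
    then show "complex_of_real \<alpha> *s fderiv (inv (X n)) (X n z) b = v"
      using assms(2) by simp
  qed
qed

lemma kobayashi_zero:
  assumes "z \<in> \<Omega>"
  shows "kobayashi \<Omega> z v = 0"
proof -
  have "kobayashi \<Omega> z v = Inf {0<..}"
    unfolding kobayashi_def using kobayashi_disc[OF assms] by (intro arg_cong[of _ _ Inf]) auto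
  then show ?thesis by (simp add: cInf_greaterThan)
qed

text \<open>Iterates are polynomial on complex lines, so each \<open>u i n\<close> obeys the submean
  inequality. A circle is compact, hence inside one tame set, and the uniform error
  \<open>2 * \<delta> n\<close> lets the inequality pass to the limit.\<close>

lemma U_psh:
  assumes "i \<noteq> e 0"
  shows "psh S (U i)"
  unfolding psh_def
proof (intro conjI allI impI)
  show "usc_on S (U i)"
    unfolding usc_on_def
  proof (intro ballI allI impI)
    fix z c assume "z \<in> S" "U i z < c"
    have "(U i \<longlongrightarrow> U i z) (at z within S)"
      using U_continuous[OF assms, of S] \<open>z \<in> S\<close> by (simp add: continuous_on_def)
    then show "\<forall>\<^sub>F y in at z within S. U i y < c" using \<open>U i z < c\<close> by (rule order_tendstoD)
  qed
  fix a b :: "complex ^ 'n"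
  have cis: "continuous_on A (\<lambda>t. a + cis t *s b)" for A
    by (intro continuous_intros bounded_linear.continuous_on[OF bounded_linear_scalar_line])
  have cont: "continuous_on A (\<lambda>t. U i (a + cis t *s b))" for A
    by (rule continuous_on_compose2[OF U_continuous[OF assms, of UNIV] cis]) auto
  show int: "set_integrable lborel {0..2*pi} (\<lambda>t. U i (a + cis t *s b))"
    by (rule borel_integrable_atLeastAtMost'[OF cont])
  let ?K = "(\<lambda>t. a + cis t *s b) ` {0..2*pi}"
  have "compact (X 0 ` ?K)"
    by (intro compact_continuous_image X_continuous cis) simp
  then obtain M where M: "\<And>z. z \<in> ?K \<Longrightarrow> norm (X 0 z) \<le> M"
    using compact_imp_bounded bounded_iff by (metis imageI)
  obtain N where "M < real N" using reals_Archimedean2 by blast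
  then have "z \<in> tame N" if "z \<in> ?K" for z using M[OF that] by (intro tame_large) simp
  then have tame: "a + cis t *s b \<in> tame n" if "t \<in> {0..2*pi}" "n \<ge> N" for t n
    using that tame_mono by blast
  have sub: "2 * pi * u i n a \<le> integral {0..2*pi} (\<lambda>t. u i n (a + cis t *s b))" for n
  proof -
    obtain q where "\<And>t. X n (a + t *s b) $ i = poly q t" using poly_fun_line[OF X_poly] by blast
    then have "u i n (a + t *s b) = root (2 ^ n) (cmod (poly q t))" for t by (simp add: u_def)
    from root_poly_submean[of "2 ^ n" q] this[of 0] this show ?thesis by simp
  qed
  have step: "2 * pi * u i n a \<le> integral {0..2*pi} (\<lambda>t. U i (a + cis t *s b)) + 4 * pi * \<delta> n" if "n \<ge> N" for n
  proof -
    have "integral {0..2*pi} (\<lambda>t. u i n (a + cis t *s b)) \<le> integral {0..2*pi} (\<lambda>t. U i (a + cis t *s b) + 2 * \<delta> n)"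
    proof (rule integral_le)
      show "(\<lambda>t. u i n (a + cis t *s b)) integrable_on {0..2*pi}"
        by (intro integrable_continuous_interval continuous_on_compose2[OF u_continuous[of UNIV] cis]) auto
      show "(\<lambda>t. U i (a + cis t *s b) + 2 * \<delta> n) integrable_on {0..2*pi}"
        by (intro integrable_continuous_interval continuous_intros cont)
      show "u i n (a + cis t *s b) \<le> U i (a + cis t *s b) + 2 * \<delta> n" if "t \<in> {0..2*pi}" for t
        using U_diff[OF assms tame[OF that \<open>n \<ge> N\<close>]] by linarith
    qed
    also have "\<dots> = integral {0..2*pi} (\<lambda>t. U i (a + cis t *s b)) + 4 * pi * \<delta> n"
      by (subst integral_add) (auto intro!: integrable_continuous_interval cont)
    finally show ?thesis using sub[of n] by linarith
  qed
  have "2 * pi * U i a \<le> integral {0..2*pi} (\<lambda>t. U i (a + cis t *s b)) + 4 * pi * 0"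
  proof (rule LIMSEQ_le)
    show "(\<lambda>n. 2 * pi * u i n a) \<longlonglongrightarrow> 2 * pi * U i a" by (intro tendsto_intros u_tendsto assms)
    show "(\<lambda>n. integral {0..2*pi} (\<lambda>t. U i (a + cis t *s b)) + 4 * pi * \<delta> n)
        \<longlonglongrightarrow> integral {0..2*pi} (\<lambda>t. U i (a + cis t *s b)) + 4 * pi * 0"
      by (intro tendsto_intros \<delta>_lim)
  qed (use step in blast)
  then show "U i a \<le> 1 / (2 * pi) * (LINT t:{0..2*pi}|lborel. U i (a + cis t *s b))"
    using set_borel_integral_eq_integral(2)[OF int] by (simp add: field_simps)
qed

lemma \<Omega>_short: "short_Ck \<Omega>"
  unfolding short_Ck_def
proof (intro conjI)
  show "open \<Omega>" unfolding \<Omega>_union using B_open by blast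
  show "connected \<Omega>" unfolding \<Omega>_union
  proof (rule connected_Union)
    have "p \<in> \<Inter> (range B)" using p_in_B by blast
    then show "\<Inter> (range B) \<noteq> {}" by blast
  qed (use B_connected in auto)
  have "p \<in> \<Omega>" unfolding \<Omega>_union using p_in_B by blast
  then show "\<Omega> \<noteq> {}" by blast
  show "\<exists>\<Omega>s. \<Omega> = (\<Union>j. \<Omega>s j) \<and> (\<forall>j. \<Omega>s j \<subseteq> \<Omega>s (Suc j)) \<and> (\<forall>j. biholomorphic (\<Omega>s j) (ball 0 1))"
    using \<Omega>_union B_step(2) B_biholomorphic by (intro exI[of _ B]) blast
  show "\<forall>z\<in>\<Omega>. \<forall>v. kobayashi \<Omega> z v = 0" using kobayashi_zero by blast
  obtain i where i: "i \<noteq> e 0" using \<sigma>_neq by blast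
  \<comment> \<open>At this point the first coupling term vanishes because
    \<open>\<sigma> i \<noteq> i\<close>. So \<open>u i 1 z = 1 / 4\<close> exceeds the error
    \<open>2 * \<delta> 1\<close>, whereas \<open>U i\<close> is 0 at \<open>p\<close>.\<close>
  define w :: "complex ^ 'n" where "w = axis i (1 / 4)"
  define z where "z = inv (X 0) w"
  have w: "norm w = 1 / 4" by (simp add: w_def norm_axis_complex)
  have X0: "X 0 z = w" unfolding z_def by (rule X_inv)
  have X1: "X 1 z $ i = 1 / 16"
    using X_Suc_nth[OF i, of 0 z] \<sigma>_neq[of i] by (simp add: X0[simplified] w_def axis_def power2_eq_square)
  have "z \<in> B 0" using X0 w by (simp add: B_def)
  then have z: "z \<in> \<Omega>" unfolding \<Omega>_union by blast
  have "z \<in> tame 1" by (rule tame_large) (use X0 w in simp)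
  moreover have "u i 1 z = 1 / 4"
  proof -
    have "sqrt (1 / 16) = 1 / 4" by (rule real_sqrt_unique) (simp_all add: power2_eq_square)
    then show ?thesis unfolding u_def X1 by (simp add: sqrt_def norm_divide)
  qed
  ultimately have "U i z > 0" using U_diff[OF i, of z 1] \<delta>_le[of 1] by linarith
  moreover have "U i p = 0"
    using u_tendsto[OF i, of p] LIMSEQ_unique[of "\<lambda>n. u i n p" 0] by (simp add: u_def X_p)
  ultimately show "\<exists>u. psh \<Omega> u \<and> (\<exists>M. \<forall>z\<in>\<Omega>. u z \<le> M) \<and> (\<exists>x\<in>\<Omega>. \<exists>y\<in>\<Omega>. u x \<noteq> u y)"
    using U_psh[OF i] \<Omega>_eq i z \<open>p \<in> \<Omega>\<close>
    by (intro exI[of _ "U i"] conjI exI[of _ 1] ballI bexI[of _ z] bexI[of _ p]) (auto intro: less_imp_le)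
qed

end

section \<open>Smoothness of the boundary\<close>

text \<open>The polynomial factor in \<open>1 / x\<close> makes the family of flat functions closed
  under differentiation.\<close>

definition flat :: "real poly \<Rightarrow> real \<Rightarrow> real" where
  "flat p x = (if x \<le> 0 then 0 else poly p (1 / x) * exp (- (1 / x)))"

text \<open>With \<open>y = 1 / x\<close> the derivative of \<open>P(y) exp(-y)\<close> in
  \<open>x\<close> is \<open>y^2 (P(y) - P'(y)) exp(-y)\<close>.\<close>

definition flat_deriv :: "real poly \<Rightarrow> real poly" where
  "flat_deriv p = [:0, 0, 1:] * (p - pderiv p)"

lemma poly_times_exp_tendsto_0: "((\<lambda>y. poly p y * exp (- y)) \<longlongrightarrow> (0::real)) at_top"
proof -
  have "((\<lambda>y. \<Sum>i\<le>degree p. coeff p i * (y ^ i / exp y)) \<longlongrightarrow> (\<Sum>i\<le>degree p. coeff p i * 0)) at_top"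
    by (intro tendsto_sum tendsto_mult tendsto_const tendsto_power_div_exp_0)
  then show ?thesis
    by (simp add: poly_altdef sum_distrib_right exp_minus divide_inverse mult.assoc)
qed

lemma flat_tendsto_0: "(flat p \<longlongrightarrow> 0) (at 0)"
proof (rule filterlim_split_at_real)
  have "((\<lambda>x. 0::real) \<longlongrightarrow> 0) (at_left 0)" by simp
  then show "(flat p \<longlongrightarrow> 0) (at_left 0)"
    by (rule Lim_transform_eventually) (auto simp: flat_def eventually_at_filter intro!: always_eventually)
  have "((\<lambda>x. poly p (inverse x) * exp (- inverse x)) \<longlongrightarrow> 0) (at_right 0)"
    by (rule filterlim_compose[OF poly_times_exp_tendsto_0 filterlim_inverse_at_top_right])
  then show "(flat p \<longlongrightarrow> 0) (at_right 0)"
    by (rule Lim_transform_eventually)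
       (auto simp: flat_def eventually_at_filter inverse_eq_divide intro!: always_eventually)
qed

lemma flat_has_derivative: "(flat p has_real_derivative flat (flat_deriv p) x) (at x)"
proof -
  consider "x < 0" | "x = 0" | "x > 0" by linarith
  then show ?thesis
  proof cases
    case 1
    have "((\<lambda>_. 0) has_real_derivative 0) (at x)" by simp
    then have "(flat p has_real_derivative 0) (at x)"
      by (rule has_field_derivative_transform_within_open[where S = "{..<0}"]) (use 1 in \<open>auto simp: flat_def\<close>)
    then show ?thesis using 1 by (simp add: flat_def)
  next
    case 2
    \<comment> \<open>For positive \<open>y\<close> the quotient \<open>flat p y / y\<close> is
      again flat, with the polynomial multiplied by its variable.\<close>
    have "((\<lambda>y. (flat p y - flat p 0) / (y - 0)) \<longlongrightarrow> 0) (at 0)"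
      by (rule Lim_transform_eventually[OF flat_tendsto_0[of "pCons 0 p"]])
         (auto simp: flat_def eventually_at_filter field_simps)
    then show ?thesis using 2 by (simp add: has_field_derivative_iff flat_def)
  next
    case 3
    have "((\<lambda>x. poly p (1 / x) * exp (- (1 / x))) has_real_derivative
        poly (pderiv p) (1 / x) * (- (1 / x\<^sup>2)) * exp (- (1 / x)) + poly p (1 / x) * (exp (- (1 / x)) * (1 / x\<^sup>2))) (at x)"
    proof -
      have inv: "((\<lambda>x. 1 / x) has_real_derivative (- (1 / x\<^sup>2))) (at x)"
        using 3 by (auto intro!: derivative_eq_intros simp: power2_eq_square)
      have e: "((\<lambda>x. exp (- (1 / x))) has_real_derivative exp (- (1 / x)) * (1 / x\<^sup>2)) (at x)"
        using DERIV_fun_exp[OF DERIV_minus[OF inv]] by simp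
      show ?thesis
        using DERIV_mult[OF DERIV_chain2[OF poly_DERIV inv] e] by (simp add: algebra_simps)
    qed
    then have "(flat p has_real_derivative
        poly (pderiv p) (1 / x) * (- (1 / x\<^sup>2)) * exp (- (1 / x)) + poly p (1 / x) * (exp (- (1 / x)) * (1 / x\<^sup>2))) (at x)"
      by (rule has_field_derivative_transform_within_open[where S = "{0<..}"]) (use 3 in \<open>auto simp: flat_def\<close>)
    moreover have "poly (pderiv p) (1 / x) * (- (1 / x\<^sup>2)) * exp (- (1 / x)) + poly p (1 / x) * (exp (- (1 / x)) * (1 / x\<^sup>2))
        = flat (flat_deriv p) x"
      using 3 by (simp add: flat_def flat_deriv_def power2_eq_square algebra_simps)
    ultimately show ?thesis by simp
  qed
qed

lemma flat_one_less: "x > 0 \<Longrightarrow> flat 1 x < flat 1 1 \<longleftrightarrow> x < 1"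
  by (auto simp: flat_def field_simps)

lemma flat_one_eq: "x > 0 \<Longrightarrow> flat 1 x = flat 1 1 \<longleftrightarrow> x = 1"
  by (auto simp: flat_def field_simps)

lemma flat_nonpos: "x \<le> 0 \<Longrightarrow> flat p x = 0" and flat_one_pos: "flat 1 1 > 0"
  by (simp_all add: flat_def)

lemma flat_deriv_one_pos: "flat (flat_deriv 1) 1 > 0"
  by (simp add: flat_def flat_deriv_def pderiv_1)

text \<open>A certificate for smoothness in the sense of \<open>iter_dderiv\<close>: a function that
  agrees on \<open>S\<close> with a member still does so after any list of directional
  derivatives.\<close>

definition derivative_closed :: "(complex ^ 'n) set \<Rightarrow> (complex ^ 'n \<Rightarrow> real) set \<Rightarrow> bool" where
  "derivative_closed S \<F> \<longleftrightarrow> open S \<and>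
     (\<forall>g\<in>\<F>. \<exists>D. (\<forall>v. D v \<in> \<F>) \<and> (\<forall>q\<in>S. (g has_derivative (\<lambda>v. D v q)) (at q)))"

lemma frechet_derivative_cong_open:
  assumes "open S" "q \<in> S" "\<And>x. x \<in> S \<Longrightarrow> f x = g x" "(g has_derivative D) (at q)"
  shows "(f has_derivative D) (at q)" "fderiv f q = D"
proof -
  show "(f has_derivative D) (at q)"
    using has_derivative_transform_within_open[OF assms(4,1,2)] assms(3) by simp
  then show "fderiv f q = D" by (rule frechet_derivative_at[symmetric])
qed

lemma iter_dderiv_in_family:
  assumes cl: "derivative_closed S \<F>" and "g \<in> \<F>" and "\<And>q. q \<in> S \<Longrightarrow> f q = g q"
  shows "\<exists>g'\<in>\<F>. \<forall>q\<in>S. iter_dderiv f vs q = g' q"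
proof (induction vs)
  case Nil
  then show ?case using assms by auto
next
  case (Cons v vs)
  then obtain g' where g': "g' \<in> \<F>" "\<And>q. q \<in> S \<Longrightarrow> iter_dderiv f vs q = g' q" by blast
  then obtain D where D: "\<And>v. D v \<in> \<F>" "\<And>q. q \<in> S \<Longrightarrow> (g' has_derivative (\<lambda>v. D v q)) (at q)"
    using cl unfolding derivative_closed_def by blast
  have "open S" using cl by (simp add: derivative_closed_def)
  have "iter_dderiv f (v # vs) q = D v q" if "q \<in> S" for q
    using frechet_derivative_cong_open(2)[OF \<open>open S\<close> that g'(2) D(2)[OF that]] by simp
  then show ?case using D by blast
qed

lemma iter_dderiv_differentiable:
  assumes cl: "derivative_closed S \<F>" and "g \<in> \<F>" "\<And>q. q \<in> S \<Longrightarrow> f q = g q" "q \<in> S"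
  shows "iter_dderiv f vs differentiable (at q)"
proof -
  obtain g' where g': "g' \<in> \<F>" "\<And>q. q \<in> S \<Longrightarrow> iter_dderiv f vs q = g' q"
    using iter_dderiv_in_family[OF assms(1-3)] by blast
  then obtain D where D: "(g' has_derivative (\<lambda>v. D v q)) (at q)"
    using cl \<open>q \<in> S\<close> unfolding derivative_closed_def by blast
  have "open S" using cl by (simp add: derivative_closed_def)
  from frechet_derivative_cong_open(1)[OF this \<open>q \<in> S\<close> g'(2) D]
  show ?thesis by (rule differentiableI)
qed

text \<open>Contains every iterated derivative of \<open>flat p (1 + Re H)\<close>: the chain rule
  produces only products of flat terms with real parts of derivatives of \<open>H\<close>.\<close>

inductive_set flat_family :: "(complex ^ 'n) set \<Rightarrow> (complex ^ 'n \<Rightarrow> complex) \<Rightarrow> (complex ^ 'n \<Rightarrow> real) set"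
  for S H where
  flat: "(\<lambda>z. flat p (1 + Re (H z))) \<in> flat_family S H"
| re: "holo_fun S K \<Longrightarrow> (\<lambda>z. Re (K z)) \<in> flat_family S H"
| add: "f \<in> flat_family S H \<Longrightarrow> g \<in> flat_family S H \<Longrightarrow> (\<lambda>z. f z + g z) \<in> flat_family S H"
| mult: "f \<in> flat_family S H \<Longrightarrow> g \<in> flat_family S H \<Longrightarrow> (\<lambda>z. f z * g z) \<in> flat_family S H"

lemma re_has_derivative:
  assumes "holo_fun S K" "q \<in> S"
  shows "((\<lambda>z. Re (K z)) has_derivative (\<lambda>v. Re (fderiv K q v))) (at q)"
  using bounded_linear.has_derivative[OF bounded_linear_Re holo_fun_has_derivative[OF assms]] .

lemma flat_re_has_derivative:
  assumes "holo_fun S H" "q \<in> S"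
  shows "((\<lambda>z. flat p (1 + Re (H z))) has_derivative
    (\<lambda>v. flat (flat_deriv p) (1 + Re (H q)) * Re (fderiv H q v))) (at q)"
proof -
  have "((\<lambda>z. 1 + Re (H z)) has_derivative (\<lambda>v. 0 + Re (fderiv H q v))) (at q)"
    by (intro has_derivative_add has_derivative_const re_has_derivative[OF assms])
  from has_derivative_compose[OF this flat_has_derivative[unfolded has_field_derivative_def]]
  show ?thesis by simp
qed

lemma flat_family_closed:
  assumes H: "holo_fun S H"
  shows "derivative_closed S (flat_family S H)"
  unfolding derivative_closed_def
proof (intro conjI ballI)
  show "open S" using holo_fun_open[OF H] .
  fix g assume "g \<in> flat_family S H"
  then show "\<exists>D. (\<forall>v. D v \<in> flat_family S H) \<and> (\<forall>q\<in>S. (g has_derivative (\<lambda>v. D v q)) (at q))"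
  proof induction
    case (flat p)
    show ?case
      by (intro exI[of _ "\<lambda>v z. flat (flat_deriv p) (1 + Re (H z)) * Re (fderiv H z v)"] conjI allI ballI)
         (auto intro: flat_re_has_derivative[OF H]
            flat_family.mult[OF flat_family.flat flat_family.re[OF holo_fun_directional_derivative[OF H]]])
  next
    case (re K)
    then show ?case
      by (intro exI[of _ "\<lambda>v z. Re (fderiv K z v)"] conjI allI ballI)
         (auto intro: flat_family.re[OF holo_fun_directional_derivative] re_has_derivative)
  next
    case (add f g)
    then obtain D E where "\<And>v. D v \<in> flat_family S H" "\<And>v. E v \<in> flat_family S H"
      "\<And>q. q \<in> S \<Longrightarrow> (f has_derivative (\<lambda>v. D v q)) (at q)"
      "\<And>q. q \<in> S \<Longrightarrow> (g has_derivative (\<lambda>v. E v q)) (at q)" by blast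
    then show ?case
      by (intro exI[of _ "\<lambda>v z. D v z + E v z"] conjI allI ballI) (auto intro: flat_family.add has_derivative_add)
  next
    case (mult f g)
    then obtain D E where DE: "\<And>v. D v \<in> flat_family S H" "\<And>v. E v \<in> flat_family S H"
      "\<And>q. q \<in> S \<Longrightarrow> (f has_derivative (\<lambda>v. D v q)) (at q)"
      "\<And>q. q \<in> S \<Longrightarrow> (g has_derivative (\<lambda>v. E v q)) (at q)" by blast
    show ?case
    proof (intro exI[of _ "\<lambda>v z. f z * E v z + D v z * g z"] conjI allI ballI)
      show "(\<lambda>z. f z * E v z + D v z * g z) \<in> flat_family S H" for v
        by (intro flat_family.add flat_family.mult mult.hyps DE)
      show "((\<lambda>z. f z * g z) has_derivative (\<lambda>v. f q * E v q + D v q * g q)) (at q)" if "q \<in> S" for q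
        by (rule has_derivative_mult[OF DE(3,4)[OF that]])
    qed
  qed
qed

text \<open>\<open>Re H\<close> is pluriharmonic: its second derivatives along \<open>w\<close> and
  \<open>\<i> *s w\<close> cancel. What remains is the second derivative of the outer function times
  the squared modulus of \<open>fderiv H q w\<close>.\<close>

lemma flat_re_Levi_form:
  assumes H: "holo_fun S H" and q: "q \<in> S" and \<rho>: "\<And>z. z \<in> S \<Longrightarrow> \<rho> z = flat p (1 + Re (H z)) - c"
  shows "fderiv \<rho> q w = flat (flat_deriv p) (1 + Re (H q)) * Re (fderiv H q w)"
    and "iter_dderiv \<rho> [w, w] q + iter_dderiv \<rho> [\<i> *s w, \<i> *s w] q
      = flat (flat_deriv (flat_deriv p)) (1 + Re (H q)) * (cmod (fderiv H q w))\<^sup>2"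
proof -
  have "open S" using holo_fun_open[OF H] .
  have d1: "fderiv \<rho> z = (\<lambda>w. flat (flat_deriv p) (1 + Re (H z)) * Re (fderiv H z w))"
    if "z \<in> S" for z
  proof (rule frechet_derivative_cong_open(2)[OF \<open>open S\<close> that \<rho>])
    show "((\<lambda>z. flat p (1 + Re (H z)) - c) has_derivative
        (\<lambda>w. flat (flat_deriv p) (1 + Re (H z)) * Re (fderiv H z w))) (at z)"
      using has_derivative_diff[OF flat_re_has_derivative[OF H that] has_derivative_const] by simp
  qed
  then show "fderiv \<rho> q w = flat (flat_deriv p) (1 + Re (H q)) * Re (fderiv H q w)"
    using q by simp
  have d2: "iter_dderiv \<rho> [v, v] q = flat (flat_deriv p) (1 + Re (H q)) *
        Re (frechet_derivative (\<lambda>z. fderiv H z v) (at q) v)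
      + flat (flat_deriv (flat_deriv p)) (1 + Re (H q)) * (Re (fderiv H q v))\<^sup>2" for v
  proof -
    have "((\<lambda>z. flat (flat_deriv p) (1 + Re (H z)) * Re (fderiv H z v)) has_derivative
        (\<lambda>w. flat (flat_deriv p) (1 + Re (H q)) * Re (frechet_derivative (\<lambda>z. fderiv H z v) (at q) w)
          + flat (flat_deriv (flat_deriv p)) (1 + Re (H q)) * Re (fderiv H q w)
            * Re (fderiv H q v))) (at q)"
      by (rule has_derivative_mult[OF flat_re_has_derivative[OF H q]
            re_has_derivative[OF holo_fun_directional_derivative[OF H] q]])
    from frechet_derivative_cong_open(2)[OF \<open>open S\<close> q _ this, of "iter_dderiv \<rho> [v]"]
    show ?thesis by (simp add: d1 power2_eq_square mult.assoc)
  qed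
  let ?h = "fderiv H q w"
  let ?hh = "frechet_derivative (\<lambda>z. fderiv H z w) (at q) w"
  have s1: "fderiv H q (\<i> *s w) = \<i> * ?h" by (rule holo_fun_scale[OF H q])
  have hol: "holo_fun S (\<lambda>z. fderiv H z w)" by (rule holo_fun_directional_derivative[OF H])
  have "((\<lambda>z. \<i> * fderiv H z w) has_derivative
      (\<lambda>v. \<i> * frechet_derivative (\<lambda>z. fderiv H z w) (at q) v)) (at q)"
    by (rule has_derivative_mult_right[OF holo_fun_has_derivative[OF hol q]])
  then have "((\<lambda>z. fderiv H z (\<i> *s w)) has_derivative
      (\<lambda>v. \<i> * frechet_derivative (\<lambda>z. fderiv H z w) (at q) v)) (at q)"
    by (rule has_derivative_transform_within_open[OF _ \<open>open S\<close> q]) (simp add: holo_fun_scale[OF H])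
  then have D: "frechet_derivative (\<lambda>z. fderiv H z (\<i> *s w)) (at q)
      = (\<lambda>v. \<i> * frechet_derivative (\<lambda>z. fderiv H z w) (at q) v)"
    by (rule frechet_derivative_at[symmetric])
  have s2: "frechet_derivative (\<lambda>z. fderiv H z (\<i> *s w)) (at q) (\<i> *s w) = - ?hh"
    unfolding D holo_fun_scale[OF hol q] by simp
  show "iter_dderiv \<rho> [w, w] q + iter_dderiv \<rho> [\<i> *s w, \<i> *s w] q
      = flat (flat_deriv (flat_deriv p)) (1 + Re (H q)) * (cmod ?h)\<^sup>2"
    unfolding d2 s1 s2 by (simp add: cmod_power2 algebra_simps)
qed

section \<open>Local holomorphic potentials\<close>

lemma Ln_holomorphic_ball: "Ln holomorphic_on ball 1 1"
proof (rule holomorphic_on_Ln)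
  have "Re z > 0" if "z \<in> ball 1 1" for z
    using that abs_Re_le_cmod[of "1 - z"] by (simp add: dist_norm)
  then show "ball (1::complex) 1 \<inter> \<real>\<^sub>\<le>\<^sub>0 = {}" 
    unfolding disjoint_iff complex_nonpos_Reals_iff by (meson not_le)
qed

context short_dynamics
begin

text \<open>If the coordinate is nonzero at \<open>q\<close>, it stays on the chart in a disc
  avoiding 0, where a logarithm exists.\<close>

definition chart :: "'n \<Rightarrow> complex ^ 'n \<Rightarrow> nat \<Rightarrow> (complex ^ 'n) set" where
  "chart i q N = tame N \<inter> {z. cmod (X N z $ i - X N q $ i) < cmod (X N q $ i) / 2}"

lemma X_nth_continuous: "continuous_on A (\<lambda>z. X N z $ i)"
  by (intro continuous_intros X_continuous)

lemma chart_open: "open (chart i q N)"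
  unfolding chart_def
  by (intro open_Int tame_open open_Collect_less continuous_intros X_nth_continuous)

text \<open>From 1/4 the root at \<open>q\<close> keeps 1/5; on the chart the coordinate, hence its
  root, drops at most by half; later steps cost at most 2/100. The rest is above 1/16.\<close>

lemma chart_lower_bound:
  assumes i: "i \<noteq> e 0" and q: "q \<in> tame N" "U i q > 1 / 4" and z: "z \<in> chart i q N" and "l \<ge> N"
  shows "u i l z \<ge> 1 / 16"
proof -
  have zt: "z \<in> tame N" using z by (simp add: chart_def)
  have "u i N q \<ge> 1 / 5" using U_diff[OF i q(1)] q(2) \<delta>_le[of N] by linarith
  have "cmod (X N q $ i) / 2 \<le> cmod (X N z $ i)"
    using z norm_triangle_ineq2[of "X N q $ i" "X N z $ i"] by (simp add: chart_def norm_minus_commute)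
  moreover have "(u i N q / 2) ^ (2 ^ N) \<le> u i N q ^ (2 ^ N) / 2"
  proof -
    have "(2::real) ^ 1 \<le> 2 ^ (2 ^ N)" by (intro power_increasing) auto
    then show ?thesis unfolding power_divide using u_nonneg[of i N q] by (intro divide_left_mono) auto
  qed
  ultimately have "(u i N q / 2) ^ (2 ^ N) \<le> u i N z ^ (2 ^ N)" unfolding u_power by linarith
  then have "u i N q / 2 \<le> u i N z" using u_nonneg by (rule power_le_imp_le_base[of _ "2 ^ N - 1", simplified]) 
  then show ?thesis
    using u_diff[OF i zt \<open>l \<ge> N\<close>] \<open>u i N q \<ge> 1 / 5\<close> \<delta>_le[of N] \<delta>_pos[of l] by linarith
qed

definition ratio :: "'n \<Rightarrow> nat \<Rightarrow> complex ^ 'n \<Rightarrow> complex" where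
  "ratio i l z = of_real (\<eta> l) * X l z $ \<sigma> i / (X l z $ i)\<^sup>2"

text \<open>The perturbation is at most \<open>\<delta> l ^ (2 ^ Suc l)\<close> and the square at
  least \<open>(1 / 16) ^ (2 ^ Suc l)\<close>, so a high power of \<open>16 * \<delta> l < 1\<close>
  bounds the quotient.\<close>

lemma ratio_le:
  assumes "z \<in> tame l" "u i l z \<ge> 1 / 16"
  shows "cmod (ratio i l z) \<le> 16 * \<delta> l" and "X l z $ i \<noteq> 0"
proof -
  have pow: "(1 / 16) ^ (2 ^ l) \<le> cmod (X l z $ i)"
    unfolding u_power[symmetric] using assms by (intro power_mono) auto
  moreover have pos: "(1 / 16 :: real) ^ (2 ^ l) > 0" by simp
  ultimately show nz: "X l z $ i \<noteq> 0" by (metis norm_zero not_le)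
  have sq: "(1 / 16) ^ (2 ^ Suc l) \<le> (cmod (X l z $ i))\<^sup>2"
    using power_mono[OF pow, of 2] by (simp add: power_mult[symmetric] mult.commute)
  have pos2: "(1 / 16 :: real) ^ (2 ^ Suc l) > 0" by simp
  have "cmod (ratio i l z) = cmod (of_real (\<eta> l) * X l z $ \<sigma> i) / (cmod (X l z $ i))\<^sup>2"
    by (simp add: ratio_def norm_divide norm_power)
  also have "\<dots> \<le> \<delta> l ^ (2 ^ Suc l) / (1 / 16) ^ (2 ^ Suc l)"
    using perturbation_le[OF assms(1), of i] sq pos2 \<delta>_pos[of l]
    by (intro frac_le) auto
  also have "\<dots> = (16 * \<delta> l) ^ (2 ^ Suc l)" by (simp only: power_divide[symmetric]) simp
  also have "\<dots> \<le> (16 * \<delta> l) ^ 1"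
    using \<delta>_pos[of l] \<delta>_le[of l] by (intro power_decreasing) auto
  finally show "cmod (ratio i l z) \<le> 16 * \<delta> l" by simp
qed

lemma \<delta>_add: "\<delta> (N + j) = \<delta> N * (1 / 4) ^ j"
  by (simp add: \<delta>_def power_add)

text \<open>Along the orbit, \<open>x\<^sub>l\<^sub>+\<^sub>1 = x\<^sub>l\<^sup>2 (1 + r\<^sub>l)\<close>, so \<open>2\<^sup>-\<^sup>l ln |x\<^sub>l|\<close> telescopes into a series of \<open>Re (Ln (1 + r\<^sub>l))\<close>.\<close>
lemma ln_U_chart:
  assumes i: "i \<noteq> e 0" and q: "q \<in> tame N" "U i q > 1 / 4"
  obtains T where "holo_fun (chart i q N) T" "\<And>z. z \<in> chart i q N \<Longrightarrow> cmod (T z) \<le> 64 * \<delta> N"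
    "\<And>z. z \<in> chart i q N \<Longrightarrow> U i z > 0 \<and> ln (U i z) = (ln (cmod (X N z $ i)) + Re (T z)) / 2 ^ N"
proof -
  let ?S = "chart i q N"
  \<comment> \<open>The step from \<open>N + j\<close> to \<open>N + j + 1\<close> has weight
    \<open>1 / 2 ^ (N + Suc j)\<close>; the common factor \<open>1 / 2 ^ N\<close> is kept outside
    the series.\<close>
  define f where "f j z = of_real (1 / 2 ^ Suc j) * Ln (1 + ratio i (N + j) z)" for j z
  have tame: "z \<in> tame l" if "z \<in> ?S" "l \<ge> N" for z l
    using tame_mono[OF that(2)] that(1) by (simp add: chart_def)
  have lower: "u i l z \<ge> 1 / 16" if "z \<in> ?S" "l \<ge> N" for z l
    using chart_lower_bound[OF i q that] .
  have r: "cmod (ratio i l z) \<le> 16 * \<delta> l" "X l z $ i \<noteq> 0" if "z \<in> ?S" "l \<ge> N" for z l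
    using ratio_le[OF tame[OF that] lower[OF that]] .
  have r1: "cmod (ratio i l z) < 1 / 2" if "z \<in> ?S" "l \<ge> N" for z l
    using r(1)[OF that] \<delta>_le[of l] by linarith
  have f_le: "cmod (f j z) \<le> 32 * \<delta> N * (1 / 4) ^ j" if "z \<in> ?S" for j z
  proof -
    have "cmod (f j z) = 1 / 2 ^ Suc j * cmod (Ln (1 + ratio i (N + j) z))"
      by (simp add: f_def norm_mult norm_divide norm_power)
    also have "\<dots> \<le> 1 * (2 * cmod (ratio i (N + j) z))"
    proof (rule mult_mono)
      show "cmod (Ln (1 + ratio i (N + j) z)) \<le> 2 * cmod (ratio i (N + j) z)"
        using r1[OF that] by (intro norm_Ln_le) auto
    qed (use one_le_power[of "2::real" "Suc j"] in auto)
    also have "\<dots> \<le> 32 * \<delta> (N + j)" using r(1)[OF that, of "N + j"] by simp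
    finally show ?thesis by (simp add: \<delta>_add)
  qed
  have f_holo: "holo_fun ?S (f j)" for j
  proof -
    have x: "holo_fun ?S (\<lambda>z. X l z $ m)" for l m
      using holo_fun_subset[OF poly_fun_holo[OF X_poly] chart_open] by simp
    have "holo_fun ?S (\<lambda>z. ratio i (N + j) z)"
      unfolding ratio_def power2_eq_square
      using r(2) by (intro holo_fun_divide holo_fun_mult holo_fun_const chart_open x) auto
    then have "holo_fun ?S (\<lambda>z. 1 + ratio i (N + j) z)"
      by (intro holo_fun_add holo_fun_const chart_open)
    then have "holo_fun ?S (\<lambda>z. Ln (1 + ratio i (N + j) z))"
    proof (rule holo_fun_comp[OF _ Ln_holomorphic_ball])
      show "(\<lambda>z. 1 + ratio i (N + j) z) ` ?S \<subseteq> ball 1 1"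
      proof clarify
        fix z assume "z \<in> ?S"
        then have "cmod (ratio i (N + j) z) < 1 / 2" by (rule r1) simp
        then show "1 + ratio i (N + j) z \<in> ball 1 1" by (simp add: dist_norm)
      qed
    qed simp
    then show ?thesis unfolding f_def by (intro holo_fun_mult holo_fun_const chart_open)
  qed
  have summ: "summable (\<lambda>j. 32 * \<delta> N * (1 / 4) ^ j)"
    by (intro summable_mult summable_geometric) simp
  define T where "T z = (\<Sum>j. f j z)" for z
  have unif: "uniform_limit ?S (\<lambda>n z. \<Sum>j<n. f j z) T sequentially"
    unfolding T_def using f_le summ by (rule Weierstrass_m_test)
  show thesis
  proof
    show "holo_fun ?S T"
      by (rule holo_fun_uniform_limit[OF _ unif]) (intro holo_fun_sum chart_open f_holo)
    fix z assume z: "z \<in> ?S"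
    have "cmod (T z) \<le> (\<Sum>j. 32 * \<delta> N * (1 / 4) ^ j)"
      unfolding T_def using f_le[OF z] summ by (rule norm_suminf_le)
    also have "\<dots> = 32 * \<delta> N * (4 / 3)"
      by (subst suminf_mult) (auto simp: suminf_geometric)
    also have "\<dots> \<le> 64 * \<delta> N" using \<delta>_pos[of N] by simp
    finally show "cmod (T z) \<le> 64 * \<delta> N" .
    have U16: "U i z \<ge> 1 / 16"
      by (rule LIMSEQ_le_const[OF u_tendsto[OF i]]) (use lower[OF z] in blast)
    have tele: "ln (cmod (X (N + n) z $ i)) / 2 ^ n = ln (cmod (X N z $ i)) + Re (\<Sum>j<n. f j z)" for n
    proof (induction n)
      case (Suc n)
      let ?x = "X (N + n) z $ i" and ?r = "ratio i (N + n) z"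
      have nz: "?x \<noteq> 0" "1 + ?r \<noteq> 0"
      proof -
        show "?x \<noteq> 0" using r(2)[OF z] by simp
        have "cmod ?r < 1" using r1[OF z, of "N + n"] by simp
        then show "1 + ?r \<noteq> 0" by (metis add_eq_0_iff less_irrefl norm_minus_cancel norm_one)
      qed
      have "X (N + Suc n) z $ i = ?x\<^sup>2 * (1 + ?r)"
        using X_Suc_nth[OF i, of "N + n" z] nz(1) by (simp add: ratio_def field_simps)
      then have "ln (cmod (X (N + Suc n) z $ i)) = 2 * ln (cmod ?x) + ln (cmod (1 + ?r))"
        using nz by (simp only: norm_mult norm_power) (simp add: ln_mult ln_realpow)
      then have "ln (cmod (X (N + Suc n) z $ i)) / 2 ^ Suc n = ln (cmod ?x) / 2 ^ n + ln (cmod (1 + ?r)) / 2 ^ Suc n"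
        by (simp only: add_divide_distrib) simp
      moreover have "Re (f n z) = ln (cmod (1 + ?r)) / 2 ^ Suc n"
      proof -
        have "Re (complex_of_real c * w) = c * Re w" for c w by simp
        then show ?thesis using nz(2) unfolding f_def by simp
      qed
      ultimately show ?case using Suc by simp
    qed simp
    have "(\<lambda>n. ln (u i (N + n) z)) \<longlonglongrightarrow> ln (U i z)"
      using LIMSEQ_ignore_initial_segment[OF u_tendsto[OF i, of z], of N] U16
      by (intro tendsto_ln) (auto simp: add.commute)
    moreover have "ln (u i (N + n) z) = (ln (cmod (X N z $ i)) + Re (\<Sum>j<n. f j z)) / 2 ^ N" for n
      unfolding tele[symmetric] u_def by (simp add: ln_root power_add field_simps)
    moreover have "(\<lambda>n. (ln (cmod (X N z $ i)) + Re (\<Sum>j<n. f j z)) / 2 ^ N)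
        \<longlonglongrightarrow> (ln (cmod (X N z $ i)) + Re (T z)) / 2 ^ N"
      by (intro tendsto_intros tendsto_uniform_limitI[OF unif z]) simp
    ultimately show "U i z > 0 \<and> ln (U i z) = (ln (cmod (X N z $ i)) + Re (T z)) / 2 ^ N"
      using U16 LIMSEQ_unique by force
  qed
qed

text \<open>Dividing the coordinate by its value at \<open>q\<close> moves it into the ball about 1
  where \<open>Ln\<close> is holomorphic; a real constant restores the modulus. The derivative of
  \<open>H\<close> is then a logarithmic derivative plus that of the small \<open>T\<close>, over
  \<open>2 ^ N\<close>.\<close>

lemma holo_potential:
  assumes i: "i \<noteq> e 0" and q: "q \<in> tame N" "U i q > 1 / 4"
  obtains H T where "holo_fun (chart i q N) H" "holo_fun (chart i q N) T" "q \<in> chart i q N" "X N q $ i \<noteq> 0"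
    "\<And>z. z \<in> chart i q N \<Longrightarrow> cmod (T z) \<le> 64 * \<delta> N"
    "\<And>z. z \<in> chart i q N \<Longrightarrow> U i z > 0 \<and> ln (U i z) = Re (H z)"
    "\<And>v. fderiv H q v = (fderiv (X N) q v $ i / X N q $ i
        + fderiv T q v) / 2 ^ N"
proof -
  let ?S = "chart i q N"
  obtain T where T: "holo_fun ?S T" "\<And>z. z \<in> ?S \<Longrightarrow> cmod (T z) \<le> 64 * \<delta> N"
    "\<And>z. z \<in> ?S \<Longrightarrow> U i z > 0 \<and> ln (U i z) = (ln (cmod (X N z $ i)) + Re (T z)) / 2 ^ N"
    using ln_U_chart[OF assms] by blast
  have nz: "X N q $ i \<noteq> 0"
  proof
    assume "X N q $ i = 0"
    then have "u i N q = 0" by (simp add: u_def)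
    then show False using U_diff[OF i q(1)] q(2) \<delta>_le[of N] by linarith
  qed
  have qS: "q \<in> ?S" using q nz by (simp add: chart_def)
  have znz: "X N z $ i \<noteq> 0" if "z \<in> ?S" for z
    using that by (auto simp: chart_def)
  define L where "L z = Ln (X N z $ i / X N q $ i)" for z
  have "holo_fun ?S (\<lambda>z. X N z $ i)"
    using holo_fun_subset[OF poly_fun_holo[OF X_poly] chart_open] by simp
  then have ratio: "holo_fun ?S (\<lambda>z. X N z $ i / X N q $ i)"
    using nz by (intro holo_fun_divide holo_fun_const chart_open)
  have L: "holo_fun ?S L"
    unfolding L_def
  proof (rule holo_fun_comp[OF ratio Ln_holomorphic_ball])
    show "(\<lambda>z. X N z $ i / X N q $ i) ` ?S \<subseteq> ball 1 1"
    proof clarify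
      fix z assume "z \<in> ?S"
      then have "cmod (X N q $ i - X N z $ i) < cmod (X N q $ i) / 2"
        by (simp add: chart_def norm_minus_commute)
      then have "cmod (X N q $ i - X N z $ i) < cmod (X N q $ i)"
        using norm_ge_zero[of "X N q $ i"] by linarith
      then have "cmod ((X N q $ i - X N z $ i) / X N q $ i) < 1" using nz by (simp add: norm_divide)
      then show "X N z $ i / X N q $ i \<in> ball 1 1" using nz by (simp add: dist_norm diff_divide_distrib)
    qed
  qed simp
  define H where "H z = (L z + of_real (ln (cmod (X N q $ i))) + T z) / 2 ^ N" for z
  show thesis
  proof
    show "holo_fun ?S H"
      unfolding H_def by (intro holo_fun_divide holo_fun_add holo_fun_const chart_open L T) simp
    show "holo_fun ?S T" "q \<in> ?S" "X N q $ i \<noteq> 0" by fact+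
    show "cmod (T z) \<le> 64 * \<delta> N" if "z \<in> ?S" for z by (rule T(2)[OF that])
    show "U i z > 0 \<and> ln (U i z) = Re (H z)" if "z \<in> ?S" for z
    proof -
      have "Re (L z) = ln (cmod (X N z $ i)) - ln (cmod (X N q $ i))"
        using nz znz[OF that] by (simp add: L_def norm_divide ln_div)
      moreover have "Re (H z) = (Re (L z) + ln (cmod (X N q $ i)) + Re (T z)) / 2 ^ N"
      proof -
        have "H z = (L z + of_real (ln (cmod (X N q $ i))) + T z) / of_real (2 ^ N)" by (simp add: H_def)
        then show ?thesis by (simp only: Re_divide_of_real) simp
      qed
      ultimately show ?thesis using T(3)[OF that] by simp
    qed
    fix v
    let ?dX = "fderiv (X N) q" and ?dT = "fderiv T q"
    have "((\<lambda>z. X N z $ i) has_derivative (\<lambda>v. ?dX v $ i)) (at q)"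
      using holo_map_has_derivative[OF X_holo UNIV_I] by (rule has_derivative_vec_nth)
    then have d1: "((\<lambda>z. X N z $ i / X N q $ i) has_derivative (\<lambda>v. ?dX v $ i / X N q $ i)) (at q)"
      by (rule bounded_linear.has_derivative[OF bounded_linear_divide])
    have "(Ln has_field_derivative 1) (at (X N q $ i / X N q $ i))"
      using nz has_field_derivative_Ln[of 1] by simp
    then have "(L has_derivative (\<lambda>v. 1 * (?dX v $ i / X N q $ i))) (at q)"
      unfolding L_def has_field_derivative_def by (rule has_derivative_compose[OF d1])
    then have "(H has_derivative (\<lambda>v. (1 * (?dX v $ i / X N q $ i) + 0 + ?dT v) / 2 ^ N)) (at q)"
      unfolding H_def
      by (intro bounded_linear.has_derivative[OF bounded_linear_divide] has_derivative_add has_derivative_const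
          holo_fun_has_derivative[OF T(1) qS])
    from fun_cong[OF frechet_derivative_at[OF this], of v]
    show "fderiv H q v = (?dX v $ i / X N q $ i + ?dT v) / 2 ^ N" by simp
  qed
qed

text \<open>\<open>flat 1 (1 + ln U)\<close> is 0 for \<open>0 < U \<le> exp (-1)\<close>, and
  \<open>1 / 4 < exp (-1)\<close>: the case distinction only removes the singularity of
  \<open>ln\<close> at zeros. Subtracting \<open>flat 1 1\<close> puts the boundary at
  \<open>U = 1\<close>.\<close>

definition \<rho> :: "'n \<Rightarrow> complex ^ 'n \<Rightarrow> real" where
  "\<rho> i z = (if U i z \<le> 1 / 4 then 0 else flat 1 (1 + ln (U i z))) - flat 1 1"

lemma exp_minus_one_gt: "1 / 4 < exp (-1 :: real)"
  using exp_le by (simp add: exp_minus field_simps)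

lemma ln_le_minus_one: "x > 0 \<Longrightarrow> x < exp (-1) \<Longrightarrow> 1 + ln x \<le> (0::real)"
  by (smt (verit) exp_ln exp_le_cancel_iff)

lemma \<rho>_neg_iff: "\<rho> i z < 0 \<longleftrightarrow> U i z < 1" and \<rho>_zero_iff: "\<rho> i z = 0 \<longleftrightarrow> U i z = 1"
proof -
  have "(\<rho> i z < 0 \<longleftrightarrow> U i z < 1) \<and> (\<rho> i z = 0 \<longleftrightarrow> U i z = 1)"
  proof (cases "U i z \<le> 1 / 4")
    case True
    then show ?thesis using flat_one_pos by (simp add: \<rho>_def)
  next
    case False
    then have pos: "U i z > 0" by simp
    show ?thesis
    proof (cases "1 + ln (U i z) > 0")
      case True
      then show ?thesis using False flat_one_less[OF True] flat_one_eq[OF True] pos by (simp add: \<rho>_def)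
    next
      case neg: False
      then have "ln (U i z) < 0" by simp
      then have "U i z < 1" using pos by simp
      then show ?thesis using neg False flat_one_pos by (simp add: \<rho>_def flat_nonpos)
    qed
  qed
  then show "\<rho> i z < 0 \<longleftrightarrow> U i z < 1" "\<rho> i z = 0 \<longleftrightarrow> U i z = 1" by auto
qed

lemma \<rho>_eq_flat: "U i z > 0 \<Longrightarrow> \<rho> i z = flat 1 (1 + ln (U i z)) - flat 1 1"
  using ln_le_minus_one[of "U i z"] exp_minus_one_gt by (auto simp: \<rho>_def flat_nonpos)

text \<open>Two open regions cover the space: \<open>U i > 1 / 4\<close>, with local holomorphic
  potentials, and \<open>U i < exp (-1)\<close>, where \<open>\<rho> i\<close> is constant.\<close>

lemma \<rho>_smooth:
  assumes i: "i \<noteq> e 0"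
  shows "smooth_fun (\<rho> i)"
  unfolding smooth_fun_def
proof (intro allI)
  fix vs q
  show "iter_dderiv (\<rho> i) vs differentiable (at q)"
  proof (cases "U i q > 1 / 4")
    case True
    obtain N where N: "q \<in> tame N" using eventually_tame[of q] by (auto simp: eventually_sequentially)
    obtain H where H: "holo_fun (chart i q N) H" "q \<in> chart i q N"
      "\<And>z. z \<in> chart i q N \<Longrightarrow> U i z > 0 \<and> ln (U i z) = Re (H z)"
      using holo_potential[OF i N True] by metis
    show ?thesis
    proof (rule iter_dderiv_differentiable[OF flat_family_closed[OF H(1)] _ _ H(2)])
      show "(\<lambda>z. flat 1 (1 + Re (H z)) + Re (of_real (- flat 1 1))) \<in> flat_family (chart i q N) H"
        by (intro flat_family.add flat_family.flat flat_family.re holo_fun_const chart_open)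
      show "\<rho> i z = flat 1 (1 + Re (H z)) + Re (of_real (- flat 1 1))" if "z \<in> chart i q N" for z
        using H(3)[OF that] \<rho>_eq_flat[of i z] by simp
    qed
  next
    case False
    define S where "S = {z. U i z < exp (-1)}"
    have "open S" unfolding S_def by (intro open_Collect_less continuous_intros U_continuous[OF i])
    show ?thesis
    proof (rule iter_dderiv_differentiable[OF flat_family_closed[OF holo_fun_const[OF \<open>open S\<close>, of 0]]])
      show "(\<lambda>z. Re (of_real (- flat 1 1))) \<in> flat_family S (\<lambda>z. 0)"
        by (intro flat_family.re holo_fun_const \<open>open S\<close>)
      show "q \<in> S" using False exp_minus_one_gt by (simp add: S_def)
      show "\<rho> i z = Re (of_real (- flat 1 1))" if "z \<in> S" for z
        using that ln_le_minus_one[of "U i z"] by (auto simp: \<rho>_def S_def flat_nonpos)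
    qed
  qed
qed

lemma \<rho>_frontier:
  assumes "i \<noteq> e 0" "q \<in> frontier {z. \<rho> i z < 0}"
  shows "U i q = 1"
proof -
  have "open {z. U i z < 1}" by (intro open_Collect_less continuous_intros U_continuous[OF assms(1)])
  moreover have "closed {z. U i z \<le> 1}" by (intro closed_Collect_le continuous_intros U_continuous[OF assms(1)])
  then have "closure {z. U i z < 1} \<subseteq> {z. U i z \<le> 1}" by (intro closure_minimal) auto
  ultimately show ?thesis
    using assms(2) by (auto simp: \<rho>_neg_iff frontier_def interior_open)
qed

text \<open>Tangency of \<open>w\<close> and of \<open>\<i> *s w\<close> kills the real and the
  imaginary part of \<open>fderiv H q w\<close>, so the Levi form is exactly 0.\<close>

lemma \<rho>_levi:
  assumes i: "i \<noteq> e 0"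
  shows "levi_pseudoconvex (\<rho> i)"
  unfolding levi_pseudoconvex_def
proof (intro ballI allI impI)
  fix q w
  assume "q \<in> frontier {z. \<rho> i z < 0}"
    and tan: "fderiv (\<rho> i) q w = 0 \<and> fderiv (\<rho> i) q (\<i> *s w) = 0"
  then have U1: "U i q = 1" using \<rho>_frontier[OF i] by blast
  obtain N where N: "q \<in> tame N" using eventually_tame[of q] by (auto simp: eventually_sequentially)
  have gt: "U i q > 1 / 4" using U1 by simp
  obtain H where H: "holo_fun (chart i q N) H" "q \<in> chart i q N"
    "\<And>z. z \<in> chart i q N \<Longrightarrow> U i z > 0 \<and> ln (U i z) = Re (H z)"
    using holo_potential[OF i N gt] by metis
  have \<rho>: "\<rho> i z = flat 1 (1 + Re (H z)) - flat 1 1" if "z \<in> chart i q N" for z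
    using H(3)[OF that] \<rho>_eq_flat[of i z] by simp
  have ReH: "Re (H q) = 0" using H(3)[OF H(2)] U1 by simp
  note L = flat_re_Levi_form[OF H(1,2) \<rho>]
  have "Re (fderiv H q w) = 0"
    using tan L(1)[of w] flat_deriv_one_pos ReH by simp
  moreover have "Re (fderiv H q (\<i> *s w)) = 0"
    using tan L(1)[of "\<i> *s w"] flat_deriv_one_pos ReH by simp
  then have "Im (fderiv H q w) = 0" by (simp add: holo_fun_scale[OF H(1,2)])
  ultimately have "fderiv H q w = 0" by (simp add: complex_eq_iff)
  then show "iter_dderiv (\<rho> i) [w, w] q + iter_dderiv (\<rho> i) [\<i> *s w, \<i> *s w] q \<ge> 0"
    using L(2)[of w] by simp
qed

text \<open>Room 2, against the 1 in \<open>tame\<close>, lets a whole ball about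
  \<open>X N q\<close> consist of images of tame points.\<close>

lemma roomy:
  assumes "norm (X 0 q) + 1 \<le> real N"
  shows "norm (X N q) + 2 \<le> Q N"
proof -
  define a where "a = norm (X 0 q) + 1"
  have "a \<ge> 1" by (simp add: a_def)
  have "norm (X N q) + 2 \<le> a ^ (2 ^ N) + 1" using X_growth[of N q] by (simp add: a_def)
  also have "\<dots> \<le> (a + 1) ^ (2 ^ N)"
  proof -
    have "a ^ m + 1 \<le> (a + 1) ^ m" if "m > 0" for m :: nat
      using that
    proof (induction m rule: nat_induct_non_zero)
      case (Suc n)
      have "a ^ Suc n + 1 \<le> (a + 1) * (a ^ n + 1)"
        using \<open>a \<ge> 1\<close> by (simp add: algebra_simps)
      also have "\<dots> \<le> (a + 1) * (a + 1) ^ n" using Suc \<open>a \<ge> 1\<close> by (intro mult_left_mono) auto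
      finally show ?case by simp
    qed simp
    then show ?thesis by simp
  qed
  also have "\<dots> \<le> Q N"
    unfolding Q_def using assms \<open>a \<ge> 1\<close> by (intro power_mono) (auto simp: a_def)
  finally show ?thesis .
qed

lemma U_eq_one_bounds:
  assumes "i \<noteq> e 0" "U i q = 1" "q \<in> tame N"
  shows "1 / 2 < cmod (X N q $ i)" "cmod (X N q $ i) < 2"
  using U_less_one[OF assms(1,3)] U_gt_one[OF assms(1,3)] assms(2) by force+

text \<open>Composed with \<open>inv (X N)\<close>, \<open>T\<close> is small and holomorphic on the
  ball of radius 1/4 about \<open>X N q\<close>; the ball lies over the chart since
  \<open>1 / 2 < cmod (X N q $ i)\<close>. Cauchy gives \<open>2 * \<epsilon> / (1 / 4)\<close>,
  with no estimate of the derivative of \<open>inv (X N)\<close>.\<close>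

lemma chart_derivative_bound:
  assumes i: "i \<noteq> e 0" and U1: "U i q = 1" and room: "norm (X N q) + 2 \<le> Q N"
    and T: "holo_fun (chart i q N) T" "\<And>z. z \<in> chart i q N \<Longrightarrow> cmod (T z) \<le> \<epsilon>"
  shows "cmod (fderiv T q (fderiv (inv (X N)) (X N q) w)) \<le> 8 * \<epsilon> * norm w"
proof -
  have qt: "q \<in> tame N" using room by (simp add: tame_def)
  note b = U_eq_one_bounds[OF i U1 qt]
  have ball: "inv (X N) w \<in> chart i q N" if "w \<in> ball (X N q) (1 / 4)" for w
  proof -
    have d: "norm (w - X N q) < 1 / 4" using that by (simp add: dist_norm norm_minus_commute)
    have "norm w \<le> norm (X N q) + norm (w - X N q)" by (metis add_diff_cancel_left' diff_add_cancel norm_triangle_ineq add.commute)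
    then have "norm w + 1 < Q N" using d room by linarith
    moreover have "cmod (w $ i - X N q $ i) \<le> norm (w - X N q)" using cmod_nth_le[of "w - X N q" i] by simp
    then have "cmod (w $ i - X N q $ i) < cmod (X N q $ i) / 2" using d b by linarith
    ultimately show ?thesis by (simp add: chart_def tame_def)
  qed
  have qS: "q \<in> chart i q N" using ball[of "X N q"] by simp
  let ?B = "ball (X N q) (1 / 4)"
  have holo: "holo_map ?B (inv (X N))" using X_inv_holo by (auto simp: holo_map_def)
  have comp: "holo_fun ?B (\<lambda>w. T (inv (X N) w))"
    by (rule holo_fun_comp_map[OF holo T(1)]) (use ball in blast)
  have "cmod (fderiv (\<lambda>w. T (inv (X N) w)) (X N q) w) \<le> 2 * \<epsilon> / (1 / 4) * norm w"
    by (rule holo_fun_Cauchy_bound[OF comp order_refl]) (use ball T(2) in auto)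
  moreover have "fderiv (\<lambda>w. T (inv (X N) w)) (X N q)
      = (\<lambda>w. fderiv T q (fderiv (inv (X N)) (X N q) w))"
  proof (rule frechet_derivative_at[symmetric])
    have "(T has_derivative fderiv T q) (at (inv (X N) (X N q)))"
      using holo_fun_has_derivative[OF T(1) qS] by simp
    from has_derivative_compose[OF holo_map_has_derivative[OF X_inv_holo UNIV_I] this]
    show "((\<lambda>w. T (inv (X N) w)) has_derivative
      (\<lambda>w. fderiv T q (fderiv (inv (X N)) (X N q) w))) (at (X N q))" .
  qed
  ultimately show ?thesis by simp
qed

text \<open>In the coordinates of the \<open>N\<close>-th iterate the differential of each
  \<open>\<rho> i\<close> is, up to a common factor, the real part of
  \<open>w $ i / X N q $ i\<close> plus a small error. The linear system for \<open>c\<close> is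
  thus diagonally dominant.\<close>

lemma transversality:
  assumes A: "finite A" "\<And>i. i \<in> A \<Longrightarrow> i \<noteq> e 0" "\<And>i. i \<in> A \<Longrightarrow> U i q = 1"
    and zero: "\<And>w. (\<Sum>i\<in>A. c i * fderiv (\<rho> i) q w) = 0" and "j \<in> A"
  shows "c j = 0"
proof -
  \<comment> \<open>Chosen so that all the errors together account for at most half of the sum of
    the \<open>\<bar>c i\<bar>\<close>.\<close>
  define \<epsilon> where "\<epsilon> = 1 / (32 * real (card A))"
  have card: "card A > 0" using A(1) \<open>j \<in> A\<close> card_gt_0_iff by blast
  then have "\<epsilon> > 0" by (simp add: \<epsilon>_def)
  obtain N0 where "norm (X 0 q) + 1 < real N0" using reals_Archimedean2 by blast
  have "\<forall>\<^sub>F n in sequentially. \<delta> n < \<epsilon> / 64" by (rule eventually_\<delta>_less) (use \<open>\<epsilon> > 0\<close> in simp)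
  with eventually_ge_at_top[of N0] have "\<forall>\<^sub>F n in sequentially. n \<ge> N0 \<and> \<delta> n < \<epsilon> / 64"
    by eventually_elim simp
  then obtain N where N: "N \<ge> N0" "64 * \<delta> N \<le> \<epsilon>" by (fastforce simp: eventually_sequentially)
  have room: "norm (X N q) + 2 \<le> Q N"
    using \<open>norm (X 0 q) + 1 < real N0\<close> N(1) by (intro roomy) simp
  then have qt: "q \<in> tame N" by (simp add: tame_def)
  define V where "V = fderiv (inv (X N)) (X N q)"
  define \<kappa> where "\<kappa> = flat (flat_deriv 1) 1"
  have "\<kappa> > 0" unfolding \<kappa>_def by (rule flat_deriv_one_pos)
  have "\<exists>T. (\<forall>v. fderiv (\<rho> i) q v
        = \<kappa> * (Re (fderiv (X N) q v $ i / X N q $ i + T v) / 2 ^ N)) \<and>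
      (\<forall>w. cmod (T (V w)) \<le> 8 * \<epsilon> * norm w)" if "i \<in> A" for i
  proof -
    have i: "i \<noteq> e 0" and U1: "U i q = 1" using A that by auto
    then have gt: "U i q > 1 / 4" by simp
    obtain H T where H: "holo_fun (chart i q N) H" "holo_fun (chart i q N) T" "q \<in> chart i q N"
      "\<And>z. z \<in> chart i q N \<Longrightarrow> cmod (T z) \<le> 64 * \<delta> N"
      "\<And>z. z \<in> chart i q N \<Longrightarrow> U i z > 0 \<and> ln (U i z) = Re (H z)"
      "\<And>v. fderiv H q v = (fderiv (X N) q v $ i / X N q $ i
        + fderiv T q v) / 2 ^ N"
      using holo_potential[OF i qt gt] by metis
    have \<rho>: "\<rho> i z = flat 1 (1 + Re (H z)) - flat 1 1" if "z \<in> chart i q N" for z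
      using H(5)[OF that] \<rho>_eq_flat[of i z] by simp
    have ReH: "Re (H q) = 0" using H(5)[OF H(3)] U1 by simp
    have half: "Re (a / 2 ^ N) = Re a / 2 ^ N" for a
    proof -
      have "a / 2 ^ N = a / of_real (2 ^ N)" by simp
      then show ?thesis by (simp only: Re_divide_of_real)
    qed
    have "fderiv (\<rho> i) q v = \<kappa> * (Re (fderiv (X N) q v $ i / X N q $ i
        + fderiv T q v) / 2 ^ N)" for v
    proof -
      have "fderiv (\<rho> i) q v = flat (flat_deriv 1) (1 + Re (H q)) * Re (fderiv H q v)"
        by (rule flat_re_Levi_form(1)[OF H(1,3) \<rho>])
      then show ?thesis unfolding H(6) half ReH \<kappa>_def by simp
    qed
    moreover have "cmod (fderiv T q (V w)) \<le> 8 * \<epsilon> * norm w" for w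
      unfolding V_def
    proof (rule chart_derivative_bound[OF i U1 room H(2)])
      show "cmod (T z) \<le> \<epsilon>" if "z \<in> chart i q N" for z using H(4)[OF that] N(2) by linarith
    qed
    ultimately show ?thesis by blast
  qed
  then obtain T where T: "\<And>i v. i \<in> A \<Longrightarrow> fderiv (\<rho> i) q v
        = \<kappa> * (Re (fderiv (X N) q v $ i / X N q $ i + T i v) / 2 ^ N)"
      "\<And>i w. i \<in> A \<Longrightarrow> cmod (T i (V w)) \<le> 8 * \<epsilon> * norm w" by metis
  have dX: "fderiv (X N) q (V w) = w" for w
    unfolding V_def by (rule holo_automorphism_derivative(2)[OF X_automorphism])
  have bound: "\<bar>c m\<bar> \<le> 16 * \<epsilon> * (\<Sum>i\<in>A. \<bar>c i\<bar>)" if "m \<in> A" for m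
  proof -
    \<comment> \<open>In this direction the main term is 1 for \<open>i = m\<close> and 0 otherwise,
      which isolates \<open>c m\<close>.\<close>
    define w :: "complex ^ 'n" where "w = axis m (X N q $ m)"
    note bm = U_eq_one_bounds[OF A(2)[OF that] A(3)[OF that] qt]
    have "norm w \<le> 2" using bm by (simp add: w_def norm_axis_complex)
    have val: "fderiv (\<rho> i) q (V w) = \<kappa> / 2 ^ N * ((if i = m then 1 else 0) + Re (T i (V w)))"
      if "i \<in> A" for i
    proof -
      have "w $ i / X N q $ i = (if i = m then 1 else 0)" using bm by (auto simp: w_def axis_def)
      then show ?thesis unfolding T(1)[OF that] dX by simp
    qed
    have "0 = (\<Sum>i\<in>A. c i * fderiv (\<rho> i) q (V w))" using zero by simp
    also have "\<dots> = (\<Sum>i\<in>A. \<kappa> / 2 ^ N * (c i * (if i = m then 1 else 0) + c i * Re (T i (V w))))"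
      by (intro sum.cong refl) (simp only: val, simp add: algebra_simps)
    also have "\<dots> = \<kappa> / 2 ^ N * ((\<Sum>i\<in>A. c i * (if i = m then 1 else 0)) + (\<Sum>i\<in>A. c i * Re (T i (V w))))"
      by (simp only: sum_distrib_left[symmetric] sum.distrib)
    also have "(\<Sum>i\<in>A. c i * (if i = m then 1 else 0)) = c m"
      using that A(1) by (simp add: if_distrib cong: if_cong)
    finally have "c m + (\<Sum>i\<in>A. c i * Re (T i (V w))) = 0" using \<open>\<kappa> > 0\<close> by simp
    then have "\<bar>c m\<bar> = \<bar>\<Sum>i\<in>A. c i * Re (T i (V w))\<bar>" by linarith
    also have "\<dots> \<le> (\<Sum>i\<in>A. \<bar>c i\<bar> * (16 * \<epsilon>))"
    proof (rule order_trans[OF sum_abs sum_mono])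
      fix i assume "i \<in> A"
      have "\<bar>Re (T i (V w))\<bar> \<le> 8 * \<epsilon> * norm w" using T(2)[OF \<open>i \<in> A\<close>] abs_Re_le_cmod order_trans by blast
      also have "\<dots> \<le> 8 * \<epsilon> * 2" using \<open>norm w \<le> 2\<close> \<open>\<epsilon> > 0\<close> by (intro mult_left_mono) auto
      finally show "\<bar>c i * Re (T i (V w))\<bar> \<le> \<bar>c i\<bar> * (16 * \<epsilon>)"
        unfolding abs_mult by (intro mult_left_mono) auto
    qed
    also have "\<dots> = 16 * \<epsilon> * (\<Sum>i\<in>A. \<bar>c i\<bar>)"
      by (simp only: sum_distrib_right[symmetric] mult.commute)
    finally show ?thesis .
  qed
  have "(\<Sum>i\<in>A. \<bar>c i\<bar>) \<le> (\<Sum>m\<in>A. 16 * \<epsilon> * (\<Sum>i\<in>A. \<bar>c i\<bar>))" by (intro sum_mono bound)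
  also have "\<dots> = (\<Sum>i\<in>A. \<bar>c i\<bar>) / 2" using card by (simp add: \<epsilon>_def)
  finally have "(\<Sum>i\<in>A. \<bar>c i\<bar>) \<le> 0" by simp
  moreover have "\<bar>c j\<bar> \<le> (\<Sum>i\<in>A. \<bar>c i\<bar>)" using A(1) \<open>j \<in> A\<close> by (intro member_le_sum) auto
  ultimately show ?thesis by simp
qed

text \<open>By \<open>U_less_one\<close> the set is a union of preimages of convex sets under
  iterates, all containing \<open>p\<close>.\<close>

lemma sublevel_connected:
  assumes i: "i \<noteq> e 0"
  shows "connected {z. U i z < 1}"
proof -
  \<comment> \<open>The time is shifted to \<open>Suc n\<close> because \<open>Q 0 = 1\<close> would
    leave an empty ball.\<close>
  define P where "P n = {w :: complex ^ 'n. cmod (w $ i) < 1 / 2} \<inter> ball 0 (Q (Suc n) - 1)" for n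
  have "convex {w :: complex ^ 'n. cmod (w $ i) < 1 / 2}"
  proof -
    have "{w :: complex ^ 'n. cmod (w $ i) < 1 / 2} = (\<lambda>w. w $ i) -` ball 0 (1 / 2)" by auto
    then show ?thesis
      by (simp add: convex_linear_vimage bounded_linear.linear[OF bounded_linear_vec_nth])
  qed
  then have conn: "connected (P n)" for n unfolding P_def by (intro convex_connected convex_Int convex_ball)
  have Q1: "Q (Suc n) > 1" for n unfolding Q_def by (intro one_less_power) auto
  have "{z. U i z < 1} = (\<Union>n. inv (X (Suc n)) ` P n)"
  proof (intro set_eqI iffI)
    fix z assume "z \<in> {z. U i z < 1}"
    then have "(\<lambda>n. cmod (X n z $ i)) \<longlonglongrightarrow> 0" using X_nth_tendsto_0[OF i] tendsto_norm_zero by blast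
    then have "\<forall>\<^sub>F n in sequentially. cmod (X n z $ i) < 1 / 2" by (rule order_tendstoD) simp
    with eventually_tame[of z] have "\<forall>\<^sub>F n in sequentially. z \<in> tame n \<and> cmod (X n z $ i) < 1 / 2"
      by eventually_elim simp
    then obtain N where "\<And>n. n \<ge> N \<Longrightarrow> z \<in> tame n \<and> cmod (X n z $ i) < 1 / 2"
      unfolding eventually_sequentially by blast
    from this[of "Suc N"] have "X (Suc N) z \<in> P N" by (simp add: P_def tame_def del: X.simps)
    then have "inv (X (Suc N)) (X (Suc N) z) \<in> inv (X (Suc N)) ` P N" by (rule imageI)
    then have "z \<in> inv (X (Suc N)) ` P N" by (simp only: X_inv)
    then show "z \<in> (\<Union>n. inv (X (Suc n)) ` P n)" by blast
  next
    fix z assume "z \<in> (\<Union>n. inv (X (Suc n)) ` P n)"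
    then obtain n w where "w \<in> P n" "z = inv (X (Suc n)) w" by blast
    then have "X (Suc n) z \<in> P n" by (simp only: X_inv)
    then have "z \<in> tame (Suc n)" "cmod (X (Suc n) z $ i) \<le> 1 / 2" by (auto simp: P_def tame_def simp del: X.simps)
    then show "z \<in> {z. U i z < 1}" using U_less_one[OF i] by blast
  qed
  moreover have "connected (\<Union>n. inv (X (Suc n)) ` P n)"
  proof (rule connected_Union)
    show "connected S" if "S \<in> range (\<lambda>n. inv (X (Suc n)) ` P n)" for S
      using that by (auto intro!: connected_continuous_image conn X_inv_continuous simp del: X.simps)
    have "p \<in> inv (X (Suc n)) ` P n" for n
    proof -
      have "inv (X (Suc n)) (X (Suc n) p) = p" by (rule X_inv)
      then have "p = inv (X (Suc n)) 0" by (simp only: X_p)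
      moreover have "0 \<in> P n" using Q1[of n] by (simp add: P_def)
      ultimately show ?thesis by blast
    qed
    then have "p \<in> (\<Inter>n. inv (X (Suc n)) ` P n)" by blast
    then show "(\<Inter>n. inv (X (Suc n)) ` P n) \<noteq> {}" by blast
  qed
  ultimately show ?thesis by simp
qed

lemma U_p: "i \<noteq> e 0 \<Longrightarrow> U i p < 1"
  using \<Omega>_eq \<Omega>_union p_in_B by blast

lemma \<Omega>_piecewise_smooth: "piecewise_smooth_domain \<Omega>"
proof -
  \<comment> \<open>Numbers the squared coordinates \<open>e 1\<close> to \<open>e (k - 1)\<close>
    from 0, as \<open>piecewise_smooth_domain\<close> indexes its functions.\<close>
  define \<iota> where "\<iota> j = e (Suc j)" for j
  have \<iota>0: "\<iota> j \<noteq> e 0" if "j < k - 1" for j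
  proof
    assume "\<iota> j = e 0"
    then have "idx (e (Suc j)) = idx (e 0)" by (simp add: \<iota>_def)
    then show False using that k2 by (simp add: idx_e)
  qed
  have idx_\<iota>: "idx (\<iota> j) - 1 = j" if "j < k - 1" for j using that by (simp add: \<iota>_def idx_e)
  have surj: "\<exists>j<k - 1. i = \<iota> j" if "i \<noteq> e 0" for i
  proof -
    have "idx i \<noteq> 0" using that e_idx[of i] by metis
    then show ?thesis using idx_less[of i] e_idx[of i]
      by (intro exI[of _ "idx i - 1"]) (auto simp: \<iota>_def)
  qed
  show ?thesis
    unfolding piecewise_smooth_domain_def
  proof (intro exI[of _ "k - 1"] exI[of _ "\<lambda>j. \<rho> (\<iota> j)"] conjI allI impI ballI)
    show "1 \<le> k - 1" using k2 by simp
    show "\<Omega> = (\<Inter>j<k - 1. {z. \<rho> (\<iota> j) z < 0})"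
      unfolding \<Omega>_eq \<rho>_neg_iff using surj \<iota>0 by auto
    fix j assume j: "j < k - 1"
    note i = \<iota>0[OF j]
    show "smooth_fun (\<rho> (\<iota> j))" by (rule \<rho>_smooth[OF i])
    show "connected {z. \<rho> (\<iota> j) z < 0}" unfolding \<rho>_neg_iff by (rule sublevel_connected[OF i])
    show "{z. \<rho> (\<iota> j) z < 0} \<noteq> {}" unfolding \<rho>_neg_iff using U_p[OF i] by blast
    show "levi_pseudoconvex (\<rho> (\<iota> j))" by (rule \<rho>_levi[OF i])
    fix q assume "q \<in> frontier {z. \<rho> (\<iota> j) z < 0}"
    then have "U (\<iota> j) q = 1" by (rule \<rho>_frontier[OF i])
    \<comment> \<open>For a single function with coefficient 1, transversality says that the
      differential is nonzero.\<close>
    then show "\<exists>w. fderiv (\<rho> (\<iota> j)) q w \<noteq> 0"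
      using transversality[of "{\<iota> j}" q "\<lambda>_. 1" "\<iota> j"] i by auto
  next
    fix S q c j
    assume S: "S \<subseteq> {..<k - 1}" and zero: "\<forall>i\<in>S. \<rho> (\<iota> i) q = 0"
      and sum: "\<forall>w. (\<Sum>i\<in>S. c i * fderiv (\<rho> (\<iota> i)) q w) = 0" and j: "j \<in> S"
    have "finite S" using S finite_subset by blast
    have inj: "inj_on \<iota> S"
      by (rule inj_on_inverseI[of _ "\<lambda>i. idx i - 1"]) (use S idx_\<iota> in auto)
    have "c (idx (\<iota> j) - 1) = 0"
    proof (rule transversality[of "\<iota> ` S" q "\<lambda>i. c (idx i - 1)" "\<iota> j"])
      show "finite (\<iota> ` S)" using \<open>finite S\<close> by simp
      show "i \<noteq> e 0" if "i \<in> \<iota> ` S" for i using that S \<iota>0 by auto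
      show "U i q = 1" if "i \<in> \<iota> ` S" for i using that zero \<rho>_zero_iff by blast
      show "(\<Sum>i\<in>\<iota> ` S. c (idx i - 1) * fderiv (\<rho> i) q w) = 0" for w
      proof -
        have "(\<Sum>i\<in>\<iota> ` S. c (idx i - 1) * fderiv (\<rho> i) q w)
            = (\<Sum>i\<in>S. c i * fderiv (\<rho> (\<iota> i)) q w)"
          unfolding sum.reindex[OF inj] comp_def by (intro sum.cong refl) (use S idx_\<iota> in auto)
        then show ?thesis using sum by simp
      qed
    qed (use j in simp)
    then show "c j = 0" using idx_\<iota>[of j] S j by auto
  qed
qed

section \<open>Escape and conjugation\<close>

text \<open>Squaring a maximal \<open>M \<ge> 3\<close> gives at least \<open>3 * M\<close> and the
  coupling costs at most \<open>M\<close>. The coordinate \<open>e 0\<close> receives only a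
  coupling term of size at most \<open>M\<close>, so the new maximum lies elsewhere.\<close>

lemma escaping_F:
  assumes "escaping (e 0) w" "0 < h" "h \<le> 1 / 100"
  shows "escaping (e 0) (F h w)"
proof -
  obtain i where i: "i \<noteq> e 0" "3 \<le> cmod (w $ i)" "\<And>j. cmod (w $ j) \<le> cmod (w $ i)"
    using assms(1) by (auto simp: escaping_def)
  define M where "M = cmod (w $ i)"
  have h: "cmod (of_real h * w $ j) \<le> M" for j
  proof -
    have "h * cmod (w $ j) \<le> 1 * M" using assms i(3) by (intro mult_mono) (auto simp: M_def)
    then show ?thesis using assms by (simp add: norm_mult)
  qed
  have big: "cmod (F h w $ i) \<ge> 2 * M"
  proof -
    have "M * 3 \<le> M * M" using i(2) by (intro mult_left_mono) (auto simp: M_def)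
    moreover have "cmod ((w $ i)\<^sup>2) = M * M" by (simp add: M_def norm_mult power2_eq_square)
    moreover have "cmod ((w $ i)\<^sup>2) - cmod (of_real h * w $ \<sigma> i) \<le> cmod (F h w $ i)"
      using norm_diff_ineq[of "(w $ i)\<^sup>2" "of_real h * w $ \<sigma> i"] i(1) by (simp add: F_def)
    ultimately show ?thesis using h[of "\<sigma> i"] by linarith
  qed
  obtain m where m: "\<And>j. cmod (F h w $ j) \<le> cmod (F h w $ m)"
    using obtain_max_component[of "F h w"] by blast
  have "M \<ge> 3" using i(2) by (simp add: M_def)
  have "m \<noteq> e 0"
  proof
    assume "m = e 0"
    then have "cmod (F h w $ m) \<le> M" using h by (simp add: F_def)
    then show False using m[of i] big \<open>M \<ge> 3\<close> by linarith
  qed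
  moreover have "3 \<le> cmod (F h w $ m)" using m[of i] big \<open>M \<ge> 3\<close> by linarith
  ultimately show ?thesis using m by (auto simp: escaping_def)
qed

lemma escaping_not_in_\<Omega>:
  assumes "escaping (e 0) (X 0 z)"
  shows "z \<notin> \<Omega>"
proof
  assume "z \<in> \<Omega>"
  have esc: "escaping (e 0) (X n z)" for n
    by (induction n) (use assms escaping_F \<eta>_pos \<eta>_le in auto)
  from \<open>z \<in> \<Omega>\<close> have "\<forall>\<^sub>F n in sequentially. norm (X n z) < 3" by (rule eventually_norm_X_less) simp
  then obtain n where n: "norm (X n z) < 3" by (auto simp: eventually_sequentially)
  obtain i where "3 \<le> cmod (X n z $ i)" using esc[of n] by (auto simp: escaping_def)
  then show False using n cmod_nth_le[of "X n z" i] by linarith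
qed

text \<open>Conjugation by \<open>\<Psi>\<close> makes all maps fix \<open>p\<close>, and
  compositions telescope. Since \<open>comp_seq\<close> starts with one map already applied, its
  \<open>n\<close>-th term corresponds to \<open>X (Suc n)\<close>.\<close>

definition G :: "nat \<Rightarrow> complex ^ 'n \<Rightarrow> complex ^ 'n" where
  "G n z = inv \<Psi> (F (\<eta> n) (\<Psi> z))"

lemma \<Psi>_inv [simp]: "inv \<Psi> (\<Psi> z) = z" "\<Psi> (inv \<Psi> z) = z"
  using X_inv[of 0] by simp_all

lemma comp_seq_G: "comp_seq G n z = inv \<Psi> (X (Suc n) z)"
  by (induction n) (simp_all add: G_def)

lemma basin_G: "basin G p = \<Omega>"
proof (intro set_eqI iffI)
  have \<Psi>_cont: "isCont \<Psi> x" "isCont (inv \<Psi>) x" for x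
    using X_continuous[of UNIV 0] X_inv_continuous[of UNIV 0] by (auto simp: continuous_on_eq_continuous_at)
  fix z
  show "z \<in> \<Omega>" if "z \<in> basin G p"
  proof -
    have "(\<lambda>n. comp_seq G n z) \<longlonglongrightarrow> p" using that by (simp add: basin_def)
    from isCont_tendsto_compose[OF \<Psi>_cont(1) this] have "(\<lambda>n. X (Suc n) z) \<longlonglongrightarrow> 0"
      by (simp only: comp_seq_G p_def \<Psi>_inv)
    then have "(\<lambda>n. X n z) \<longlonglongrightarrow> 0" by (rule LIMSEQ_imp_Suc)
    then show ?thesis by (simp add: \<Omega>_def)
  qed
  show "z \<in> basin G p" if "z \<in> \<Omega>"
  proof -
    have "(\<lambda>n. X n z) \<longlonglongrightarrow> 0" using that by (simp add: \<Omega>_def)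
    then have "(\<lambda>n. X (Suc n) z) \<longlonglongrightarrow> 0" by (rule LIMSEQ_Suc)
    from isCont_tendsto_compose[OF \<Psi>_cont(2) this] show ?thesis
      by (simp only: basin_def comp_seq_G p_def mem_Collect_eq)
  qed
qed

lemma G_automorphism: "holo_automorphism (G n)"
proof -
  note F = F_automorphism[OF \<eta>_pos[of n]]
  have \<Psi>: "holo_map UNIV \<Psi>" "holo_map UNIV (inv \<Psi>)" "bij \<Psi>" using \<Psi> by (auto simp: holo_automorphism_def)
  have F': "holo_map UNIV (F (\<eta> n))" "holo_map UNIV (inv (F (\<eta> n)))" "bij (F (\<eta> n))"
    using F by (auto simp: holo_automorphism_def)
  have F_inv: "inv (F (\<eta> n)) (F (\<eta> n) z) = z" "F (\<eta> n) (inv (F (\<eta> n)) z) = z" for z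
    using F'(3) by (simp_all add: bij_is_inj bij_is_surj surj_f_inv_f)
  define G' where "G' w = inv \<Psi> (inv (F (\<eta> n)) (\<Psi> w))" for w
  have inverse: "G' (G n z) = z" "G n (G' z) = z" for z by (simp_all add: G_def G'_def F_inv)
  then have "bij (G n)" by (intro o_bij[of G']) (auto simp: fun_eq_iff)
  moreover have "inv (G n) = G'" using inverse by (rule inv_equality)
  moreover have "holo_map UNIV (G n)"
    unfolding G_def[abs_def]
    by (rule holo_map_comp[OF holo_map_comp[OF \<Psi>(1) F'(1)] \<Psi>(2)]) auto
  moreover have "holo_map UNIV G'"
    unfolding G'_def[abs_def]
    by (rule holo_map_comp[OF holo_map_comp[OF \<Psi>(1) F'(2)] \<Psi>(2)]) auto
  ultimately show ?thesis by (simp add: holo_automorphism_def)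
qed

text \<open>The derivative at \<open>p\<close> is conjugate to \<open>\<eta> n\<close> times a
  permutation of the coordinates, so all eigenvalues have modulus \<open>\<eta> n\<close>.\<close>

lemma G_attracting: "attracting_fixed_point (G n) p"
  unfolding attracting_fixed_point_def
proof (intro conjI allI impI)
  show "G n p = p" by (simp add: G_def p_def F_0)
  fix \<mu> v assume v: "v \<noteq> 0 \<and> fderiv (G n) p v = \<mu> *s v"
  have \<Psi>': "holo_map UNIV \<Psi>" "holo_map UNIV (inv \<Psi>)" using \<Psi> by (auto simp: holo_automorphism_def)
  let ?L = "fderiv \<Psi> p" and ?L' = "fderiv (inv \<Psi>) 0"
  have \<Psi>p: "\<Psi> p = 0" by (simp add: p_def)
  have "(F (\<eta> n) has_derivative dF (\<eta> n) 0) (at (\<Psi> p))" unfolding \<Psi>p by (rule F_has_derivative)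
  note d = has_derivative_compose[OF holo_map_has_derivative[OF \<Psi>'(1) UNIV_I] this]
  have "(inv \<Psi> has_derivative ?L') (at (F (\<eta> n) (\<Psi> p)))"
    unfolding \<Psi>p F_0 by (rule holo_map_has_derivative[OF \<Psi>'(2) UNIV_I])
  from has_derivative_compose[OF d this]
  have "(G n has_derivative (\<lambda>v. ?L' (dF (\<eta> n) 0 (?L v)))) (at p)" by (simp add: G_def[abs_def])
  from fun_cong[OF frechet_derivative_at[OF this], of v] v have "?L' (dF (\<eta> n) 0 (?L v)) = \<mu> *s v" by simp
  then have "?L (?L' (dF (\<eta> n) 0 (?L v))) = \<mu> *s ?L v"
    using holo_map_scale[OF \<Psi>'(1) UNIV_I] by metis
  moreover have "?L (?L' w) = w" for w using holo_automorphism_derivative(2)[OF \<Psi>, of p w] by (simp add: \<Psi>p)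
  ultimately have eig: "dF (\<eta> n) 0 (?L v) = \<mu> *s ?L v" by simp
  have "dF (\<eta> n) 0 (?L v) = of_real (\<eta> n) *s (\<chi> i. ?L v $ \<sigma> i)" by (simp add: dF_def vec_eq_iff)
  then have "norm (dF (\<eta> n) 0 (?L v)) = \<eta> n * norm (?L v)"
    using \<eta>_pos[of n] by (simp add: norm_vector_scalar_mult norm_\<sigma>)
  then have "\<eta> n * norm (?L v) = cmod \<mu> * norm (?L v)" unfolding eig by (simp only: norm_vector_scalar_mult)
  moreover have "?L v \<noteq> 0"
  proof
    assume "?L v = 0"
    moreover have "?L' (?L v) = v" using holo_automorphism_derivative(1)[OF \<Psi>, of p v] by (simp add: \<Psi>p)
    moreover have "linear ?L'" by (rule has_derivative_linear[OF holo_map_has_derivative[OF \<Psi>'(2) UNIV_I]])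
    ultimately show False using v linear_0 by metis
  qed
  ultimately have "cmod \<mu> = \<eta> n" by simp
  then show "cmod \<mu> < 1" using \<eta>_le[of n] by simp
qed

end

theorem theorem1p6:
  fixes V :: "(complex ^ 'n) set"
  assumes "CARD('n) \<ge> 3"
    and "algebraic_variety_codim V 2"
  shows "\<exists>(p :: complex ^ 'n) (F :: nat \<Rightarrow> (complex ^ 'n \<Rightarrow> complex ^ 'n)).
           (\<forall>n. holo_automorphism (F n) \<and> attracting_fixed_point (F n) p) \<and>
           short_Ck (basin F p) \<and> piecewise_smooth_domain (basin F p) \<and>
           basin F p \<inter> V = {}"
proof -
  obtain i0 \<Psi> where coords: "holo_automorphism \<Psi>" "\<And>i. (\<lambda>z. \<Psi> z $ i) \<in> poly_fun"
    "\<And>z. z \<in> V \<Longrightarrow> escaping i0 (\<Psi> z)"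
    by (rule affine_coordinates_avoiding_variety[OF assms(2,1)]) (rule that)
  obtain f :: "nat \<Rightarrow> 'n" where f: "bij_betw f {..<CARD('n)} UNIV"
    using ex_bij_betw_nat_finite[of "UNIV :: 'n set"] by (auto simp: atLeast0LessThan)
  have "i0 \<in> f ` {..<CARD('n)}" using bij_betw_imp_surj_on[OF f] by simp
  then obtain m where m: "m < CARD('n)" "f m = i0" by auto
  \<comment> \<open>The transposition makes the distinguished index \<open>i0\<close> the unsquared
    coordinate \<open>e 0\<close>.\<close>
  define e where "e = f \<circ> Transposition.transpose 0 m"
  have "bij_betw (Transposition.transpose 0 m) {..<CARD('n)} {..<CARD('n)}"
    using m assms(1) by simp
  then have e: "bij_betw e {..<CARD('n)} UNIV" unfolding e_def using f by (rule bij_betw_trans)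
  interpret short_dynamics e \<Psi> by unfold_locales (use e coords assms(1) in auto)
  have "e 0 = i0" using m by (simp add: e_def)
  have "z \<notin> \<Omega>" if "z \<in> V" for z
    using escaping_not_in_\<Omega>[of z] coords(3)[OF that] \<open>e 0 = i0\<close> by simp
  then show ?thesis
    using G_automorphism G_attracting basin_G \<Omega>_short \<Omega>_piecewise_smooth
    by (intro exI[of _ p] exI[of _ G]) auto
qed

end
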